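(* Let $N\geq 1$ be an integer, $p>1$, $q\geq 1$, $\alpha\geq 1$ and $\varrho>-1$ be real numbers, and suppose that $q>\frac{N(p-1)}{2}$. Then the initial value problem $$\partial_t u-\Delta u=\|u(t)\|_q^{\alpha}|u|^p+t^{\varrho}\,\mathbf{w}(x)\ \text{ in }\mathbb{R}^N\times(0,\infty),\qquad u(x,0)=u_0(x)\ \text{ in }\mathbb{R}^N,$$ is locally well-posed in $L^q(\mathbb{R}^N)$. More precisely, given $u_0,\mathbf{w}\in L^q(\mathbb{R}^N)$, there exist $T>0$ and a unique mild solution $u\in C([0,T],L^q(\mathbb{R}^N))$ of this problem.
   Context: Here $\|\cdot\|_q$ denotes the norm of $L^q(\mathbb{R}^N)$, and $\|u(t)\|_q=\|u(\cdot,t)\|_{L^q(\mathbb{R}^N)}$. Let $\mathbf{S}(t)=e^{t\Delta}$ be the heat semigroup on $\mathbb{R}^N$: $\mathbf{S}(t)\varphi=G(\cdot,t)\star\varphi$ with $G(x,t)=(4\pi t)^{-N/2}e^{-|x|^2/(4t)}$ for $t>0$, and $\mathbf{S}(0)=\mathrm{Id}$. A mild solution on $[0,T]$ is a function $u$ satisfying the integral (Duhamel) equation $$u(t)=\mathbf{S}(t)u_0+\int_0^t\mathbf{S}(t-\tau)\big(\|u(\tau)\|_q^{\alpha}|u(\tau)|^p\big)\,d\tau+\int_0^t\tau^{\varrho}\,\mathbf{S}(t-\tau)\mathbf{w}\,d\tau,\qquad t\in[0,T].$$ *)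

theory Defs
  imports "HOL-Analysis.Analysis"
begin

text \<open>
  Elements of $L^q(\mathbb{R}^N)$ are represented by Borel functions on \<open>real ^ 'n\<close> with
  \<open>N = CARD('n)\<close>, two functions being identified if they agree almost everywhere.
\<close>

definition Lq :: "real \<Rightarrow> (real ^ 'n \<Rightarrow> real) set" where
  "Lq q = {f \<in> borel_measurable lborel. integrable lborel (\<lambda>x. \<bar>f x\<bar> powr q)}"

definition Lq_norm :: "real \<Rightarrow> (real ^ 'n \<Rightarrow> real) \<Rightarrow> real" where
  "Lq_norm q f = (LINT x|lborel. \<bar>f x\<bar> powr q) powr (1 / q)"

definition continuous_Lq :: "real \<Rightarrow> real \<Rightarrow> (real \<Rightarrow> real ^ 'n \<Rightarrow> real) \<Rightarrow> bool" where
  "continuous_Lq q T u \<longleftrightarrow>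
     (\<forall>t\<in>{0..T}. u t \<in> Lq q) \<and>
     (\<forall>t\<in>{0..T}. ((\<lambda>s. Lq_norm q (\<lambda>x. u s x - u t x)) \<longlongrightarrow> 0) (at t within {0..T}))"

definition heat_kernel :: "real \<Rightarrow> real ^ 'n \<Rightarrow> real" where
  "heat_kernel t x = (4 * pi * t) powr (- real CARD('n) / 2) * exp (- (norm x)\<^sup>2 / (4 * t))"

definition heat_semigroup :: "real \<Rightarrow> (real ^ 'n \<Rightarrow> real) \<Rightarrow> real ^ 'n \<Rightarrow> real" where
  "heat_semigroup t \<phi> x =
     (if t = 0 then \<phi> x else (LINT y|lborel. heat_kernel t (x - y) * \<phi> y))"

text \<open>
  The Bochner integral of a non-integrable function is 0 by convention. As $|u(\tau)|^p$ need not
  be locally integrable when $q < p$, convergence of the convolution has to be demanded explicitly.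
\<close>

definition heat_semigroup_defined :: "real \<Rightarrow> (real ^ 'n \<Rightarrow> real) \<Rightarrow> real ^ 'n \<Rightarrow> bool" where
  "heat_semigroup_defined t \<phi> x \<longleftrightarrow>
     t = 0 \<or> integrable lborel (\<lambda>y. heat_kernel t (x - y) * \<phi> y)"

definition nonlinearity ::
    "real \<Rightarrow> real \<Rightarrow> real \<Rightarrow> (real ^ 'n \<Rightarrow> real) \<Rightarrow> real ^ 'n \<Rightarrow> real" where
  "nonlinearity q \<alpha> p v = (\<lambda>y. Lq_norm q v powr \<alpha> * \<bar>v y\<bar> powr p)"

text \<open>
  The Duhamel equation is read, for every time $t$, as an identity for almost every $x$, and all
  integrals in it are required to converge absolutely. The time integrals are iterated, so that
  each condition depends only on the classes of the functions $u(\tau)$ modulo null sets; no joint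
  measurability of the chosen representatives in $(\tau, x)$ is needed.
\<close>

definition mild_solution ::
    "real \<Rightarrow> real \<Rightarrow> real \<Rightarrow> real \<Rightarrow> (real ^ 'n \<Rightarrow> real) \<Rightarrow> (real ^ 'n \<Rightarrow> real) \<Rightarrow> real \<Rightarrow>
     (real \<Rightarrow> real ^ 'n \<Rightarrow> real) \<Rightarrow> bool" where
  "mild_solution q \<alpha> p \<rho> w u0 T u \<longleftrightarrow>
     (\<forall>t\<in>{0..T}. AE x in lborel.
        heat_semigroup_defined t u0 x \<and>
        (AE \<tau> in lborel. \<tau> \<in> {0..t} \<longrightarrow>
           heat_semigroup_defined (t - \<tau>) (nonlinearity q \<alpha> p (u \<tau>)) x \<and>
           heat_semigroup_defined (t - \<tau>) w x) \<and>
        set_integrable lborel {0..t}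
          (\<lambda>\<tau>. heat_semigroup (t - \<tau>) (nonlinearity q \<alpha> p (u \<tau>)) x) \<and>
        set_integrable lborel {0..t} (\<lambda>\<tau>. \<tau> powr \<rho> * heat_semigroup (t - \<tau>) w x) \<and>
        u t x = heat_semigroup t u0 x
          + (LINT \<tau>:{0..t}|lborel. heat_semigroup (t - \<tau>) (nonlinearity q \<alpha> p (u \<tau>)) x)
          + (LINT \<tau>:{0..t}|lborel. \<tau> powr \<rho> * heat_semigroup (t - \<tau>) w x))"

end

theory Submission
  imports Defs "HOL-Probability.Distributions"
begin

text \<open>
  Everything rests on a pointwise majorant. Let \<open>\<phi> = |u0|\<^sup>q + |w|\<^sup>q\<close>,
  \<open>K(t) = (S(t) \<phi>)\<^sup>1\<^sup>/\<^sup>q\<close> and \<open>B(t) = K(t) + \<integral> \<sigma>\<^sup>\<rho> K(t - \<sigma>) d\<sigma>\<close>. By Jensen's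
  inequality \<open>S(s) K(t) \<le> K(s + t)\<close>, and by smoothing \<open>K(t)\<^sup>p \<le> c t\<^sup>-\<^sup>\<kappa> K(t)\<close> with
  \<open>\<kappa> = N (p - 1) / (2 q) < 1\<close>; hence the Duhamel integral of \<open>B\<^sup>p\<close> is at most
  \<open>C t\<^sup>1\<^sup>-\<^sup>\<kappa> B(t)\<close> at every point, and the Duhamel map is a contraction on functions bounded by
  \<open>2 B\<close>, in the norm \<open>sup |U| / B\<close>.

  For uniqueness, freeze the coefficient \<open>a(t) = \<parallel>v(t)\<parallel>\<^sub>q\<^sup>\<alpha>\<close> of an arbitrary solution \<open>v\<close>
  and compare \<open>v\<close> with the fixed point \<open>U\<close> of the frozen equation. The difference satisfies
  \<open>z \<le> \<integral> S(t - \<tau>) (W z) d\<tau>\<close> with \<open>W = p a (|v|\<^sup>p\<^sup>-\<^sup>1 + |U|\<^sup>p\<^sup>-\<^sup>1)\<close>. When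
  \<open>q < p\<close>, nothing is known about \<open>a |v|\<^sup>p\<close> except that its Duhamel integral is bounded in
  \<open>L\<^sup>q\<close>; but this already makes \<open>W\<close> small in a space-time Kato class, so that testing with an
  exponentially decaying weight gives \<open>z = 0\<close>. Thus \<open>v\<close> is bounded by \<open>2 B\<close>, where the
  contraction applies to the nonlocal equation.
\<close>

section \<open>Real powers of extended nonnegative reals\<close>

text \<open>Uniqueness is claimed in all of \<open>C([0,T], L^q)\<close>, where for
  \<open>q < p\<close> nothing makes \<open>|v|^p\<close> locally integrable; an argument in an
  auxiliary space of higher integrability would only compare solutions already known to lie in it.
  The substitute is the equation itself: the Duhamel integral of \<open>a |v|^p\<close> equals
  \<open>v - h\<close>, with \<open>h\<close> the linear evolution, and so stays bounded in
  \<open>L^q\<close>. \<open>W\<close> is estimated through \<open>(a |v|^p)^\<beta>\<close> with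
  \<open>\<beta> = (p - 1) / p\<close>; Jensen in time against smoothing leaves a power
  \<open>s^e\<close> on the time scale \<open>s\<close>, and \<open>e = (1 - \<kappa>) / p\<close>
  is positive exactly when \<open>\<kappa> < 1\<close>. The coefficient is frozen first because the
  difference of two nonlocal coefficients depends on whole functions and does not fit a pointwise
  inequality with kernel \<open>W\<close>. Freezing needs \<open>a\<close> bounded, which for an
  arbitrary \<open>v\<close> is known only until its norm first exceeds \<open>2 b + 1\<close>,
  where \<open>b\<close> bounds the norm of \<open>B\<close>; up to then \<open>v\<close> is the
  solution below \<open>2 B\<close>, of norm at most \<open>2 b\<close>, so that time never
  comes.\<close>

definition epow :: "ennreal \<Rightarrow> real \<Rightarrow> ennreal" where
  "epow x a = (if x = top then top else ennreal (enn2real x powr a))"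

lemma epow_top [simp]: "epow top a = top"
  by (simp add: epow_def)

lemma epow_ennreal [simp]: "0 \<le> r \<Longrightarrow> epow (ennreal r) a = ennreal (r powr a)"
  by (simp add: epow_def)

lemma epow_0 [simp]: "epow 0 a = 0"
  by (simp add: epow_def)

lemma epow_1 [simp]: "epow x 1 = x"
  by (cases x) (auto simp: epow_def)

lemma epow_eq_top_iff [simp]: "epow x a = top \<longleftrightarrow> x = top"
  by (simp add: epow_def)

lemma epow_less_top_iff [simp]: "epow x a < top \<longleftrightarrow> x < top"
  by (simp add: epow_def top.not_eq_extremum)

lemma epow_eq_0_iff [simp]: "epow x a = 0 \<longleftrightarrow> x = 0"
  by (cases x) (auto simp: epow_def)

lemma epow_mono: "x \<le> y \<Longrightarrow> 0 \<le> a \<Longrightarrow> epow x a \<le> epow y a"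
  by (cases x; cases y) (auto simp: epow_def powr_mono2 top_unique)

text \<open>Holds without side conditions because \<open>epow\<close> keeps 0 and \<open>top\<close>
  fixed for every exponent, in agreement with \<open>0 * top = 0\<close>.\<close>

lemma epow_mult: "epow (x * y) a = epow x a * epow y a"
proof (cases x; cases y)
  fix r s assume "x = ennreal r" "0 \<le> r" "y = ennreal s" "0 \<le> s"
  then show ?thesis by (simp add: ennreal_mult[symmetric] powr_mult)
next
  fix r assume *: "x = ennreal r" "0 \<le> r" "y = top"
  then show ?thesis by (cases "r = 0") (auto simp: ennreal_mult_top)
next
  fix r assume *: "x = top" "0 \<le> r" "y = ennreal r"
  then show ?thesis by (cases "r = 0") (auto simp: ennreal_top_mult)
qed simp

lemma epow_epow: "epow (epow x a) b = epow x (a * b)"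
  by (cases x) (auto simp: powr_powr)

lemma epow_add: "epow x (a + b) = epow x a * epow x b"
  by (cases x) (auto simp: powr_add ennreal_mult)

text \<open>Lets an \<open>L^q\<close> bound control an integral against a weight of finite mass, as
  in \<open>duhamel_decay_finite\<close>.\<close>

lemma epow_le_1_plus: "1 \<le> r \<Longrightarrow> x \<le> 1 + epow x r"
proof (cases x)
  fix s assume r: "1 \<le> r" and s: "x = ennreal s" "0 \<le> s"
  have "s \<le> 1 + s powr r"
  proof (cases "s \<le> 1")
    case False
    then have "s powr 1 \<le> s powr r" using r by (intro powr_mono) auto
    with False show ?thesis by simp
  qed (simp add: add_increasing2)
  then have "ennreal s \<le> ennreal (1 + s powr r)" by (rule ennreal_leI)
  then show ?thesis using s by (simp flip: ennreal_1 add: ennreal_plus)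
qed simp

lemma measurable_epow [measurable (raw)]:
  "f \<in> borel_measurable M \<Longrightarrow> (\<lambda>x. epow (f x) a) \<in> borel_measurable M"
proof -
  assume [measurable]: "f \<in> borel_measurable M"
  have [measurable]: "{x \<in> space M. f x = top} \<in> sets M"
    using measurable_sets[of f M borel "{top}"] by (simp add: vimage_def Int_def conj_commute)
  show ?thesis
    unfolding epow_def by (intro measurable_If) measurable
qed

text \<open>The graph of a convex power lies above its tangent at \<open>s\<close>; Young's
  inequality for the conjugate exponents \<open>r\<close> and \<open>r / (r - 1)\<close> gives this
  without differentiating. It is the common source of the inequalities of Jensen and Minkowski and
  of the Lipschitz bounds for powers below.\<close>

lemma powr_tangent:
  fixes x s r :: real
  assumes "1 \<le> r" "0 \<le> x" "0 < s"
  shows "r * s powr (r - 1) * x \<le> x powr r + (r - 1) * s powr r"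
proof (cases "r = 1")
  case False
  define r' where "r' = r / (r - 1)"
  have r: "r > 1" "r' > 1" "1 / r + 1 / r' = 1"
    using assms False by (auto simp: r'_def field_simps)
  have "x * s powr (r - 1) \<le> x powr r / r + (s powr (r - 1)) powr r' / r'"
    using r assms by (intro Youngs_inequality) auto
  also have "(s powr (r - 1)) powr r' = s powr r"
    using r by (simp add: powr_powr r'_def)
  finally have "r * (x * s powr (r - 1)) \<le> r * (x powr r / r + s powr r / r')"
    using r by (intro mult_left_mono) auto
  also have "\<dots> = x powr r + (r - 1) * s powr r"
    using r by (simp add: r'_def field_simps)
  finally show ?thesis by (simp add: mult_ac)
qed (use assms in simp)

text \<open>Integrating the tangent inequality \<open>r s\<^sup>r\<^sup>-\<^sup>1 f \<le> f\<^sup>r + (r - 1) s\<^sup>r\<close> at the mean value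
  \<open>s\<close> of \<open>f\<close> gives Jensen's inequality.\<close>

lemma nn_integral_jensen:
  fixes f k :: "'a \<Rightarrow> ennreal"
  assumes [measurable]: "k \<in> borel_measurable M" "f \<in> borel_measurable M"
    and mass: "(\<integral>\<^sup>+x. k x \<partial>M) \<le> ennreal c" and c: "0 < c" and r: "1 \<le> r"
  shows "epow (\<integral>\<^sup>+x. k x * f x \<partial>M) r \<le> ennreal (c powr (r - 1)) * (\<integral>\<^sup>+x. k x * epow (f x) r \<partial>M)"
proof (cases "(\<integral>\<^sup>+x. k x * epow (f x) r \<partial>M)")
  case top
  then show ?thesis using c by (simp add: ennreal_mult_top)
next
  case (real J)
  have tang: "ennreal (r * s powr (r - 1)) * (\<integral>\<^sup>+x. k x * f x \<partial>M)
      \<le> ennreal J + ennreal ((r - 1) * s powr r * c)" if s: "0 < s" for s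
  proof -
    have pt: "ennreal (r * s powr (r - 1)) * f x \<le> epow (f x) r + ennreal ((r - 1) * s powr r)" for x
    proof (cases "f x")
      case (real y)
      then show ?thesis
        using powr_tangent[OF r, of y s] s r
        by (simp add: ennreal_mult[symmetric] ennreal_plus[symmetric] del: ennreal_plus)
    qed simp
    have "ennreal (r * s powr (r - 1)) * (\<integral>\<^sup>+x. k x * f x \<partial>M)
        = (\<integral>\<^sup>+x. k x * (ennreal (r * s powr (r - 1)) * f x) \<partial>M)"
      by (subst nn_integral_cmult[symmetric]) (auto simp: mult_ac)
    also have "\<dots> \<le> (\<integral>\<^sup>+x. k x * (epow (f x) r + ennreal ((r - 1) * s powr r)) \<partial>M)"
      by (intro nn_integral_mono mult_left_mono pt) auto
    also have "\<dots> = (\<integral>\<^sup>+x. k x * epow (f x) r \<partial>M) + ennreal ((r - 1) * s powr r) * (\<integral>\<^sup>+x. k x \<partial>M)"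
      by (simp add: distrib_left nn_integral_add nn_integral_multc mult.commute[of "ennreal ((r - 1) * s powr r)"])
    also have "\<dots> \<le> ennreal J + ennreal ((r - 1) * s powr r) * ennreal c"
      using real mass by (intro add_mono mult_left_mono) auto
    also have "\<dots> = ennreal J + ennreal ((r - 1) * s powr r * c)"
      using c r by (simp add: ennreal_mult)
    finally show ?thesis .
  qed
  show ?thesis
  proof (cases "(\<integral>\<^sup>+x. k x * f x \<partial>M)")
    case top
    \<comment> \<open>An infinite mean would make the left side of the tangent inequality at
      \<open>s = 1\<close> infinite, while its right side is finite.\<close>
    with tang[of 1] r show ?thesis by (simp add: ennreal_mult_top ennreal_plus[symmetric] top_unique del: ennreal_plus)
  next
    case I: (real I)
    show ?thesis
    proof (cases "I = 0")
      case False
      \<comment> \<open>\<open>c\<close> only bounds the mass of \<open>k\<close>. As the constant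
        term of the tangent inequality is nonnegative, \<open>tang\<close> could replace the mass by
        \<open>c\<close>, and the point of tangency is the mean formed with
        \<open>c\<close>.\<close>
      define s where "s = I / c"
      have s: "0 < s" "I = s * c" using I(1) False c by (auto simp: s_def)
      have "r * s powr (r - 1) * I \<le> J + (r - 1) * s powr r * c"
        using tang[OF s(1)] I s c r real
        by (simp add: ennreal_mult[symmetric] ennreal_plus[symmetric] del: ennreal_plus)
      also have "r * s powr (r - 1) * I = r * (s powr r * c)"
        using s by (simp add: powr_diff)
      finally have "s powr r * c \<le> J" by (simp add: algebra_simps)
      then have "c powr (r - 1) * (s powr r * c) \<le> c powr (r - 1) * J"
        by (intro mult_left_mono) auto
      also have "c powr (r - 1) * (s powr r * c) = I powr r"
        using s c by (simp add: powr_mult powr_diff)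
      finally show ?thesis
        using I real c by (simp add: ennreal_mult[symmetric])
    qed (use I in simp)
  qed
qed

section \<open>The heat semigroup on nonnegative functions\<close>

lemma heat_kernel_nonneg [simp]: "0 \<le> heat_kernel t x"
  by (simp add: heat_kernel_def)

lemma heat_kernel_minus: "heat_kernel t (x - y) = heat_kernel t (y - x)"
  by (simp add: heat_kernel_def norm_minus_commute)

lemma measurable_heat_kernel [measurable (raw)]:
  fixes g :: "'a \<Rightarrow> real ^ 'n"
  assumes [measurable]: "f \<in> borel_measurable M" "g \<in> borel_measurable M"
  shows "(\<lambda>z. heat_kernel (f z) (g z)) \<in> borel_measurable M"
  unfolding heat_kernel_def by measurable

lemma heat_kernel_le: "0 < t \<Longrightarrow> heat_kernel t (x :: real ^ 'n) \<le> (4 * pi * t) powr (- real CARD('n) / 2)"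
  by (simp add: heat_kernel_def mult_left_le)

text \<open>The exponential factor increases with time, so only the prefactor
  \<open>(4 \<pi> t)^(-N/2)\<close> is lost, and it changes by at most \<open>c^(N/2)\<close> when
  time grows by at most the factor \<open>c\<close>.\<close>

lemma heat_kernel_ratio:
  assumes "0 < a" "a \<le> b" "b \<le> c * a"
  shows "heat_kernel a (x :: real ^ 'n) \<le> c powr (real CARD('n) / 2) * heat_kernel b x"
proof -
  have c: "0 < c" using assms by (metis less_le_trans mult_pos_pos zero_less_mult_pos2 order.strict_trans1)
  have "(4 * pi * a) powr (- real CARD('n) / 2) \<le> (4 * pi * (b / c)) powr (- real CARD('n) / 2)"
    using assms c by (intro powr_mono2') (auto simp: field_simps)
  also have "\<dots> = c powr (real CARD('n) / 2) * (4 * pi * b) powr (- real CARD('n) / 2)"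
    using assms c by (simp add: powr_divide powr_mult powr_minus field_simps)
  finally have 1: "(4 * pi * a) powr (- real CARD('n) / 2) \<le> c powr (real CARD('n) / 2) * (4 * pi * b) powr (- real CARD('n) / 2)" .
  have 2: "exp (- (norm x)\<^sup>2 / (4 * a)) \<le> exp (- (norm x)\<^sup>2 / (4 * b))"
    using assms by (simp add: frac_le)
  from mult_mono[OF 1 2] show ?thesis
    by (simp add: heat_kernel_def mult_ac)
qed

lemma nn_integral_gauss_1d: 
  assumes "0 < t"
  shows "(\<integral>\<^sup>+x. ennreal ((4 * pi * t) powr (- 1 / 2) * exp (- x\<^sup>2 / (4 * t))) \<partial>lborel) = 1"
proof -
  have "(4 * pi * t) powr (- 1 / 2) * exp (- x\<^sup>2 / (4 * t)) = normal_density 0 (sqrt (2 * t)) x" for x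
    using assms by (simp add: normal_density_def powr_minus powr_half_sqrt field_simps)
  moreover have "(\<integral>\<^sup>+x. ennreal (normal_density 0 (sqrt (2 * t)) x) \<partial>lborel) = 1"
    using assms by (subst nn_integral_eq_integral) auto
  ultimately show ?thesis by simp
qed

lemma norm_eq_sum_Basis: "(norm x)\<^sup>2 = (\<Sum>b\<in>Basis. (x \<bullet> b)\<^sup>2)"
  unfolding power2_norm_eq_inner by (subst euclidean_inner) (simp add: power2_eq_square)

lemma nn_integral_heat_kernel:
  assumes t: "0 < t"
  shows "(\<integral>\<^sup>+x. ennreal (heat_kernel t (x :: real ^ 'n)) \<partial>lborel) = 1"
proof -
  have "ennreal (heat_kernel t x)
      = (\<Prod>b\<in>Basis. ennreal ((4 * pi * t) powr (- 1 / 2) * exp (- (x \<bullet> b)\<^sup>2 / (4 * t))))" for x :: "real ^ 'n"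
  proof -
    have "exp (- (norm x)\<^sup>2 / (4 * t)) = (\<Prod>b\<in>Basis. exp (- (x \<bullet> b)\<^sup>2 / (4 * t)))"
      by (simp add: norm_eq_sum_Basis exp_sum[symmetric] sum_divide_distrib[symmetric] sum_negf)
    moreover have "(4 * pi * t) powr (- real CARD('n) / 2) = (\<Prod>b\<in>(Basis :: (real^'n) set). (4 * pi * t) powr (- 1 / 2))"
      using t by (simp add: powr_realpow[symmetric] powr_powr)
    ultimately have "heat_kernel t x
       = (\<Prod>b\<in>Basis. (4 * pi * t) powr (- 1 / 2) * exp (- (x \<bullet> b)\<^sup>2 / (4 * t)))"
      unfolding heat_kernel_def by (simp only: prod.distrib)
    then show ?thesis by (simp only: prod_ennreal mult_nonneg_nonneg powr_ge_zero exp_ge_zero)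
  qed
  then have "(\<integral>\<^sup>+x. ennreal (heat_kernel t (x :: real ^ 'n)) \<partial>lborel)
    = (\<integral>\<^sup>+x. (\<Prod>b\<in>(Basis :: (real ^ 'n) set). ennreal ((4 * pi * t) powr (- 1 / 2) * exp (- (x \<bullet> b)\<^sup>2 / (4 * t)))) \<partial>lborel)"
    by (intro nn_integral_cong)
  also have "\<dots> = 1"
    using nn_integral_gauss_1d[OF t] by (subst nn_integral_lborel_prod) auto
  finally show ?thesis .
qed

lemma nn_integral_heat_kernel_diff:
  assumes t: "0 < t"
  shows "(\<integral>\<^sup>+y. ennreal (heat_kernel t (x - y :: real ^ 'n)) \<partial>lborel) = 1"
    and "(\<integral>\<^sup>+y. ennreal (heat_kernel t (y - x :: real ^ 'n)) \<partial>lborel) = 1"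
proof -
  show "(\<integral>\<^sup>+y. ennreal (heat_kernel t (y - x :: real ^ 'n)) \<partial>lborel) = 1"
  proof -
    have "(\<integral>\<^sup>+y. ennreal (heat_kernel t (- x + y)) \<partial>lborel)
        = (\<integral>\<^sup>+y. ennreal (heat_kernel t y) \<partial>distr lborel borel ((+) (- x)))"
      by (subst nn_integral_distr) auto
    then show ?thesis
      using nn_integral_heat_kernel[OF t, where 'n = 'n] by (simp only: lborel_distr_plus) simp
  qed
  then show "(\<integral>\<^sup>+y. ennreal (heat_kernel t (x - y :: real ^ 'n)) \<partial>lborel) = 1"
    by (simp add: heat_kernel_minus[of t x])
qed

text \<open>Completing the square; the second factor is the density of a Brownian bridge.\<close>

lemma heat_kernel_mult:
  fixes x y :: "real ^ 'n"
  assumes "0 < s" "0 < t"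
  shows "heat_kernel s (x - y) * heat_kernel t y
    = heat_kernel (s + t) x * heat_kernel (s * t / (s + t)) (y - (t / (s + t)) *\<^sub>R x)"
proof -
  define xx yy xy where "xx = x \<bullet> x" and "yy = y \<bullet> y" and "xy = x \<bullet> y"
  have 1: "(norm (x - y))\<^sup>2 = xx - 2 * xy + yy"
    by (simp add: power2_norm_eq_inner inner_diff_left inner_diff_right xx_def yy_def xy_def inner_commute)
  have 2: "(norm (y - (t / (s + t)) *\<^sub>R x))\<^sup>2 = yy - 2 * (t / (s + t)) * xy + (t / (s + t))\<^sup>2 * xx"
    unfolding power2_norm_eq_inner inner_diff_left inner_diff_right
    by (simp add: xx_def yy_def xy_def inner_commute power2_eq_square algebra_simps)
  have 3: "(norm x)\<^sup>2 = xx" "(norm y)\<^sup>2 = yy" by (simp_all add: power2_norm_eq_inner xx_def yy_def)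
  have st: "s \<noteq> 0" "t \<noteq> 0" "s + t \<noteq> 0" using assms by auto
  have e: "(xx - 2 * xy + yy) / (4 * s) + yy / (4 * t)
      = xx / (4 * (s + t)) + (yy - 2 * (t / (s + t)) * xy + (t / (s + t))\<^sup>2 * xx) / (4 * (s * t / (s + t)))"
  proof -
    have "(yy - 2 * (t / (s + t)) * xy + (t / (s + t))\<^sup>2 * xx) / (4 * (s * t / (s + t)))
      = yy * (s + t) / (4 * s * t) - 2 * xy / (4 * s) + t * xx / (4 * s * (s + t))"
      using st by (simp add: divide_simps power2_eq_square) (simp add: algebra_simps)
    also have "yy * (s + t) / (4 * s * t) = yy / (4 * s) + yy / (4 * t)"
      using st by (simp add: divide_simps) (simp add: algebra_simps)
    finally have *: "(yy - 2 * (t / (s + t)) * xy + (t / (s + t))\<^sup>2 * xx) / (4 * (s * t / (s + t)))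
      = yy / (4 * s) + yy / (4 * t) - 2 * xy / (4 * s) + t * xx / (4 * s * (s + t))" .
    have "xx / (4 * (s + t)) + t * xx / (4 * s * (s + t)) = xx / (4 * s)"
      using st by (simp add: divide_simps) (simp add: algebra_simps)
    with * show ?thesis by (simp add: diff_divide_distrib add_divide_distrib)
  qed
  have p: "(4 * pi * s) powr a * (4 * pi * t) powr a = (4 * pi * (s + t)) powr a * (4 * pi * (s * t / (s + t))) powr a" for a
  proof -
    have "(4 * pi * s) * (4 * pi * t) = (4 * pi * (s + t)) * (4 * pi * (s * t / (s + t)))"
      using st by (simp only: times_divide_eq_right eq_divide_eq mult_ac) simp
    then have "((4 * pi * s) * (4 * pi * t)) powr a = ((4 * pi * (s + t)) * (4 * pi * (s * t / (s + t)))) powr a"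
      by (rule arg_cong)
    then show ?thesis by (simp only: powr_mult)
  qed
  have ex: "exp (- A / B) * exp (- C / D) = exp (- (A / B + C / D))" for A B C D :: real
    by (simp add: exp_add[symmetric])
  have perm: "(k1 * e1) * (k2 * e2) = (k1 * k2) * (e1 * e2)" for k1 k2 e1 e2 :: real
    by (simp add: mult_ac)
  show ?thesis
    unfolding heat_kernel_def 1 2 3
    by (rule trans[OF perm], subst p, subst ex, subst e, subst ex[symmetric], rule perm[symmetric])
qed

text \<open>After translation by \<open>z\<close>, \<open>heat_kernel_mult\<close> pulls out the
  kernel at time \<open>s + t\<close>; the bridge density that remains has integral 1 in
  \<open>y\<close>.\<close>

lemma heat_kernel_convolution:
  fixes x z :: "real ^ 'n"
  assumes "0 < s" "0 < t"
  shows "(\<integral>\<^sup>+y. ennreal (heat_kernel s (x - y)) * ennreal (heat_kernel t (y - z)) \<partial>lborel)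
    = ennreal (heat_kernel (s + t) (x - z))"
proof -
  have "heat_kernel s (x - y) * heat_kernel t (y - z) = heat_kernel (s + t) (x - z) *
      heat_kernel (s * t / (s + t)) (y - (z + (t / (s + t)) *\<^sub>R (x - z)))" for y
    using heat_kernel_mult[OF assms, of "x - z" "y - z"] by (simp add: algebra_simps)
  then have "(\<integral>\<^sup>+y. ennreal (heat_kernel s (x - y)) * ennreal (heat_kernel t (y - z)) \<partial>lborel)
    = (\<integral>\<^sup>+y. ennreal (heat_kernel (s + t) (x - z)) *
      ennreal (heat_kernel (s * t / (s + t)) (y - (z + (t / (s + t)) *\<^sub>R (x - z)))) \<partial>lborel)"
    by (simp flip: ennreal_mult)
  also have "\<dots> = ennreal (heat_kernel (s + t) (x - z))"
    using assms by (subst nn_integral_cmult) (auto simp: nn_integral_heat_kernel_diff)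
  finally show ?thesis .
qed

text \<open>On functions with values in [0, top] the convolution always exists, so Tonelli and the
  semigroup law need no integrability. Nonpositive times act as the identity, which keeps
  conservation of mass, symmetry and Jensen's inequality valid for every real
  \<open>t\<close>.\<close>

definition nn_heat :: "real \<Rightarrow> (real ^ 'n \<Rightarrow> ennreal) \<Rightarrow> real ^ 'n \<Rightarrow> ennreal" where
  "nn_heat t \<phi> x =
     (if t \<le> 0 then \<phi> x else (\<integral>\<^sup>+y. ennreal (heat_kernel t (x - y)) * \<phi> y \<partial>lborel))"

lemma measurable_uncurry:
  assumes U: "case_prod U \<in> borel_measurable (borel \<Otimes>\<^sub>M borel)"
    and f: "f \<in> borel_measurable M" and g: "g \<in> borel_measurable M"
  shows "(\<lambda>z. U (f z) (g z)) \<in> borel_measurable M"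
proof -
  have "(\<lambda>z. (f z, g z)) \<in> M \<rightarrow>\<^sub>M borel \<Otimes>\<^sub>M borel"
    using f g by measurable
  from measurable_compose[OF this U] show ?thesis by simp
qed

lemma measurable_nn_heat [measurable (raw)]:
  fixes \<phi> :: "'a \<Rightarrow> real ^ 'n \<Rightarrow> ennreal"
  assumes \<phi>: "case_prod \<phi> \<in> borel_measurable (M \<Otimes>\<^sub>M borel)"
    and [measurable]: "a \<in> borel_measurable M" "g \<in> borel_measurable M"
  shows "(\<lambda>w. nn_heat (a w) (\<phi> w) (g w)) \<in> borel_measurable M"
proof -
  have [measurable (raw)]: "(\<lambda>z. \<phi> (f z) (h z)) \<in> borel_measurable N"
    if [measurable]: "f \<in> N \<rightarrow>\<^sub>M M" "h \<in> borel_measurable N" for f h and N :: "('a \<times> (real^'n)) measure"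
  proof -
    have "(\<lambda>z. (f z, h z)) \<in> N \<rightarrow>\<^sub>M M \<Otimes>\<^sub>M borel"
      by measurable
    from measurable_compose[OF this \<phi>] show ?thesis by simp
  qed
  have [measurable (raw)]: "(\<lambda>z. \<phi> z (g z)) \<in> borel_measurable M"
  proof -
    have "(\<lambda>z. (z, g z)) \<in> M \<rightarrow>\<^sub>M M \<Otimes>\<^sub>M borel"
      by measurable
    from measurable_compose[OF this \<phi>] show ?thesis by simp
  qed
  show ?thesis
    unfolding nn_heat_def by measurable
qed

lemma nn_heat_nonpos: "t \<le> 0 \<Longrightarrow> nn_heat t \<phi> x = \<phi> x"
  by (simp add: nn_heat_def)

lemma nn_heat_0 [simp]: "nn_heat 0 \<phi> = \<phi>"
  by (simp add: nn_heat_def fun_eq_iff)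

lemma nn_heat_mono: "(\<And>y. \<phi> y \<le> \<psi> y) \<Longrightarrow> nn_heat t \<phi> x \<le> nn_heat t \<psi> x"
  unfolding nn_heat_def by (auto intro!: nn_integral_mono mult_left_mono)

lemma nn_heat_cong_AE:
  "AE y in lborel. \<phi> y = \<psi> y \<Longrightarrow> 0 < t \<Longrightarrow> nn_heat t \<phi> x = nn_heat t \<psi> x"
  unfolding nn_heat_def by (auto intro!: nn_integral_cong_AE)

lemma nn_heat_cmult:
  assumes [measurable]: "\<phi> \<in> borel_measurable borel"
  shows "nn_heat t (\<lambda>y. c * \<phi> y) x = c * nn_heat t \<phi> x"
  unfolding nn_heat_def by (auto simp: nn_integral_cmult[symmetric] mult_ac)

lemma nn_heat_add:
  assumes [measurable]: "\<phi> \<in> borel_measurable borel" "\<psi> \<in> borel_measurable borel"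
  shows "nn_heat t (\<lambda>y. \<phi> y + \<psi> y) x = nn_heat t \<phi> x + nn_heat t \<psi> x"
  unfolding nn_heat_def by (auto simp: nn_integral_add distrib_left)

lemma nn_heat_const: "nn_heat t (\<lambda>_. c) x = c"
  by (simp add: nn_heat_def nn_integral_multc nn_integral_heat_kernel_diff)

lemma nn_heat_nn_integral:
  fixes \<Psi> :: "'a \<Rightarrow> real ^ 'n \<Rightarrow> ennreal"
  assumes "sigma_finite_measure M"
    and [measurable]: "(\<lambda>(y, \<sigma>). \<Psi> \<sigma> y) \<in> borel_measurable (borel \<Otimes>\<^sub>M M)"
  shows "nn_heat t (\<lambda>y. \<integral>\<^sup>+\<sigma>. \<Psi> \<sigma> y \<partial>M) x = (\<integral>\<^sup>+\<sigma>. nn_heat t (\<Psi> \<sigma>) x \<partial>M)"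
proof (cases "t \<le> 0")
  case False
  interpret M: sigma_finite_measure M by fact
  interpret pair_sigma_finite M "lborel :: (real^'n) measure" ..
  have [measurable]: "case_prod \<Psi> \<in> borel_measurable (M \<Otimes>\<^sub>M borel)"
    using measurable_compose[OF measurable_pair_swap' assms(2)] by (simp add: split_beta')
  have "(\<lambda>\<sigma>. \<Psi> \<sigma> y) \<in> borel_measurable M" for y
    by measurable
  then have "nn_heat t (\<lambda>y. \<integral>\<^sup>+\<sigma>. \<Psi> \<sigma> y \<partial>M) x
    = (\<integral>\<^sup>+y. \<integral>\<^sup>+\<sigma>. ennreal (heat_kernel t (x - y)) * \<Psi> \<sigma> y \<partial>M \<partial>lborel)"
    using False by (simp add: nn_heat_def nn_integral_cmult)
  also have "\<dots> = (\<integral>\<^sup>+\<sigma>. \<integral>\<^sup>+y. ennreal (heat_kernel t (x - y)) * \<Psi> \<sigma> y \<partial>lborel \<partial>M)"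
    by (rule Fubini') measurable
  finally show ?thesis
    using False by (simp add: nn_heat_def)
qed (simp add: nn_heat_nonpos)

lemma nn_heat_nn_heat:
  fixes \<phi> :: "real ^ 'n \<Rightarrow> ennreal"
  assumes [measurable]: "\<phi> \<in> borel_measurable borel" and "0 \<le> s" "0 \<le> t"
  shows "nn_heat s (nn_heat t \<phi>) x = nn_heat (s + t) \<phi> x"
proof (cases "s = 0 \<or> t = 0")
  case False
  then have st: "0 < s" "0 < t" using assms by auto
  have "nn_heat s (nn_heat t \<phi>) x
    = (\<integral>\<^sup>+y. \<integral>\<^sup>+z. (ennreal (heat_kernel s (x - y)) * ennreal (heat_kernel t (y - z))) * \<phi> z \<partial>lborel \<partial>lborel)"
    using st by (simp add: nn_heat_def nn_integral_cmult mult.assoc)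
  also have "\<dots> = (\<integral>\<^sup>+z. \<integral>\<^sup>+y. (ennreal (heat_kernel s (x - y)) * ennreal (heat_kernel t (y - z))) * \<phi> z \<partial>lborel \<partial>lborel)"
    by (rule lborel_pair.Fubini') measurable
  also have "\<dots> = (\<integral>\<^sup>+z. ennreal (heat_kernel (s + t) (x - z)) * \<phi> z \<partial>lborel)"
    using st by (simp add: nn_integral_multc heat_kernel_convolution)
  finally show ?thesis using st by (simp add: nn_heat_def)
qed auto

text \<open>The kernel is even. This duality later moves the flow from an uncontrolled function onto
  a weight; with the weight 1 it is conservation of mass.\<close>

lemma nn_heat_symmetric:
  fixes \<phi> \<psi> :: "real ^ 'n \<Rightarrow> ennreal"
  assumes [measurable]: "\<phi> \<in> borel_measurable borel" "\<psi> \<in> borel_measurable borel"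
  shows "(\<integral>\<^sup>+x. nn_heat t \<phi> x * \<psi> x \<partial>lborel) = (\<integral>\<^sup>+x. \<phi> x * nn_heat t \<psi> x \<partial>lborel)"
proof (cases "t \<le> 0")
  case False
  then have "(\<integral>\<^sup>+x. nn_heat t \<phi> x * \<psi> x \<partial>lborel)
    = (\<integral>\<^sup>+x. \<integral>\<^sup>+y. ennreal (heat_kernel t (x - y)) * \<phi> y * \<psi> x \<partial>lborel \<partial>lborel)"
    by (simp add: nn_heat_def nn_integral_multc)
  also have "\<dots> = (\<integral>\<^sup>+y. \<integral>\<^sup>+x. ennreal (heat_kernel t (x - y)) * \<phi> y * \<psi> x \<partial>lborel \<partial>lborel)"
    by (rule lborel_pair.Fubini') measurable
  also have "\<dots> = (\<integral>\<^sup>+y. \<integral>\<^sup>+x. \<phi> y * (ennreal (heat_kernel t (y - x)) * \<psi> x) \<partial>lborel \<partial>lborel)"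
    by (simp add: heat_kernel_minus mult_ac)
  also have "\<dots> = (\<integral>\<^sup>+y. \<phi> y * nn_heat t \<psi> y \<partial>lborel)"
    using False by (simp add: nn_heat_def nn_integral_cmult)
  finally show ?thesis .
qed (simp add: nn_heat_nonpos)

lemma nn_integral_nn_heat:
  assumes [measurable]: "\<phi> \<in> borel_measurable borel"
  shows "(\<integral>\<^sup>+x. nn_heat t \<phi> x \<partial>lborel) = (\<integral>\<^sup>+x. \<phi> x \<partial>lborel)"
  using nn_heat_symmetric[of \<phi> "\<lambda>_. 1" t] by (simp add: nn_heat_const)

lemma nn_heat_jensen:
  assumes [measurable]: "\<phi> \<in> borel_measurable borel" and "1 \<le> r"
  shows "epow (nn_heat t \<phi> x) r \<le> nn_heat t (\<lambda>y. epow (\<phi> y) r) x"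
proof (cases "t \<le> 0")
  case False
  then show ?thesis
    using nn_integral_jensen[of "\<lambda>y. ennreal (heat_kernel t (x - y))" lborel \<phi> 1 r] assms
    by (simp add: nn_heat_def nn_integral_heat_kernel_diff)
qed (simp add: nn_heat_nonpos)

text \<open>Jensen's inequality applied to the root and then solved for it. With the semigroup law
  it makes the \<open>r\<close>-th root of a heat flow a subsolution, the property on which the
  majorant rests.\<close>

lemma nn_heat_jensen_root:
  assumes [measurable]: "\<phi> \<in> borel_measurable borel" and "1 \<le> r"
  shows "nn_heat t (\<lambda>y. epow (\<phi> y) (1 / r)) x \<le> epow (nn_heat t \<phi> x) (1 / r)"
proof -
  have "epow (nn_heat t (\<lambda>y. epow (\<phi> y) (1 / r)) x) r \<le> nn_heat t \<phi> x"
    using nn_heat_jensen[of "\<lambda>y. epow (\<phi> y) (1 / r)" r t x] assms by (simp add: epow_epow)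
  then have "epow (epow (nn_heat t (\<lambda>y. epow (\<phi> y) (1 / r)) x) r) (1 / r) \<le> epow (nn_heat t \<phi> x) (1 / r)"
    using assms by (intro epow_mono) auto
  then show ?thesis using assms by (simp add: epow_epow)
qed

lemma nn_heat_contraction:
  assumes [measurable]: "\<phi> \<in> borel_measurable borel" and "1 \<le> r"
  shows "(\<integral>\<^sup>+x. epow (nn_heat t \<phi> x) r \<partial>lborel) \<le> (\<integral>\<^sup>+x. epow (\<phi> x) r \<partial>lborel)"
proof -
  have "(\<integral>\<^sup>+x. epow (nn_heat t \<phi> x) r \<partial>lborel) \<le> (\<integral>\<^sup>+x. nn_heat t (\<lambda>y. epow (\<phi> y) r) x \<partial>lborel)"
    using assms by (intro nn_integral_mono nn_heat_jensen)
  then show ?thesis by (simp add: nn_integral_nn_heat)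
qed

lemma nn_heat_smoothing:
  fixes \<phi> :: "real ^ 'n \<Rightarrow> ennreal"
  assumes [measurable]: "\<phi> \<in> borel_measurable borel" and t: "0 < t"
  shows "nn_heat t \<phi> x \<le> ennreal ((4 * pi * t) powr (- real CARD('n) / 2)) * (\<integral>\<^sup>+y. \<phi> y \<partial>lborel)"
proof -
  have "nn_heat t \<phi> x \<le> (\<integral>\<^sup>+y. ennreal ((4 * pi * t) powr (- real CARD('n) / 2)) * \<phi> y \<partial>lborel)"
    using heat_kernel_le[OF t, where 'n = 'n] t
    by (auto simp: nn_heat_def intro!: nn_integral_mono mult_right_mono ennreal_leI)
  then show ?thesis by (simp add: nn_integral_cmult)
qed

lemma nn_heat_ratio:
  fixes \<phi> :: "real ^ 'n \<Rightarrow> ennreal"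
  assumes [measurable]: "\<phi> \<in> borel_measurable borel" and "0 < a" "a \<le> b" "b \<le> c * a"
  shows "nn_heat a \<phi> x \<le> ennreal (c powr (real CARD('n) / 2)) * nn_heat b \<phi> x"
proof -
  have "nn_heat a \<phi> x
    \<le> (\<integral>\<^sup>+y. ennreal (c powr (real CARD('n) / 2)) * (ennreal (heat_kernel b (x - y)) * \<phi> y) \<partial>lborel)"
    using assms
    by (auto simp: nn_heat_def mult.assoc[symmetric] simp flip: ennreal_mult'
        intro!: nn_integral_mono mult_right_mono ennreal_leI heat_kernel_ratio)
  then show ?thesis
    using assms by (simp add: nn_integral_cmult nn_heat_def)
qed

section \<open>From nonnegative to signed functions\<close>

lemma heat_semigroup_defined_iff:
  assumes [measurable]: "\<phi> \<in> borel_measurable borel" and "0 < t"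
  shows "heat_semigroup_defined t \<phi> x \<longleftrightarrow> nn_heat t (\<lambda>y. ennreal \<bar>\<phi> y\<bar>) x < top"
  using assms
  by (simp add: heat_semigroup_defined_def nn_heat_def integrable_iff_bounded abs_mult ennreal_mult)

lemma heat_semigroup_nonneg:
  assumes [measurable]: "\<phi> \<in> borel_measurable borel" and "0 \<le> t" and "\<And>y. 0 \<le> \<phi> y"
  shows "heat_semigroup t \<phi> x = enn2real (nn_heat t (\<lambda>y. ennreal (\<phi> y)) x)"
proof (cases "t = 0")
  case False
  have "(LINT y|lborel. heat_kernel t (x - y) * \<phi> y)
      = enn2real (\<integral>\<^sup>+y. ennreal (heat_kernel t (x - y) * \<phi> y) \<partial>lborel)"
    using assms by (intro integral_eq_nn_integral) auto
  with False assms show ?thesis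
    by (simp add: heat_semigroup_def nn_heat_def ennreal_mult)
qed (use assms in \<open>simp add: heat_semigroup_def\<close>)

text \<open>\<open>ennreal\<close> truncates negative numbers to 0, so the two terms are the flows
  of the positive and of the negative part.\<close>

lemma heat_semigroup_eq_diff:
  assumes [measurable]: "\<phi> \<in> borel_measurable borel" and "0 \<le> t"
    and fin: "nn_heat t (\<lambda>y. ennreal \<bar>\<phi> y\<bar>) x < top"
  shows "heat_semigroup t \<phi> x
    = enn2real (nn_heat t (\<lambda>y. ennreal (\<phi> y)) x) - enn2real (nn_heat t (\<lambda>y. ennreal (- \<phi> y)) x)"
proof (cases "t = 0")
  case False
  with assms have "integrable lborel (\<lambda>y. heat_kernel t (x - y) * \<phi> y)"
    using heat_semigroup_defined_iff[of \<phi> t x] by (simp add: heat_semigroup_defined_def)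
  then have "(LINT y|lborel. heat_kernel t (x - y) * \<phi> y)
      = enn2real (\<integral>\<^sup>+y. ennreal (heat_kernel t (x - y) * \<phi> y) \<partial>lborel)
        - enn2real (\<integral>\<^sup>+y. ennreal (heat_kernel t (x - y) * - \<phi> y) \<partial>lborel)"
    by (simp add: real_lebesgue_integral_def)
  with False assms show ?thesis
    by (simp only: heat_semigroup_def nn_heat_def ennreal_mult'[OF heat_kernel_nonneg]) simp
next
  case True
  then show ?thesis
    by (cases "0 \<le> \<phi> x") (auto simp: heat_semigroup_def ennreal_neg)
qed

section \<open>Duhamel integrals of nonnegative functions\<close>

text \<open>The lower limit is a parameter because continuity in time is obtained by restarting the
  integral at a late time \<open>a\<close>, all bounds being small with
  \<open>t - a\<close>.\<close>

definition duhamel ::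
    "real \<Rightarrow> real \<Rightarrow> (real \<Rightarrow> real ^ 'n \<Rightarrow> ennreal) \<Rightarrow> real ^ 'n \<Rightarrow> ennreal" where
  "duhamel a t F x = (\<integral>\<^sup>+\<tau>. indicator {a..t} \<tau> * nn_heat (t - \<tau>) (F \<tau>) x \<partial>lborel)"

lemma measurable_uncurry_lift:
  assumes U: "case_prod U \<in> borel_measurable (borel \<Otimes>\<^sub>M borel)"
    and f: "f \<in> borel_measurable M" 
  shows "case_prod (\<lambda>w. U (f w)) \<in> borel_measurable (M \<Otimes>\<^sub>M borel)"
proof -
  have "(\<lambda>z. (f (fst z), snd z)) \<in> M \<Otimes>\<^sub>M borel \<rightarrow>\<^sub>M borel \<Otimes>\<^sub>M borel"
    using f by measurable
  from measurable_compose[OF this U] show ?thesis by (simp add: split_beta')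
qed

lemma measurable_slice:
  assumes U: "case_prod U \<in> borel_measurable (borel \<Otimes>\<^sub>M borel)"
  shows "U t \<in> borel_measurable borel"
  using measurable_uncurry[OF U, of "\<lambda>_. t" borel "\<lambda>x. x"] by simp

lemma measurable_nn_heat_uncurry:
  fixes F :: "real \<Rightarrow> real ^ 'n \<Rightarrow> ennreal"
  assumes F: "case_prod F \<in> borel_measurable (borel \<Otimes>\<^sub>M borel)"
    and "a \<in> borel_measurable M" "f \<in> borel_measurable M" "g \<in> borel_measurable M"
  shows "(\<lambda>w. nn_heat (a w) (F (f w)) (g w)) \<in> borel_measurable M"
  by (rule measurable_nn_heat[OF measurable_uncurry_lift[OF F assms(3)] assms(2) assms(4)])

lemma measurable_duhamel:
  fixes F :: "real \<Rightarrow> real ^ 'n \<Rightarrow> ennreal"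
  assumes F: "case_prod F \<in> borel_measurable (borel \<Otimes>\<^sub>M borel)"
    and [measurable]: "a \<in> borel_measurable M" "f \<in> borel_measurable M" "g \<in> borel_measurable M"
  shows "(\<lambda>w. duhamel (a w) (f w) F (g w)) \<in> borel_measurable M"
proof -
  note [measurable (raw)] = measurable_nn_heat_uncurry[OF F]
  have "(\<lambda>z. indicator {a (fst z)..f (fst z)} (snd z) * nn_heat (f (fst z) - snd z) (F (snd z)) (g (fst z)))
      = (\<lambda>z. (if a (fst z) \<le> snd z \<and> snd z \<le> f (fst z) then 1 else 0) * nn_heat (f (fst z) - snd z) (F (snd z)) (g (fst z)))"
    by (auto simp: indicator_def fun_eq_iff)
  also have "\<dots> \<in> borel_measurable (M \<Otimes>\<^sub>M lborel)"
    by measurable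
  finally show ?thesis
    unfolding duhamel_def by (intro lborel.borel_measurable_nn_integral) (simp add: split_beta')
qed

lemma duhamel_mono:
  "(\<And>\<tau> y. a \<le> \<tau> \<Longrightarrow> \<tau> \<le> t \<Longrightarrow> F \<tau> y \<le> H \<tau> y) \<Longrightarrow> duhamel a t F x \<le> duhamel a t H x"
  unfolding duhamel_def
  by (intro nn_integral_mono) (auto simp: indicator_def intro!: nn_heat_mono)

text \<open>For \<open>\<tau> < t\<close> the flow does not see null sets. At
  \<open>\<tau> = t\<close> it is the identity and would see them, but a single time does not count
  in the integral.\<close>

lemma duhamel_cong_AE:
  assumes "\<And>\<tau>. a \<le> \<tau> \<Longrightarrow> \<tau> < t \<Longrightarrow> AE y in lborel. F \<tau> y = H \<tau> y"
  shows "duhamel a t F x = duhamel a t H x"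
  unfolding duhamel_def
proof (intro nn_integral_cong_AE)
  have "AE \<tau> in lborel. \<tau> \<noteq> t" by (rule AE_lborel_singleton)
  then show "AE \<tau> in lborel. indicator {a..t} \<tau> * nn_heat (t - \<tau>) (F \<tau>) x
      = indicator {a..t} \<tau> * nn_heat (t - \<tau>) (H \<tau>) x"
  proof eventually_elim
    case (elim \<tau>)
    show ?case
    proof (cases "\<tau> \<in> {a..t}")
      case True
      with elim have "nn_heat (t - \<tau>) (F \<tau>) x = nn_heat (t - \<tau>) (H \<tau>) x"
        by (intro nn_heat_cong_AE assms) auto
      then show ?thesis by simp
    qed simp
  qed
qed

lemma duhamel_cmult:
  assumes F: "case_prod F \<in> borel_measurable (borel \<Otimes>\<^sub>M borel)"
  shows "duhamel a t (\<lambda>\<tau> y. c * F \<tau> y) x = c * duhamel a t F x"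
proof -
  note [measurable (raw)] = measurable_nn_heat_uncurry[OF F]
  show ?thesis
    unfolding duhamel_def
    by (subst nn_integral_cmult[symmetric])
       (auto simp: nn_heat_cmult measurable_slice[OF F] mult_ac)
qed

lemma duhamel_add:
  assumes F: "case_prod F \<in> borel_measurable (borel \<Otimes>\<^sub>M borel)"
    and H: "case_prod H \<in> borel_measurable (borel \<Otimes>\<^sub>M borel)"
  shows "duhamel a t (\<lambda>\<tau> y. F \<tau> y + H \<tau> y) x = duhamel a t F x + duhamel a t H x"
proof -
  note [measurable (raw)] = measurable_nn_heat_uncurry[OF F] measurable_nn_heat_uncurry[OF H]
  show ?thesis
    unfolding duhamel_def
    by (subst nn_integral_add[symmetric])
       (auto simp: nn_heat_add measurable_slice[OF F] measurable_slice[OF H] distrib_left)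
qed

lemma nn_heat_duhamel:
  fixes F :: "real \<Rightarrow> real ^ 'n \<Rightarrow> ennreal"
  assumes F: "case_prod F \<in> borel_measurable (borel \<Otimes>\<^sub>M borel)" and "0 \<le> s"
  shows "nn_heat s (duhamel a b F) x = (\<integral>\<^sup>+\<tau>. indicator {a..b} \<tau> * nn_heat (s + (b - \<tau>)) (F \<tau>) x \<partial>lborel)"
proof -
  note [measurable (raw)] = measurable_nn_heat_uncurry[OF F]
  have "nn_heat s (duhamel a b F) x = (\<integral>\<^sup>+\<tau>. nn_heat s (\<lambda>y. indicator {a..b} \<tau> * nn_heat (b - \<tau>) (F \<tau>) y) x \<partial>lborel)"
    unfolding duhamel_def
    by (rule nn_heat_nn_integral) (auto simp: lborel.sigma_finite_measure_axioms)
  also have "\<dots> = (\<integral>\<^sup>+\<tau>. indicator {a..b} \<tau> * nn_heat (s + (b - \<tau>)) (F \<tau>) x \<partial>lborel)"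
    using assms(2)
    by (intro nn_integral_cong)
       (auto simp: nn_heat_cmult nn_heat_nn_heat measurable_slice[OF F] indicator_def nn_heat_const)
  finally show ?thesis .
qed

text \<open>By the semigroup law the history up to \<open>b\<close> reaches time \<open>t\<close>
  through the flow over \<open>t - b\<close>. The two closed intervals overlap only in the null set
  \<open>{b}\<close>.\<close>

lemma duhamel_split:
  fixes F :: "real \<Rightarrow> real ^ 'n \<Rightarrow> ennreal"
  assumes F: "case_prod F \<in> borel_measurable (borel \<Otimes>\<^sub>M borel)" and "a \<le> b" "b \<le> t"
  shows "duhamel a t F x = nn_heat (t - b) (duhamel a b F) x + duhamel b t F x"
proof -
  note [measurable (raw)] = measurable_nn_heat_uncurry[OF F]
  have "AE \<tau> in lborel. \<tau> \<noteq> b" by (rule AE_lborel_singleton)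
  then have "duhamel a t F x = (\<integral>\<^sup>+\<tau>. indicator {a..b} \<tau> * nn_heat (t - \<tau>) (F \<tau>) x
      + indicator {b..t} \<tau> * nn_heat (t - \<tau>) (F \<tau>) x \<partial>lborel)"
    unfolding duhamel_def using assms(2,3)
    by (intro nn_integral_cong_AE) (auto simp: indicator_def elim!: eventually_mono)
  also have "\<dots> = (\<integral>\<^sup>+\<tau>. indicator {a..b} \<tau> * nn_heat (t - \<tau>) (F \<tau>) x \<partial>lborel) + duhamel b t F x"
    unfolding duhamel_def by (intro nn_integral_add) measurable
  also have "(\<integral>\<^sup>+\<tau>. indicator {a..b} \<tau> * nn_heat (t - \<tau>) (F \<tau>) x \<partial>lborel) = nn_heat (t - b) (duhamel a b F) x"
    using assms by (simp add: nn_heat_duhamel)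
  finally show ?thesis .
qed

section \<open>A pointwise majorant\<close>

lemma nn_integral_powr_Icc:
  fixes a e t :: real
  assumes "-1 < a" "e \<le> t"
  shows "(\<integral>\<^sup>+\<tau>. ennreal (indicator {e..t} \<tau> * (\<tau> - e) powr a) \<partial>lborel) = ennreal ((t - e) powr (a + 1) / (a + 1))"
proof -
  have "(\<integral>\<^sup>+\<tau>. ennreal (indicator {e..t} \<tau> * (\<tau> - e) powr a) \<partial>lborel)
      = (\<integral>\<^sup>+\<tau>. ennreal (indicator {e..t} (e + 1 * \<tau>) * (e + 1 * \<tau> - e) powr a) \<partial>lborel)"
    by (subst nn_integral_real_affine[where c = 1 and t = e]) auto
  also have "\<dots> = (\<integral>\<^sup>+\<tau>. ennreal (\<tau> powr a) * indicator {0..t - e} \<tau> \<partial>lborel)"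
    by (intro nn_integral_cong) (auto simp: indicator_def)
  also have "\<dots> = ennreal ((t - e) powr (a + 1) / (a + 1))"
    using assms has_integral_powr_from_0[of a "t - e"]
    by (intro nn_integral_has_integral_lebesgue') auto
  finally show ?thesis .
qed

text \<open>One formula for both terms of \<open>B\<close>: a Dirac mass at 0 produces
  \<open>K(t)\<close>, a density \<open>\<sigma> powr \<rho>\<close> produces the time average. The
  estimates below see the measure only through a bound \<open>m\<close> on its mass.\<close>

definition majorant :: "real measure \<Rightarrow> real \<Rightarrow> (real ^ 'n \<Rightarrow> ennreal) \<Rightarrow> real \<Rightarrow> real ^ 'n \<Rightarrow> ennreal" where
  "majorant \<mu> q \<phi> t x = (\<integral>\<^sup>+\<sigma>. indicator {..t} \<sigma> * epow (nn_heat (t - \<sigma>) \<phi> x) (1 / q) \<partial>\<mu>)"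

context
  fixes \<mu> :: "real measure" and q m Q :: real and \<phi> :: "real ^ 'n \<Rightarrow> ennreal"
  assumes q: "1 \<le> q"
    and \<mu>: "sets \<mu> = sets borel" "emeasure \<mu> UNIV \<le> ennreal m" "0 < m"
    and \<phi> [measurable]: "\<phi> \<in> borel_measurable borel"
    and Q: "(\<integral>\<^sup>+x. \<phi> x \<partial>lborel) \<le> ennreal Q" "0 \<le> Q"
begin

lemma finite_measure_\<mu>: "finite_measure \<mu>"
proof
  have "space \<mu> = UNIV" using sets_eq_imp_space_eq[OF \<mu>(1)] by simp
  then show "emeasure \<mu> (space \<mu>) \<noteq> \<infinity>" using \<mu>(2) by (auto simp: top_unique)
qed

interpretation \<mu>: finite_measure \<mu> by (rule finite_measure_\<mu>)

declare \<mu>(1) [measurable_cong]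

lemma nn_integral_indicator_\<mu>_le: "(\<integral>\<^sup>+\<sigma>. indicator {..t} \<sigma> \<partial>\<mu>) \<le> ennreal m"
proof -
  have "(\<integral>\<^sup>+\<sigma>. indicator {..t} \<sigma> \<partial>\<mu>) \<le> emeasure \<mu> UNIV"
    by (subst nn_integral_indicator) (simp_all add: \<mu>(1) emeasure_mono)
  from this \<mu>(2) show ?thesis by (rule order_trans)
qed

lemma measurable_majorant_kernel [measurable]:
  "(\<lambda>(w, \<sigma>). indicator {..fst w} \<sigma> * epow (nn_heat (fst w - \<sigma>) \<phi> (snd w)) (1 / q))
    \<in> borel_measurable ((borel \<Otimes>\<^sub>M borel) \<Otimes>\<^sub>M \<mu>)"
proof -
  have "(\<lambda>(w, \<sigma>). indicator {..fst w} \<sigma> * epow (nn_heat (fst w - \<sigma>) \<phi> (snd w)) (1 / q))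
     = (\<lambda>z. (if snd z \<le> fst (fst z) then 1 else 0) * epow (nn_heat (fst (fst z) - snd z) \<phi> (snd (fst z))) (1 / q))"
    by (auto simp: fun_eq_iff indicator_def)
  also have "\<dots> \<in> borel_measurable ((borel \<Otimes>\<^sub>M borel) \<Otimes>\<^sub>M \<mu>)"
    by measurable
  finally show ?thesis .
qed

lemma measurable_majorant: "case_prod (majorant \<mu> q \<phi>) \<in> borel_measurable (borel \<Otimes>\<^sub>M borel)"
proof -
  have "(\<lambda>w. majorant \<mu> q \<phi> (fst w) (snd w)) \<in> borel_measurable (borel \<Otimes>\<^sub>M borel)"
    unfolding majorant_def by (rule \<mu>.borel_measurable_nn_integral) (rule measurable_majorant_kernel)
  then show ?thesis by (simp add: split_beta')
qed

text \<open>Jensen in \<open>\<sigma>\<close> moves the power \<open>q\<close> inside at the cost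
  \<open>m^(q - 1)\<close>, where it cancels the root. The flow preserves the integral of
  \<open>\<phi>\<close>, so every \<open>\<sigma>\<close> contributes at most \<open>Q\<close>,
  uniformly in \<open>t\<close>.\<close>

lemma majorant_norm:
  "(\<integral>\<^sup>+x. epow (majorant \<mu> q \<phi> t x) q \<partial>lborel) \<le> ennreal (m powr q * Q)"
proof -
  interpret P: pair_sigma_finite \<mu> "lborel :: (real^'n) measure" ..
  have ind [measurable]: "(\<lambda>z. indicator {..t} (fst z) :: ennreal) \<in> borel_measurable (\<mu> \<Otimes>\<^sub>M (lborel :: (real^'n) measure))"
    by measurable
  have "epow (majorant \<mu> q \<phi> t x) q \<le> ennreal (m powr (q - 1)) *
      (\<integral>\<^sup>+\<sigma>. indicator {..t} \<sigma> * nn_heat (t - \<sigma>) \<phi> x \<partial>\<mu>)" for x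
    using nn_integral_jensen[of "indicator {..t}" \<mu> "\<lambda>\<sigma>. epow (nn_heat (t - \<sigma>) \<phi> x) (1 / q)" m q]
      nn_integral_indicator_\<mu>_le[of t] \<mu>(3) q
    by (simp add: majorant_def epow_epow)
  then have "(\<integral>\<^sup>+x. epow (majorant \<mu> q \<phi> t x) q \<partial>lborel)
    \<le> (\<integral>\<^sup>+x. ennreal (m powr (q - 1)) * (\<integral>\<^sup>+\<sigma>. indicator {..t} \<sigma> * nn_heat (t - \<sigma>) \<phi> x \<partial>\<mu>) \<partial>lborel)"
    by (intro nn_integral_mono)
  also have "\<dots> = ennreal (m powr (q - 1)) * (\<integral>\<^sup>+x. (\<integral>\<^sup>+\<sigma>. indicator {..t} \<sigma> * nn_heat (t - \<sigma>) \<phi> x \<partial>\<mu>) \<partial>lborel)"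
    by (rule nn_integral_cmult) measurable
  also have "(\<integral>\<^sup>+x. (\<integral>\<^sup>+\<sigma>. indicator {..t} \<sigma> * nn_heat (t - \<sigma>) \<phi> x \<partial>\<mu>) \<partial>lborel)
    = (\<integral>\<^sup>+\<sigma>. (\<integral>\<^sup>+x. indicator {..t} \<sigma> * nn_heat (t - \<sigma>) \<phi> x \<partial>lborel) \<partial>\<mu>)"
    by (rule P.Fubini') measurable
  also have "\<dots> = (\<integral>\<^sup>+\<sigma>. indicator {..t} \<sigma> * (\<integral>\<^sup>+x. \<phi> x \<partial>lborel) \<partial>\<mu>)"
    by (intro nn_integral_cong) (simp add: nn_integral_cmult nn_integral_nn_heat)
  also have "\<dots> = (\<integral>\<^sup>+\<sigma>. indicator {..t} \<sigma> \<partial>\<mu>) * (\<integral>\<^sup>+x. \<phi> x \<partial>lborel)"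
    by (rule nn_integral_multc) measurable
  also have "\<dots> \<le> ennreal m * ennreal Q"
    using nn_integral_indicator_\<mu>_le Q by (intro mult_mono) auto
  also have "ennreal (m powr (q - 1)) * (ennreal m * ennreal Q) = ennreal (m powr q * Q)"
    using \<mu>(3) Q(2) by (simp add: ennreal_mult[symmetric] powr_diff)
  finally show ?thesis by (simp add: mult_left_mono)
qed

text \<open>Only the excess power \<open>(p - 1) / q\<close> is estimated in the sup norm, by
  smoothing from \<open>L^1\<close>; this produces the time singularity with exponent
  \<open>\<kappa>\<close>. The factor with power \<open>1 / q\<close> is kept as it is.\<close>

lemma nn_heat_epow_le:
  assumes "1 < p" "0 < s"
  shows "epow (nn_heat s \<phi> x) (p / q) \<le>
    ennreal (((4 * pi) powr (- real CARD('n) / 2) * Q) powr ((p - 1) / q) * s powr (- (real CARD('n) * (p - 1) / (2 * q))))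
      * epow (nn_heat s \<phi> x) (1 / q)"
proof -
  have "nn_heat s \<phi> x \<le> ennreal ((4 * pi * s) powr (- real CARD('n) / 2)) * ennreal Q"
    by (rule order_trans[OF nn_heat_smoothing mult_left_mono[OF Q(1)]]) (use assms in auto)
  also have "\<dots> = ennreal ((4 * pi * s) powr (- real CARD('n) / 2) * Q)"
    using Q by (simp add: ennreal_mult)
  finally have "epow (nn_heat s \<phi> x) ((p - 1) / q)
      \<le> epow (ennreal ((4 * pi * s) powr (- real CARD('n) / 2) * Q)) ((p - 1) / q)"
    using assms q by (intro epow_mono) auto
  also have "\<dots> = ennreal (((4 * pi * s) powr (- real CARD('n) / 2) * Q) powr ((p - 1) / q))"
    using Q by simp
  also have "((4 * pi * s) powr (- real CARD('n) / 2) * Q) powr ((p - 1) / q)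
    = ((4 * pi) powr (- real CARD('n) / 2) * Q) powr ((p - 1) / q) * s powr (- (real CARD('n) * (p - 1) / (2 * q)))"
    using assms Q by (simp add: powr_mult powr_powr)
  finally have "epow (nn_heat s \<phi> x) ((p - 1) / q) * epow (nn_heat s \<phi> x) (1 / q) \<le>
    ennreal (((4 * pi) powr (- real CARD('n) / 2) * Q) powr ((p - 1) / q) * s powr (- (real CARD('n) * (p - 1) / (2 * q))))
      * epow (nn_heat s \<phi> x) (1 / q)"
    by (rule mult_right_mono) simp
  moreover have "epow (nn_heat s \<phi> x) (p / q) = epow (nn_heat s \<phi> x) ((p - 1) / q) * epow (nn_heat s \<phi> x) (1 / q)"
    using q by (simp add: epow_add[symmetric] diff_divide_distrib)
  ultimately show ?thesis by simp
qed

text \<open>Jensen's inequality turns \<open>B\<^sup>p\<close> into a superposition of \<open>K\<^sup>p\<close> with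
  \<open>K s = (S(s) \<phi>)\<^sup>1\<^sup>/\<^sup>q\<close>; one factor \<open>K\<^sup>p\<^sup>-\<^sup>1\<close> is absorbed by the smoothing
  estimate, and the remaining factor is a subsolution of the heat flow.\<close>

lemma duhamel_majorant_le:
  fixes p :: real
  defines "\<kappa> \<equiv> real CARD('n) * (p - 1) / (2 * q)"
  assumes p: "1 < p" and \<kappa>: "\<kappa> < 1"
  shows "\<exists>C\<ge>0. \<forall>a t x. a \<le> t \<longrightarrow> duhamel a t (\<lambda>\<tau> y. epow (majorant \<mu> q \<phi> \<tau> y) p) x
    \<le> ennreal (C * (t - a) powr (1 - \<kappa>)) * majorant \<mu> q \<phi> t x"
proof -
  define c0 where "c0 = ((4 * pi) powr (- real CARD('n) / 2) * Q) powr ((p - 1) / q)"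
  have c0: "0 \<le> c0" by (simp add: c0_def)
  \<comment> \<open>There is no smoothing at time 0; the value \<open>top\<close> makes
    \<open>Kp\<close> hold there too, keeps \<open>c\<close> decreasing, and is met at one time
    \<open>\<tau>\<close> only.\<close>
  define c where "c s = (if s \<le> 0 then top else ennreal (c0 * s powr (- \<kappa>)))" for s
  have [measurable]: "c \<in> borel_measurable borel" unfolding c_def by measurable
  have [measurable (raw)]: "(\<lambda>w. c (f w)) \<in> borel_measurable N" if "f \<in> borel_measurable N" for f :: "'c \<Rightarrow> real" and N
    by (rule measurable_compose[OF that]) fact
  define K where "K s x = epow (nn_heat s \<phi> x) (1 / q)" for s x
  have Kmeas: "(\<lambda>w. K (f w) (g w)) \<in> borel_measurable N" if [measurable]: "f \<in> borel_measurable N" "g \<in> borel_measurable N" for f g and N :: "'c measure"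
    unfolding K_def by measurable
  have \<kappa>0: "0 \<le> \<kappa>" unfolding \<kappa>_def using p q by (intro divide_nonneg_nonneg mult_nonneg_nonneg) auto
  have c_anti: "c s \<le> c r" if "r \<le> s" for r s
    using that \<kappa>0 unfolding c_def
    by (auto intro!: ennreal_leI mult_left_mono powr_mono2' simp: c0)
  have Kp: "epow (K s y) p \<le> c s * K s y" if "0 \<le> s" for s y
  proof (cases "s = 0")
    case True
    then show ?thesis by (cases "\<phi> y = 0") (auto simp: c_def K_def ennreal_top_mult)
  next
    case False
    then show ?thesis
      using nn_heat_epow_le[OF p, of s y] that q by (simp add: c_def K_def epow_epow c0_def \<kappa>_def)
  qed
  have Kheat: "nn_heat (t - \<tau>) (K (\<tau> - \<sigma>)) x \<le> K (t - \<sigma>) x" if "\<sigma> \<le> \<tau>" "\<tau> \<le> t" for t \<tau> \<sigma> x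
  proof -
    have "nn_heat (t - \<tau>) (K (\<tau> - \<sigma>)) x \<le> epow (nn_heat (t - \<tau>) (nn_heat (\<tau> - \<sigma>) \<phi>) x) (1 / q)"
      unfolding K_def using q by (intro nn_heat_jensen_root) auto
    then show ?thesis using that by (simp add: nn_heat_nn_heat K_def)
  qed
  have ind: "indicator {..\<tau>} \<sigma> = (if \<sigma> \<le> \<tau> then 1 else 0 :: ennreal)" for \<sigma> \<tau> :: real
    by (simp add: indicator_def)
  have ind2: "indicator {a..\<tau>} \<sigma> = (if a \<le> \<sigma> \<and> \<sigma> \<le> \<tau> then 1 else 0 :: ennreal)" for a \<sigma> \<tau> :: real
    by (simp add: indicator_def)
  have maj: "majorant \<mu> q \<phi> t x = (\<integral>\<^sup>+\<sigma>. indicator {..t} \<sigma> * K (t - \<sigma>) x \<partial>\<mu>)" for t x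
    by (simp add: majorant_def K_def)
  have step: "nn_heat (t - \<tau>) (\<lambda>y. epow (majorant \<mu> q \<phi> \<tau> y) p) x
    \<le> ennreal (m powr (p - 1)) * (\<integral>\<^sup>+\<sigma>. indicator {..\<tau>} \<sigma> * c (\<tau> - \<sigma>) * K (t - \<sigma>) x \<partial>\<mu>)"
    if "\<tau> \<le> t" for \<tau> t x
  proof -
    note [measurable] = Kmeas
    have "epow (majorant \<mu> q \<phi> \<tau> y) p \<le> ennreal (m powr (p - 1)) *
        (\<integral>\<^sup>+\<sigma>. indicator {..\<tau>} \<sigma> * c (\<tau> - \<sigma>) * K (\<tau> - \<sigma>) y \<partial>\<mu>)" for y
    proof -
      have "epow (majorant \<mu> q \<phi> \<tau> y) p \<le> ennreal (m powr (p - 1)) *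
        (\<integral>\<^sup>+\<sigma>. indicator {..\<tau>} \<sigma> * epow (K (\<tau> - \<sigma>) y) p \<partial>\<mu>)"
        unfolding maj using p \<mu>(3) nn_integral_indicator_\<mu>_le
        by (intro nn_integral_jensen) auto
      also have "(\<integral>\<^sup>+\<sigma>. indicator {..\<tau>} \<sigma> * epow (K (\<tau> - \<sigma>) y) p \<partial>\<mu>)
          \<le> (\<integral>\<^sup>+\<sigma>. indicator {..\<tau>} \<sigma> * c (\<tau> - \<sigma>) * K (\<tau> - \<sigma>) y \<partial>\<mu>)"
        by (intro nn_integral_mono) (auto simp: indicator_def intro: Kp)
      finally show ?thesis by (simp add: mult_left_mono)
    qed
    then have "nn_heat (t - \<tau>) (\<lambda>y. epow (majorant \<mu> q \<phi> \<tau> y) p) x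
      \<le> nn_heat (t - \<tau>) (\<lambda>y. ennreal (m powr (p - 1)) *
        (\<integral>\<^sup>+\<sigma>. indicator {..\<tau>} \<sigma> * c (\<tau> - \<sigma>) * K (\<tau> - \<sigma>) y \<partial>\<mu>)) x"
      by (rule nn_heat_mono)
    also have "\<dots> = ennreal (m powr (p - 1)) *
        nn_heat (t - \<tau>) (\<lambda>y. \<integral>\<^sup>+\<sigma>. indicator {..\<tau>} \<sigma> * c (\<tau> - \<sigma>) * K (\<tau> - \<sigma>) y \<partial>\<mu>) x"
      unfolding ind by (rule nn_heat_cmult) measurable
    also have "nn_heat (t - \<tau>) (\<lambda>y. \<integral>\<^sup>+\<sigma>. indicator {..\<tau>} \<sigma> * c (\<tau> - \<sigma>) * K (\<tau> - \<sigma>) y \<partial>\<mu>) x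
      = (\<integral>\<^sup>+\<sigma>. nn_heat (t - \<tau>) (\<lambda>y. indicator {..\<tau>} \<sigma> * c (\<tau> - \<sigma>) * K (\<tau> - \<sigma>) y) x \<partial>\<mu>)"
      unfolding ind by (rule nn_heat_nn_integral) (unfold_locales, measurable)
    also have "\<dots> = (\<integral>\<^sup>+\<sigma>. indicator {..\<tau>} \<sigma> * c (\<tau> - \<sigma>) * nn_heat (t - \<tau>) (K (\<tau> - \<sigma>)) x \<partial>\<mu>)"
      by (intro nn_integral_cong nn_heat_cmult) measurable
    also have "\<dots> \<le> (\<integral>\<^sup>+\<sigma>. indicator {..\<tau>} \<sigma> * c (\<tau> - \<sigma>) * K (t - \<sigma>) x \<partial>\<mu>)"
      using that by (intro nn_integral_mono) (auto simp: indicator_def intro!: mult_left_mono Kheat)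
    finally show ?thesis by (simp add: mult_left_mono)
  qed
  have time: "(\<integral>\<^sup>+\<tau>. indicator {a..t} \<tau> * (indicator {..\<tau>} \<sigma> * c (\<tau> - \<sigma>)) \<partial>lborel)
      \<le> ennreal (c0 * ((t - a) powr (1 - \<kappa>) / (1 - \<kappa>)))" if "a \<le> t" "\<sigma> \<le> t" for a t \<sigma>
  proof -
    \<comment> \<open>The time variable runs over \<open>[e, t]\<close>, while the singularity sits
      at \<open>\<sigma>\<close>, possibly earlier. Shifting it to \<open>e\<close> only increases
      the integrand and makes the bound independent of \<open>\<sigma>\<close>.\<close>
    define e where "e = max a \<sigma>"
    have e: "a \<le> e" "\<sigma> \<le> e" "e \<le> t" using that by (auto simp: e_def)
    have "AE \<tau> in lborel. \<tau> \<noteq> e" by (rule AE_lborel_singleton)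
    then have "(\<integral>\<^sup>+\<tau>. indicator {a..t} \<tau> * (indicator {..\<tau>} \<sigma> * c (\<tau> - \<sigma>)) \<partial>lborel)
       \<le> (\<integral>\<^sup>+\<tau>. ennreal c0 * ennreal (indicator {e..t} \<tau> * (\<tau> - e) powr (- \<kappa>)) \<partial>lborel)"
    proof (intro nn_integral_mono_AE, eventually_elim)
      case (elim \<tau>)
      show ?case
      proof (cases "\<tau> \<in> {a..t} \<and> \<sigma> \<le> \<tau>")
        case True
        then have "e < \<tau>" using elim by (auto simp: e_def)
        then have "c (\<tau> - \<sigma>) \<le> c (\<tau> - e)" using e by (intro c_anti) auto
        with \<open>e < \<tau>\<close> True show ?thesis by (simp add: c_def ennreal_mult c0)
      qed (auto simp: indicator_def)
    qed
    also have "\<dots> = ennreal c0 * ennreal ((t - e) powr (1 - \<kappa>) / (1 - \<kappa>))"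
      using nn_integral_powr_Icc[of "- \<kappa>" e t] \<kappa> e by (subst nn_integral_cmult) (auto simp: add.commute)
    also have "\<dots> \<le> ennreal c0 * ennreal ((t - a) powr (1 - \<kappa>) / (1 - \<kappa>))"
      using e \<kappa> by (intro mult_left_mono ennreal_leI divide_right_mono powr_mono2) auto
    also have "\<dots> = ennreal (c0 * ((t - a) powr (1 - \<kappa>) / (1 - \<kappa>)))"
      using c0 \<kappa> by (intro ennreal_mult[symmetric]) auto
    finally show ?thesis .
  qed
  have "duhamel a t (\<lambda>\<tau> y. epow (majorant \<mu> q \<phi> \<tau> y) p) x
    \<le> ennreal (m powr (p - 1) * (c0 / (1 - \<kappa>)) * (t - a) powr (1 - \<kappa>)) * majorant \<mu> q \<phi> t x" if "a \<le> t" for a t x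
  proof -
    note [measurable] = Kmeas
    interpret P: pair_sigma_finite \<mu> "lborel :: real measure" ..
    have "duhamel a t (\<lambda>\<tau> y. epow (majorant \<mu> q \<phi> \<tau> y) p) x
      \<le> (\<integral>\<^sup>+\<tau>. indicator {a..t} \<tau> * (ennreal (m powr (p - 1)) * (\<integral>\<^sup>+\<sigma>. indicator {..\<tau>} \<sigma> * c (\<tau> - \<sigma>) * K (t - \<sigma>) x \<partial>\<mu>)) \<partial>lborel)"
      unfolding duhamel_def
      by (intro nn_integral_mono) (auto simp: indicator_def[of "{a..t}"] intro!: step)
    also have "\<dots> = (\<integral>\<^sup>+\<tau>. (\<integral>\<^sup>+\<sigma>. ennreal (m powr (p - 1)) * (indicator {a..t} \<tau> * (indicator {..\<tau>} \<sigma> * c (\<tau> - \<sigma>)) * K (t - \<sigma>) x) \<partial>\<mu>) \<partial>lborel)"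
      unfolding ind ind2
      by (simp add: nn_integral_cmult[symmetric] mult_ac)
    also have "\<dots> = (\<integral>\<^sup>+\<sigma>. (\<integral>\<^sup>+\<tau>. ennreal (m powr (p - 1)) * (indicator {a..t} \<tau> * (indicator {..\<tau>} \<sigma> * c (\<tau> - \<sigma>)) * K (t - \<sigma>) x) \<partial>lborel) \<partial>\<mu>)"
      unfolding ind ind2 by (rule P.Fubini') measurable
    also have "\<dots> = (\<integral>\<^sup>+\<sigma>. ennreal (m powr (p - 1)) * ((\<integral>\<^sup>+\<tau>. indicator {a..t} \<tau> * (indicator {..\<tau>} \<sigma> * c (\<tau> - \<sigma>)) \<partial>lborel) * K (t - \<sigma>) x) \<partial>\<mu>)"
      unfolding ind ind2 by (simp add: nn_integral_cmult nn_integral_multc)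
    also have "\<dots> \<le> (\<integral>\<^sup>+\<sigma>. ennreal (m powr (p - 1)) * (ennreal (c0 * ((t - a) powr (1 - \<kappa>) / (1 - \<kappa>))) * (indicator {..t} \<sigma> * K (t - \<sigma>) x)) \<partial>\<mu>)"
    proof (intro nn_integral_mono mult_left_mono)
      fix \<sigma>
      show "(\<integral>\<^sup>+\<tau>. indicator {a..t} \<tau> * (indicator {..\<tau>} \<sigma> * c (\<tau> - \<sigma>)) \<partial>lborel) * K (t - \<sigma>) x
        \<le> ennreal (c0 * ((t - a) powr (1 - \<kappa>) / (1 - \<kappa>))) * (indicator {..t} \<sigma> * K (t - \<sigma>) x)"
      proof (cases "\<sigma> \<le> t")
        case True
        then show ?thesis using time[OF that True] by (simp add: mult_right_mono)
      next
        case False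
        then have "(\<integral>\<^sup>+\<tau>. indicator {a..t} \<tau> * (indicator {..\<tau>} \<sigma> * c (\<tau> - \<sigma>)) \<partial>lborel) = (\<integral>\<^sup>+\<tau>. 0 \<partial>(lborel :: real measure))"
          by (intro nn_integral_cong) (auto simp: indicator_def)
        then show ?thesis by simp
      qed
    qed auto
    also have "\<dots> = ennreal (m powr (p - 1)) * (ennreal (c0 * ((t - a) powr (1 - \<kappa>) / (1 - \<kappa>))) * majorant \<mu> q \<phi> t x)"
      unfolding maj ind by (simp add: nn_integral_cmult)
    also have "\<dots> = ennreal (m powr (p - 1) * (c0 / (1 - \<kappa>)) * (t - a) powr (1 - \<kappa>)) * majorant \<mu> q \<phi> t x"
      using c0 \<kappa> by (simp add: ennreal_mult[symmetric] mult.assoc[symmetric])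
    finally show ?thesis .
  qed
  then show ?thesis
    using c0 \<kappa> by (intro exI[of _ "m powr (p - 1) * (c0 / (1 - \<kappa>))"]) auto
qed

end

text \<open>The measure \<open>\<delta>\<^sub>0 + \<sigma>\<^sup>\<rho> d\<sigma>\<close> on \<open>[0, 1]\<close>: the Dirac mass is the
  image of Lebesgue measure on \<open>[-1, 0)\<close> under \<open>max 0\<close>.\<close>

definition time_weight :: "real \<Rightarrow> real measure" where
  "time_weight \<rho> = distr (density lborel (\<lambda>\<sigma>. ennreal (if \<sigma> < 0 then indicator {-1..<0} \<sigma> else indicator {0..1} \<sigma> * \<sigma> powr \<rho>)))
     borel (max 0)"

lemma sets_time_weight: "sets (time_weight \<rho>) = sets borel"
  by (simp add: time_weight_def)

lemma nn_integral_time_weight: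
  assumes [measurable]: "f \<in> borel_measurable borel"
  shows "(\<integral>\<^sup>+\<sigma>. f \<sigma> \<partial>time_weight \<rho>)
    = f 0 + (\<integral>\<^sup>+\<sigma>. ennreal (indicator {0..1} \<sigma> * \<sigma> powr \<rho>) * f \<sigma> \<partial>lborel)"
proof -
  have "(\<integral>\<^sup>+\<sigma>. f \<sigma> \<partial>time_weight \<rho>) = (\<integral>\<^sup>+\<sigma>. ennreal (if \<sigma> < 0 then indicator {-1..<0} \<sigma> else indicator {0..1} \<sigma> * \<sigma> powr \<rho>) * f (max 0 \<sigma>) \<partial>lborel)"
    unfolding time_weight_def by (subst nn_integral_distr) (auto simp: nn_integral_density)
  also have "\<dots> = (\<integral>\<^sup>+\<sigma>. f 0 * indicator {-1..<0} \<sigma> + ennreal (indicator {0..1} \<sigma> * \<sigma> powr \<rho>) * f \<sigma> \<partial>lborel)"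
    by (intro nn_integral_cong) (auto simp: indicator_def max_def)
  also have "\<dots> = (\<integral>\<^sup>+\<sigma>. f 0 * indicator {-1..<0::real} \<sigma> \<partial>lborel) + (\<integral>\<^sup>+\<sigma>. ennreal (indicator {0..1} \<sigma> * \<sigma> powr \<rho>) * f \<sigma> \<partial>lborel)"
    by (subst nn_integral_add) auto
  also have "(\<integral>\<^sup>+\<sigma>. f 0 * indicator {-1..<0::real} \<sigma> \<partial>lborel) = f 0 * emeasure lborel {-1..<0::real}"
    by (rule nn_integral_cmult_indicator) simp
  finally show ?thesis by simp
qed

lemma emeasure_time_weight:
  assumes "-1 < \<rho>"
  shows "emeasure (time_weight \<rho>) UNIV = ennreal (1 + 1 / (\<rho> + 1))"
proof -
  have "emeasure (time_weight \<rho>) UNIV = (\<integral>\<^sup>+\<sigma>. indicator UNIV \<sigma> \<partial>time_weight \<rho>)"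
    by (subst nn_integral_indicator) (auto simp: sets_time_weight)
  also have "\<dots> = 1 + ennreal (1 / (\<rho> + 1))"
    using nn_integral_powr_Icc[of \<rho> 0 1] assms by (subst nn_integral_time_weight) auto
  finally show ?thesis using assms by simp
qed

section \<open>The majorant of given data in a Lebesgue space\<close>

lemma Lq_measurable [measurable_dest]: "f \<in> Lq q \<Longrightarrow> f \<in> borel_measurable borel"
  by (simp add: Lq_def)

lemma nn_integral_Lq: "f \<in> Lq q \<Longrightarrow> (\<integral>\<^sup>+x. epow (ennreal \<bar>f x\<bar>) q \<partial>lborel) = ennreal (LINT x|lborel. \<bar>f x\<bar> powr q)"
  by (auto simp: Lq_def intro!: nn_integral_eq_integral)

lemma Lq_iff:
  assumes [measurable]: "f \<in> borel_measurable borel"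
  shows "f \<in> Lq q \<longleftrightarrow> (\<integral>\<^sup>+x. epow (ennreal \<bar>f x\<bar>) q \<partial>lborel) < top"
  by (simp add: Lq_def integrable_iff_bounded)

definition linear_majorant :: "real \<Rightarrow> (real ^ 'n \<Rightarrow> real) \<Rightarrow> (real ^ 'n \<Rightarrow> real) \<Rightarrow> real \<Rightarrow> real ^ 'n \<Rightarrow> ennreal" where
  "linear_majorant \<rho> u0 w t x = nn_heat t (\<lambda>y. ennreal \<bar>u0 y\<bar>) x
     + duhamel 0 t (\<lambda>\<tau> y. ennreal (\<tau> powr \<rho> * \<bar>w y\<bar>)) x"

text \<open>With \<open>\<phi>\<close> the sum of both \<open>q\<close>-th powers, a single
  \<open>K\<close> dominates the flows of \<open>|u0|\<close> and of \<open>|w|\<close>: write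
  \<open>|f|\<close> as the root of its own \<open>q\<close>-th power and apply
  \<open>nn_heat_jensen_root\<close>. The time weight is cut off at 1 to have finite mass, whence
  the restriction \<open>t \<le> 1\<close>.\<close>

lemma majorant_exists:
  fixes u0 w :: "real ^ 'n \<Rightarrow> real" and p q \<rho> :: real
  assumes p: "1 < p" and q: "1 \<le> q" and \<rho>: "-1 < \<rho>" and \<kappa>: "real CARD('n) * (p - 1) / (2 * q) < 1"
    and u0: "u0 \<in> Lq q" and w: "w \<in> Lq q"
  obtains B :: "real \<Rightarrow> real ^ 'n \<Rightarrow> ennreal" and b C :: real
  where "case_prod B \<in> borel_measurable (borel \<Otimes>\<^sub>M borel)"
    and "\<And>t x. 0 \<le> t \<Longrightarrow> t \<le> 1 \<Longrightarrow> linear_majorant \<rho> u0 w t x \<le> B t x"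
    and "0 \<le> b" "\<And>t. (\<integral>\<^sup>+x. epow (B t x) q \<partial>lborel) \<le> ennreal b"
    and "0 \<le> C"
    and "\<And>a t x. a \<le> t \<Longrightarrow> duhamel a t (\<lambda>\<tau> y. epow (B \<tau> y) p) x
      \<le> ennreal (C * (t - a) powr (1 - real CARD('n) * (p - 1) / (2 * q))) * B t x"
proof -
  note [measurable] = Lq_measurable[OF u0] Lq_measurable[OF w]
  define \<phi> where "\<phi> x = epow (ennreal \<bar>u0 x\<bar>) q + epow (ennreal \<bar>w x\<bar>) q" for x
  have \<phi> [measurable]: "\<phi> \<in> borel_measurable borel" unfolding \<phi>_def by measurable
  define Q where "Q = (LINT x|lborel. \<bar>u0 x\<bar> powr q) + (LINT x|lborel. \<bar>w x\<bar> powr q)"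
  have Q0: "0 \<le> Q" by (simp add: Q_def)
  have Q: "(\<integral>\<^sup>+x. \<phi> x \<partial>lborel) \<le> ennreal Q"
    using nn_integral_Lq[OF u0] nn_integral_Lq[OF w]
    by (simp add: \<phi>_def Q_def nn_integral_add)
  define m where "m = 1 + 1 / (\<rho> + 1)"
  have m: "0 < m" using \<rho> by (simp add: m_def add_pos_pos)
  have em: "emeasure (time_weight \<rho>) UNIV \<le> ennreal m"
    using emeasure_time_weight[OF \<rho>] by (simp add: m_def)
  define B where "B = majorant (time_weight \<rho>) q \<phi>"
  note facts = q sets_time_weight[of \<rho>] em m \<phi> Q Q0
  obtain C where C: "0 \<le> C" "\<And>a t x. a \<le> t \<Longrightarrow> duhamel a t (\<lambda>\<tau> y. epow (B \<tau> y) p) x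
      \<le> ennreal (C * (t - a) powr (1 - real CARD('n) * (p - 1) / (2 * q))) * B t x"
    using duhamel_majorant_le[OF facts p \<kappa>] unfolding B_def by blast
  show thesis
  proof (rule that[of B "m powr q * Q" C])
    show "case_prod B \<in> borel_measurable (borel \<Otimes>\<^sub>M borel)"
      unfolding B_def by (rule measurable_majorant[OF facts])
    show "(\<integral>\<^sup>+x. epow (B t x) q \<partial>lborel) \<le> ennreal (m powr q * Q)" for t
      unfolding B_def by (rule majorant_norm[OF facts])
    fix t x assume t: "0 \<le> t" "t \<le> (1 :: real)"
    define K where "K s = epow (nn_heat s \<phi> x) (1 / q)" for s
    have le: "nn_heat s (\<lambda>y. ennreal \<bar>f y\<bar>) x \<le> K s"
      if [measurable]: "f \<in> borel_measurable borel" and f: "f = u0 \<or> f = w" for f s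
    proof -
      have "nn_heat s (\<lambda>y. ennreal \<bar>f y\<bar>) x = nn_heat s (\<lambda>y. epow (epow (ennreal \<bar>f y\<bar>) q) (1 / q)) x"
        using q by (simp only: epow_epow) simp
      also have "\<dots> \<le> epow (nn_heat s (\<lambda>y. epow (ennreal \<bar>f y\<bar>) q) x) (1 / q)"
        using q by (intro nn_heat_jensen_root) measurable
      also have "\<dots> \<le> K s"
        unfolding K_def using f q by (intro epow_mono nn_heat_mono) (auto simp: \<phi>_def)
      finally show ?thesis .
    qed
    have [measurable]: "K \<in> borel_measurable borel" unfolding K_def by measurable
    have "B t x = (\<integral>\<^sup>+\<sigma>. indicator {..t} \<sigma> * K (t - \<sigma>) \<partial>time_weight \<rho>)"
      by (simp add: B_def majorant_def K_def)
    also have "\<dots> = K t + (\<integral>\<^sup>+\<sigma>. ennreal (indicator {0..1} \<sigma> * \<sigma> powr \<rho>) * (indicator {..t} \<sigma> * K (t - \<sigma>)) \<partial>lborel)"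
      using t by (subst nn_integral_time_weight) auto
    also have "(\<integral>\<^sup>+\<sigma>. ennreal (indicator {0..1} \<sigma> * \<sigma> powr \<rho>) * (indicator {..t} \<sigma> * K (t - \<sigma>)) \<partial>lborel)
      = (\<integral>\<^sup>+\<sigma>. indicator {0..t} \<sigma> * (ennreal (\<sigma> powr \<rho>) * K (t - \<sigma>)) \<partial>lborel)"
      using t by (intro nn_integral_cong) (auto simp: indicator_def)
    finally have Beq: "B t x = K t + (\<integral>\<^sup>+\<sigma>. indicator {0..t} \<sigma> * (ennreal (\<sigma> powr \<rho>) * K (t - \<sigma>)) \<partial>lborel)" .
    have "duhamel 0 t (\<lambda>\<tau> y. ennreal (\<tau> powr \<rho> * \<bar>w y\<bar>)) x
       = (\<integral>\<^sup>+\<sigma>. indicator {0..t} \<sigma> * (ennreal (\<sigma> powr \<rho>) * nn_heat (t - \<sigma>) (\<lambda>y. ennreal \<bar>w y\<bar>) x) \<partial>lborel)"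
      by (simp add: duhamel_def ennreal_mult nn_heat_cmult)
    also have "\<dots> \<le> (\<integral>\<^sup>+\<sigma>. indicator {0..t} \<sigma> * (ennreal (\<sigma> powr \<rho>) * K (t - \<sigma>)) \<partial>lborel)"
      by (intro nn_integral_mono mult_left_mono le) auto
    finally show "linear_majorant \<rho> u0 w t x \<le> B t x"
      unfolding linear_majorant_def Beq by (intro add_mono le) auto
  qed (use C Q0 m in auto)
qed

section \<open>Lebesgue norms\<close>

lemma Lq_norm_nonneg [simp]: "0 \<le> Lq_norm q f"
  by (simp add: Lq_norm_def)

lemma Lq_norm_powr: "0 < q \<Longrightarrow> Lq_norm q f powr q = (LINT x|lborel. \<bar>f x\<bar> powr q)"
  by (simp add: Lq_norm_def powr_powr)

lemma nn_integral_Lq_norm: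
  "f \<in> Lq q \<Longrightarrow> 0 < q \<Longrightarrow> (\<integral>\<^sup>+x. epow (ennreal \<bar>f x\<bar>) q \<partial>lborel) = ennreal (Lq_norm q f powr q)"
  by (simp add: nn_integral_Lq Lq_norm_powr del: epow_ennreal)

lemma Lq_norm_le_iff:
  assumes f: "f \<in> Lq q" and q: "0 < q" and c: "0 \<le> c"
  shows "Lq_norm q f \<le> c \<longleftrightarrow> (\<integral>\<^sup>+x. epow (ennreal \<bar>f x\<bar>) q \<partial>lborel) \<le> ennreal (c powr q)"
proof -
  have "Lq_norm q f \<le> c \<longleftrightarrow> Lq_norm q f powr q \<le> c powr q"
    using q c by (meson Lq_norm_nonneg not_le powr_less_mono2 powr_mono2 less_imp_le)
  then show ?thesis using nn_integral_Lq_norm[OF f q] by (simp del: epow_ennreal)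
qed

lemma Lq_bound:
  assumes [measurable]: "f \<in> borel_measurable borel" and q: "0 < q" and c: "0 \<le> c"
    and le: "(\<integral>\<^sup>+x. epow (ennreal \<bar>f x\<bar>) q \<partial>lborel) \<le> ennreal (c powr q)"
  shows "f \<in> Lq q" and "Lq_norm q f \<le> c"
proof -
  show "f \<in> Lq q" using le by (auto simp: Lq_iff simp del: epow_ennreal intro: le_less_trans)
  then show "Lq_norm q f \<le> c" using assms by (simp add: Lq_norm_le_iff del: epow_ennreal)
qed

lemma Lq_bound_majorant:
  assumes [measurable]: "f \<in> borel_measurable borel" "B \<in> borel_measurable borel"
    and q: "0 < q" and b: "0 \<le> b" and c: "0 \<le> c"
    and B: "(\<integral>\<^sup>+x. epow (B x) q \<partial>lborel) \<le> ennreal (b powr q)"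
    and le: "AE x in lborel. ennreal \<bar>f x\<bar> \<le> ennreal c * B x"
  shows "f \<in> Lq q" and "Lq_norm q f \<le> c * b"
proof -
  have "(\<integral>\<^sup>+x. epow (ennreal \<bar>f x\<bar>) q \<partial>lborel) \<le> (\<integral>\<^sup>+x. ennreal (c powr q) * epow (B x) q \<partial>lborel)"
  proof (intro nn_integral_mono_AE)
    show "AE x in lborel. epow (ennreal \<bar>f x\<bar>) q \<le> ennreal (c powr q) * epow (B x) q"
      using le
    proof eventually_elim
      case (elim x)
      then have "epow (ennreal \<bar>f x\<bar>) q \<le> epow (ennreal c * B x) q" using q by (intro epow_mono) auto
      then show ?case using c by (simp add: epow_mult)
    qed
  qed
  also have "\<dots> = ennreal (c powr q) * (\<integral>\<^sup>+x. epow (B x) q \<partial>lborel)"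
    by (rule nn_integral_cmult) measurable
  also have "\<dots> \<le> ennreal (c powr q) * ennreal (b powr q)"
    using B by (intro mult_left_mono) auto
  also have "\<dots> = ennreal ((c * b) powr q)"
    using b c by (simp add: ennreal_mult powr_mult)
  finally have *: "(\<integral>\<^sup>+x. epow (ennreal \<bar>f x\<bar>) q \<partial>lborel) \<le> ennreal ((c * b) powr q)" .
  show "f \<in> Lq q" "Lq_norm q f \<le> c * b"
    by (rule Lq_bound[OF _ q _ *]; use b c in simp)+
qed

lemma Lq_norm_cong_AE:
  assumes "AE x in lborel. f x = g x" "f \<in> borel_measurable borel" "g \<in> borel_measurable borel"
  shows "Lq_norm q f = Lq_norm q g"
proof -
  note [measurable] = assms(2,3)
  show ?thesis unfolding Lq_norm_def
    using assms(1) by (subst integral_cong_AE[where g = "\<lambda>x. \<bar>g x\<bar> powr q"]) auto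
qed

lemma Lq_cong_AE:
  assumes "AE x in lborel. f x = g x" "f \<in> Lq q" "g \<in> borel_measurable borel"
  shows "g \<in> Lq q"
proof -
  note [measurable] = assms(3) Lq_measurable[OF assms(2)]
  have "(\<integral>\<^sup>+x. epow (ennreal \<bar>f x\<bar>) q \<partial>lborel) = (\<integral>\<^sup>+x. epow (ennreal \<bar>g x\<bar>) q \<partial>lborel)"
    using assms(1) by (intro nn_integral_cong_AE) auto
  with assms(2) show ?thesis by (simp add: Lq_iff del: epow_ennreal)
qed

lemma Lq_mono:
  assumes [measurable]: "f \<in> borel_measurable borel" and g: "g \<in> Lq q" and q: "0 < q"
    and le: "AE x in lborel. \<bar>f x\<bar> \<le> \<bar>g x\<bar>"
  shows "f \<in> Lq q" and "Lq_norm q f \<le> Lq_norm q g"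
proof -
  note [measurable] = Lq_measurable[OF g]
  have *: "(\<integral>\<^sup>+x. epow (ennreal \<bar>g x\<bar>) q \<partial>lborel) \<le> ennreal (Lq_norm q g powr q)"
    using nn_integral_Lq_norm[OF g q] by (simp del: epow_ennreal)
  show "f \<in> Lq q" "Lq_norm q f \<le> Lq_norm q g"
    using Lq_bound_majorant[of f "\<lambda>x. ennreal \<bar>g x\<bar>" q "Lq_norm q g" 1] q le * by auto
qed

lemma Lq_uminus: "f \<in> Lq q \<Longrightarrow> (\<lambda>x. - f x) \<in> Lq q"
  and Lq_norm_uminus: "Lq_norm q (\<lambda>x. - f x) = Lq_norm q f"
  by (simp_all add: Lq_def Lq_norm_def)

lemma Lq_norm_minus_commute: "Lq_norm q (\<lambda>x. f x - g x) = Lq_norm q (\<lambda>x. g x - f x)"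
  by (simp add: Lq_norm_def abs_minus_commute)

lemma powr_convex_combination:
  fixes x y \<theta> q :: real
  assumes "1 \<le> q" "0 \<le> x" "0 \<le> y" "0 < \<theta>" "\<theta> < 1"
  shows "(\<theta> * x + (1 - \<theta>) * y) powr q \<le> \<theta> * x powr q + (1 - \<theta>) * y powr q"
proof (cases "\<theta> * x + (1 - \<theta>) * y = 0")
  case False
  define s where "s = \<theta> * x + (1 - \<theta>) * y"
  have "0 \<le> s" using assms by (simp add: s_def)
  with False have s: "0 < s" by (simp add: s_def)
  have "q * s powr q = q * s powr (q - 1) * s" using s by (simp add: powr_diff)
  also have "\<dots> = \<theta> * (q * s powr (q - 1) * x) + (1 - \<theta>) * (q * s powr (q - 1) * y)"
    by (subst (2) s_def) (simp add: algebra_simps)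
  also have "\<dots> \<le> \<theta> * (x powr q + (q - 1) * s powr q) + (1 - \<theta>) * (y powr q + (q - 1) * s powr q)"
    using assms s by (intro add_mono mult_left_mono powr_tangent) auto
  finally have "s powr q \<le> \<theta> * x powr q + (1 - \<theta>) * y powr q" by (simp add: algebra_simps)
  then show ?thesis by (simp only: s_def)
qed (use assms in simp)

text \<open>Minkowski's inequality by convexity: \<open>f + g\<close> is \<open>a + b\<close> times
  the combination of \<open>f / a\<close> and \<open>g / b\<close> with weights
  \<open>\<theta> = a / (a + b)\<close> and \<open>1 - \<theta>\<close>, and both quotients lie in
  the unit ball. Strictly positive bounds \<open>a\<close>, \<open>b\<close> avoid division by a
  vanishing norm; \<open>Lq_norm_triangle\<close> lets the slack tend to 0.\<close>

lemma Lq_add_aux: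
  assumes f: "f \<in> Lq q" and g: "g \<in> Lq q" and q: "1 \<le> q"
    and a: "Lq_norm q f \<le> a" "0 < a" and b: "Lq_norm q g \<le> b" "0 < b"
  shows "(\<lambda>x. f x + g x) \<in> Lq q" "Lq_norm q (\<lambda>x. f x + g x) \<le> a + b"
proof -
  note [measurable] = Lq_measurable[OF f] Lq_measurable[OF g]
  define \<theta> where "\<theta> = a / (a + b)"
  have \<theta>: "0 < \<theta>" "\<theta> < 1" using a b by (auto simp: \<theta>_def)
  define ca cb where "ca = (a + b) powr q * \<theta> * a powr (- q)" and "cb = (a + b) powr q * (1 - \<theta>) * b powr (- q)"
  have c0: "0 \<le> ca" "0 \<le> cb" using \<theta> by (simp_all add: ca_def cb_def)
  have pt: "\<bar>f x + g x\<bar> powr q \<le> ca * \<bar>f x\<bar> powr q + cb * \<bar>g x\<bar> powr q" for x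
  proof -
    have "\<bar>f x + g x\<bar> \<le> (a + b) * (\<theta> * (\<bar>f x\<bar> / a) + (1 - \<theta>) * (\<bar>g x\<bar> / b))"
    proof -
      have "1 - \<theta> = b / (a + b)" using a b by (simp add: \<theta>_def field_simps)
      then have "(a + b) * (\<theta> * (\<bar>f x\<bar> / a) + (1 - \<theta>) * (\<bar>g x\<bar> / b)) = \<bar>f x\<bar> + \<bar>g x\<bar>"
        using a b by (simp add: \<theta>_def distrib_left)
      then show ?thesis by (simp only: abs_triangle_ineq)
    qed
    then have "\<bar>f x + g x\<bar> powr q \<le> ((a + b) * (\<theta> * (\<bar>f x\<bar> / a) + (1 - \<theta>) * (\<bar>g x\<bar> / b))) powr q"
      using q by (intro powr_mono2) auto
    also have "\<dots> = (a + b) powr q * (\<theta> * (\<bar>f x\<bar> / a) + (1 - \<theta>) * (\<bar>g x\<bar> / b)) powr q"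
      using a b \<theta> by (simp add: powr_mult)
    also have "\<dots> \<le> (a + b) powr q * (\<theta> * (\<bar>f x\<bar> / a) powr q + (1 - \<theta>) * (\<bar>g x\<bar> / b) powr q)"
      using q \<theta> a b by (intro mult_left_mono powr_convex_combination) auto
    also have "\<dots> = ca * \<bar>f x\<bar> powr q + cb * \<bar>g x\<bar> powr q"
      using a b by (simp add: ca_def cb_def powr_divide powr_minus field_simps)
    finally show ?thesis .
  qed
  have "(\<integral>\<^sup>+x. epow (ennreal \<bar>f x + g x\<bar>) q \<partial>lborel)
    \<le> (\<integral>\<^sup>+x. ennreal ca * epow (ennreal \<bar>f x\<bar>) q + ennreal cb * epow (ennreal \<bar>g x\<bar>) q \<partial>lborel)"
    using pt c0
    by (intro nn_integral_mono) (simp add: ennreal_mult[symmetric] ennreal_plus[symmetric] del: ennreal_plus)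
  also have "\<dots> = ennreal ca * ennreal (Lq_norm q f powr q) + ennreal cb * ennreal (Lq_norm q g powr q)"
    using q nn_integral_Lq_norm[OF f] nn_integral_Lq_norm[OF g]
    by (simp add: nn_integral_add nn_integral_cmult)
  also have "\<dots> \<le> ennreal ca * ennreal (a powr q) + ennreal cb * ennreal (b powr q)"
    using a b q by (intro add_mono mult_left_mono ennreal_leI powr_mono2) auto
  also have "\<dots> = ennreal (ca * a powr q + cb * b powr q)"
    using c0 by (simp add: ennreal_mult)
  also have "ca * a powr q + cb * b powr q = (a + b) powr q"
  proof -
    have "ca * a powr q = (a + b) powr q * \<theta>" "cb * b powr q = (a + b) powr q * (1 - \<theta>)"
      using a b by (simp_all add: ca_def cb_def powr_minus)
    then show ?thesis by (simp add: algebra_simps)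
  qed
  finally have *: "(\<integral>\<^sup>+x. epow (ennreal \<bar>f x + g x\<bar>) q \<partial>lborel) \<le> ennreal ((a + b) powr q)" .
  show "(\<lambda>x. f x + g x) \<in> Lq q" "Lq_norm q (\<lambda>x. f x + g x) \<le> a + b"
    by (rule Lq_bound[OF _ _ _ *]; use a b q in simp)+
qed

lemma Lq_add:
  assumes f: "f \<in> Lq q" and g: "g \<in> Lq q" and q: "1 \<le> q"
  shows "(\<lambda>x. f x + g x) \<in> Lq q"
  using Lq_add_aux[OF f g q, of "Lq_norm q f + 1" "Lq_norm q g + 1"] by (simp add: add_nonneg_pos)

lemma Lq_norm_triangle:
  assumes f: "f \<in> Lq q" and g: "g \<in> Lq q" and q: "1 \<le> q"
  shows "Lq_norm q (\<lambda>x. f x + g x) \<le> Lq_norm q f + Lq_norm q g"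
proof (rule field_le_epsilon)
  fix e :: real assume "0 < e"
  then show "Lq_norm q (\<lambda>x. f x + g x) \<le> Lq_norm q f + Lq_norm q g + e"
    using Lq_add_aux(2)[OF f g q, of "Lq_norm q f + e / 2" "Lq_norm q g + e / 2"]
    by (simp add: add_nonneg_pos)
qed

lemma Lq_diff:
  assumes f: "f \<in> Lq q" and g: "g \<in> Lq q" and q: "1 \<le> q"
  shows "(\<lambda>x. f x - g x) \<in> Lq q"
  using Lq_add[OF f Lq_uminus[OF g] q] by simp

lemma Lq_norm_diff_triangle:
  assumes f: "f \<in> Lq q" and g: "g \<in> Lq q" and h: "h \<in> Lq q" and q: "1 \<le> q"
  shows "Lq_norm q (\<lambda>x. f x - h x) \<le> Lq_norm q (\<lambda>x. f x - g x) + Lq_norm q (\<lambda>x. g x - h x)"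
  using Lq_norm_triangle[OF Lq_diff[OF f g q] Lq_diff[OF g h q] q] by simp

lemma Lq_norm_diff_le:
  assumes f: "f \<in> Lq q" and g: "g \<in> Lq q" and q: "1 \<le> q"
  shows "\<bar>Lq_norm q f - Lq_norm q g\<bar> \<le> Lq_norm q (\<lambda>x. f x - g x)"
  using Lq_norm_triangle[OF Lq_diff[OF f g q] g q] Lq_norm_triangle[OF Lq_diff[OF g f q] f q]
    Lq_norm_minus_commute[of q f g]
  by simp

lemma measurable_Lq_norm:
  assumes U: "case_prod U \<in> borel_measurable (borel \<Otimes>\<^sub>M borel)"
  shows "(\<lambda>t. Lq_norm q (U t :: real ^ 'n \<Rightarrow> real)) \<in> borel_measurable borel"
proof -
  note [measurable (raw)] = measurable_uncurry[OF U]
  show ?thesis unfolding Lq_norm_def by measurable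
qed

section \<open>Contraction with respect to the majorant\<close>

text \<open>A mean value inequality: it is \<open>powr_tangent\<close> with the tangent taken at the
  larger of the two points.\<close>

lemma powr_diff_le:
  fixes x y p :: real
  assumes "1 \<le> p" "0 \<le> x" "0 \<le> y"
  shows "\<bar>x powr p - y powr p\<bar> \<le> p * max x y powr (p - 1) * \<bar>x - y\<bar>"
proof -
  have *: "a powr p - b powr p \<le> p * a powr (p - 1) * (a - b)" if "0 \<le> b" "b \<le> a" for a b :: real
  proof (cases "a = 0")
    case False
    with that have "0 < a" by simp
    moreover have "a powr (p - 1) * a = a powr p" using \<open>0 < a\<close> by (simp add: powr_diff)
    ultimately show ?thesis
      using powr_tangent[OF assms(1) that(1), of a] by (simp add: algebra_simps)
  qed (use that in simp)
  show ?thesis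
  proof (cases "x \<le> y")
    case True
    then have "x powr p \<le> y powr p" using assms by (intro powr_mono2) auto
    with *[of x y] True assms show ?thesis by (simp add: max_def)
  next
    case False
    then have "y powr p \<le> x powr p" using assms by (intro powr_mono2) auto
    with *[of y x] False assms show ?thesis by (simp add: max_def)
  qed
qed

lemma ennreal_abs_enn2real_diff_le:
  assumes "x \<le> y + e" "y \<le> x + e" "x < top" "y < top"
  shows "ennreal \<bar>enn2real x - enn2real y\<bar> \<le> e"
  using assms
proof (cases x; cases y; cases e)
  fix r s d assume "x = ennreal r" "y = ennreal s" "e = ennreal d" "0 \<le> r" "0 \<le> s" "0 \<le> d"
  with assms show ?thesis by (auto simp: ennreal_plus[symmetric] simp del: ennreal_plus)
qed auto

lemma ennreal_le_add_of_diff: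
  "ennreal \<bar>a - b\<bar> \<le> e \<Longrightarrow> ennreal a \<le> ennreal b + e"
  by (cases e; cases "0 \<le> b"; cases "0 \<le> a")
     (auto simp: ennreal_plus[symmetric] ennreal_neg simp del: ennreal_plus)

locale duhamel_contraction =
  fixes B :: "real \<Rightarrow> real ^ 'n \<Rightarrow> ennreal" and p T A \<Lambda> \<epsilon> :: real
    and \<theta> :: "real \<Rightarrow> (real ^ 'n \<Rightarrow> real) \<Rightarrow> real" and h :: "real \<Rightarrow> real ^ 'n \<Rightarrow> real"
  assumes B: "case_prod B \<in> borel_measurable (borel \<Otimes>\<^sub>M borel)"
    and h: "case_prod h \<in> borel_measurable (borel \<Otimes>\<^sub>M borel)"
    and p: "1 < p" and A: "0 < A" and \<Lambda>: "0 \<le> \<Lambda>" and \<epsilon>: "0 \<le> \<epsilon>"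
    and h_le: "\<And>t x. 0 \<le> t \<Longrightarrow> t \<le> T \<Longrightarrow> ennreal \<bar>h t x\<bar> \<le> B t x"
    and duhamel_B: "\<And>t x. 0 \<le> t \<Longrightarrow> t \<le> T \<Longrightarrow> duhamel 0 t (\<lambda>\<tau> y. epow (B \<tau> y) p) x \<le> ennreal \<epsilon> * B t x"
    and \<theta>_meas: "\<And>U. case_prod U \<in> borel_measurable (borel \<Otimes>\<^sub>M borel) \<Longrightarrow> (\<lambda>\<tau>. \<theta> \<tau> (U \<tau>)) \<in> borel_measurable borel"
    and \<theta>_nonneg: "\<And>\<tau> V. 0 \<le> \<theta> \<tau> V"
    and \<theta>_le: "\<And>\<tau> V. 0 \<le> \<tau> \<Longrightarrow> \<tau> \<le> T \<Longrightarrow> V \<in> borel_measurable borel \<Longrightarrow> (\<And>y. ennreal \<bar>V y\<bar> \<le> 2 * B \<tau> y) \<Longrightarrow> \<theta> \<tau> V \<le> A"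
    and \<theta>_lip: "\<And>\<tau> U V D. 0 \<le> \<tau> \<Longrightarrow> \<tau> \<le> T \<Longrightarrow> U \<in> borel_measurable borel \<Longrightarrow> V \<in> borel_measurable borel \<Longrightarrow>
        (\<And>y. ennreal \<bar>U y\<bar> \<le> 2 * B \<tau> y) \<Longrightarrow> (\<And>y. ennreal \<bar>V y\<bar> \<le> 2 * B \<tau> y) \<Longrightarrow>
        0 \<le> D \<Longrightarrow> (\<And>y. ennreal \<bar>U y - V y\<bar> \<le> ennreal D * B \<tau> y) \<Longrightarrow> \<bar>\<theta> \<tau> U - \<theta> \<tau> V\<bar> \<le> \<Lambda> * D"
    and small: "\<epsilon> * (A * 2 powr p) \<le> 1" "\<epsilon> * (\<Lambda> * 2 powr p + A * p * 2 powr p) \<le> 1 / 2"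
begin

definition force :: "(real \<Rightarrow> real ^ 'n \<Rightarrow> real) \<Rightarrow> real \<Rightarrow> real ^ 'n \<Rightarrow> ennreal" where
  "force U \<tau> y = ennreal (\<theta> \<tau> (U \<tau>) * \<bar>U \<tau> y\<bar> powr p)"

text \<open>Where the Duhamel integral is infinite, \<open>enn2real\<close> puts 0. For admissible
  \<open>U\<close> and times in [0, T] this occurs only where \<open>B\<close> is infinite, by
  \<open>duhamel_force_le\<close>; hence fixed point equations are claimed only at points with
  \<open>B t x < top\<close>.\<close>

definition mild_map :: "(real \<Rightarrow> real ^ 'n \<Rightarrow> real) \<Rightarrow> real \<Rightarrow> real ^ 'n \<Rightarrow> real" where
  "mild_map U t x = h t x + enn2real (duhamel 0 t (force U) x)"

definition admissible :: "(real \<Rightarrow> real ^ 'n \<Rightarrow> real) \<Rightarrow> bool" where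
  "admissible U \<longleftrightarrow> case_prod U \<in> borel_measurable (borel \<Otimes>\<^sub>M borel) \<and>
     (\<forall>t x. 0 \<le> t \<longrightarrow> t \<le> T \<longrightarrow> ennreal \<bar>U t x\<bar> \<le> 2 * B t x)"

lemma admissible_measurable: "admissible U \<Longrightarrow> case_prod U \<in> borel_measurable (borel \<Otimes>\<^sub>M borel)"
  and admissible_le: "admissible U \<Longrightarrow> 0 \<le> t \<Longrightarrow> t \<le> T \<Longrightarrow> ennreal \<bar>U t x\<bar> \<le> 2 * B t x"
  by (auto simp: admissible_def)

lemma measurable_epow_B: "case_prod (\<lambda>\<tau> y. epow (B \<tau> y) p) \<in> borel_measurable (borel \<Otimes>\<^sub>M borel)"
proof -
  note [measurable (raw)] = measurable_uncurry[OF B]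
  show ?thesis by measurable
qed

lemma measurable_force:
  assumes "case_prod U \<in> borel_measurable (borel \<Otimes>\<^sub>M borel)"
  shows "case_prod (force U) \<in> borel_measurable (borel \<Otimes>\<^sub>M borel)"
proof -
  note [measurable (raw)] = measurable_uncurry[OF assms]
  note [measurable] = measurable_compose[OF measurable_fst \<theta>_meas[OF assms]]
  have "(\<lambda>z. force U (fst z) (snd z)) \<in> borel_measurable (borel \<Otimes>\<^sub>M borel)"
    unfolding force_def by measurable
  then show ?thesis by (simp add: split_beta')
qed

lemma force_le:
  assumes U: "admissible U" and \<tau>: "0 \<le> \<tau>" "\<tau> \<le> T"
  shows "force U \<tau> y \<le> ennreal (A * 2 powr p) * epow (B \<tau> y) p"
proof -
  have "\<theta> \<tau> (U \<tau>) \<le> A"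
    using U \<tau> by (intro \<theta>_le measurable_slice) (auto simp: admissible_def)
  then have "force U \<tau> y \<le> ennreal (A * \<bar>U \<tau> y\<bar> powr p)"
    unfolding force_def by (intro ennreal_leI mult_right_mono) auto
  also have "\<dots> = ennreal A * epow (ennreal \<bar>U \<tau> y\<bar>) p"
    using A by (simp add: ennreal_mult)
  also have "\<dots> \<le> ennreal A * epow (2 * B \<tau> y) p"
    using p by (intro mult_left_mono epow_mono admissible_le U \<tau>) auto
  also have "\<dots> = ennreal (A * 2 powr p) * epow (B \<tau> y) p"
    using A epow_ennreal[of 2 p] by (simp add: epow_mult ennreal_mult mult.assoc)
  finally show ?thesis .
qed

text \<open>\<open>h\<close> already uses up one of the two copies of \<open>B\<close> that define
  the ball; the first smallness condition confines the nonlinear part to the other.\<close>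

lemma duhamel_force_le:
  assumes U: "admissible U" and t: "0 \<le> t" "t \<le> T"
  shows "duhamel 0 t (force U) x \<le> B t x"
proof -
  have "duhamel 0 t (force U) x \<le> duhamel 0 t (\<lambda>\<tau> y. ennreal (A * 2 powr p) * epow (B \<tau> y) p) x"
    using t by (intro duhamel_mono force_le U) auto
  also have "\<dots> = ennreal (A * 2 powr p) * duhamel 0 t (\<lambda>\<tau> y. epow (B \<tau> y) p) x"
    by (rule duhamel_cmult[OF measurable_epow_B])
  also have "\<dots> \<le> ennreal (A * 2 powr p) * (ennreal \<epsilon> * B t x)"
    using t by (intro mult_left_mono duhamel_B) auto
  also have "\<dots> = ennreal (\<epsilon> * (A * 2 powr p)) * B t x"
    using A \<epsilon> by (simp add: ennreal_mult mult_ac)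
  also have "\<dots> \<le> 1 * B t x"
    using small(1) by (intro mult_right_mono) (auto simp: ennreal_le_1)
  finally show ?thesis by simp
qed

lemma admissible_mild_map:
  assumes U: "admissible U"
  shows "admissible (mild_map U)"
proof -
  note [measurable (raw)] = measurable_uncurry[OF h] measurable_duhamel[OF measurable_force[OF admissible_measurable[OF U]]]
  have "(\<lambda>z. mild_map U (fst z) (snd z)) \<in> borel_measurable (borel \<Otimes>\<^sub>M borel)"
    unfolding mild_map_def by measurable
  moreover have "ennreal \<bar>mild_map U t x\<bar> \<le> 2 * B t x" if t: "0 \<le> t" "t \<le> T" for t x
  proof -
    have "ennreal (enn2real (duhamel 0 t (force U) x)) \<le> B t x"
      using duhamel_force_le[OF U t, of x] by (cases "duhamel 0 t (force U) x") auto
    then have "ennreal (\<bar>h t x\<bar> + enn2real (duhamel 0 t (force U) x)) \<le> B t x + B t x"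
      using h_le[OF t, of x] by (simp add: add_mono)
    moreover have "ennreal \<bar>mild_map U t x\<bar> \<le> ennreal (\<bar>h t x\<bar> + enn2real (duhamel 0 t (force U) x))"
      unfolding mild_map_def by (intro ennreal_leI) (simp add: abs_triangle_ineq[THEN order_trans])
    ultimately show ?thesis by (simp add: mult_2)
  qed
  ultimately show ?thesis by (simp add: admissible_def split_beta')
qed

lemma force_diff:
  assumes U: "admissible U" and V: "admissible V" and \<tau>: "0 \<le> \<tau>" "\<tau> \<le> T" and D: "0 < D"
    and UV: "\<And>y. ennreal \<bar>U \<tau> y - V \<tau> y\<bar> \<le> ennreal D * B \<tau> y"
  shows "force U \<tau> y \<le> force V \<tau> y + ennreal (D * (\<Lambda> * 2 powr p + A * p * 2 powr p)) * epow (B \<tau> y) p"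
proof (cases "B \<tau> y")
  \<comment> \<open>Where \<open>B\<close> is infinite the right side has to be \<open>top\<close>,
    which takes a strictly positive constant in front; hence \<open>D > 0\<close> in this
    lemma.\<close>
  case top
  have "0 < A * p * 2 powr p" using A p by simp
  then have "0 < D * (\<Lambda> * 2 powr p + A * p * 2 powr p)"
    using D \<Lambda> A p by (intro mult_pos_pos add_nonneg_pos mult_nonneg_nonneg) auto
  moreover have "ennreal c * top = top" if "0 < c" for c
    using that by (simp add: ennreal_mult_top)
  ultimately have "ennreal (D * (\<Lambda> * 2 powr p + A * p * 2 powr p)) * epow (B \<tau> y) p = top"
    by (simp only: top epow_top)
  then show ?thesis by simp
next
  case (real \<beta>)
  define u v where "u = \<bar>U \<tau> y\<bar>" and "v = \<bar>V \<tau> y\<bar>"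
  have uv: "0 \<le> u" "0 \<le> v" "u \<le> 2 * \<beta>" "v \<le> 2 * \<beta>"
    using admissible_le[OF U \<tau>, of y] admissible_le[OF V \<tau>, of y] real
    by (auto simp: u_def v_def ennreal_mult[symmetric] simp flip: ennreal_numeral)
  have d: "\<bar>u - v\<bar> \<le> D * \<beta>"
    using UV[of y] real D by (auto simp: u_def v_def ennreal_mult[symmetric])
  have \<theta>: "\<bar>\<theta> \<tau> (U \<tau>) - \<theta> \<tau> (V \<tau>)\<bar> \<le> \<Lambda> * D" "\<theta> \<tau> (V \<tau>) \<le> A"
    using U V \<tau> D UV by (auto intro!: \<theta>_lip \<theta>_le measurable_slice simp: admissible_def)
  have up: "u powr p \<le> 2 powr p * \<beta> powr p"
    using uv p real powr_mono2[of p u "2 * \<beta>"] by (simp add: powr_mult)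
  have dp: "u powr p - v powr p \<le> p * 2 powr p * D * \<beta> powr p"
  proof -
    have "u powr p - v powr p \<le> p * max u v powr (p - 1) * \<bar>u - v\<bar>"
      using powr_diff_le[of p u v] p uv by auto
    also have "\<dots> \<le> p * (2 * \<beta>) powr (p - 1) * (D * \<beta>)"
      using p uv d by (intro mult_mono mult_left_mono powr_mono2) auto
    also have "\<dots> = p * 2 powr (p - 1) * D * (\<beta> powr (p - 1) * \<beta>)"
      using real by (simp add: powr_mult)
    also have "\<beta> powr (p - 1) * \<beta> = \<beta> powr p"
      using real(1) by (cases "\<beta> = 0") (simp_all add: powr_diff)
    also have "p * 2 powr (p - 1) * D * \<beta> powr p \<le> p * 2 powr p * D * \<beta> powr p"
      using p D by (intro mult_right_mono mult_left_mono powr_mono) auto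
    finally show ?thesis .
  qed
  \<comment> \<open>The variation of the coefficient is separated from that of the power: the first
    brings in \<open>\<Lambda>\<close>, the second \<open>A * p\<close>.\<close>
  have "\<theta> \<tau> (U \<tau>) * u powr p = (\<theta> \<tau> (U \<tau>) - \<theta> \<tau> (V \<tau>)) * u powr p
      + \<theta> \<tau> (V \<tau>) * (u powr p - v powr p) + \<theta> \<tau> (V \<tau>) * v powr p"
    by (simp add: algebra_simps)
  also have "\<dots> \<le> (\<Lambda> * D) * (2 powr p * \<beta> powr p) + A * (p * 2 powr p * D * \<beta> powr p) + \<theta> \<tau> (V \<tau>) * v powr p"
  proof (intro add_mono order_refl)
    show "(\<theta> \<tau> (U \<tau>) - \<theta> \<tau> (V \<tau>)) * u powr p \<le> (\<Lambda> * D) * (2 powr p * \<beta> powr p)"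
      using \<theta> up \<Lambda> D by (intro mult_mono) auto
    have "\<theta> \<tau> (V \<tau>) * (u powr p - v powr p) \<le> \<theta> \<tau> (V \<tau>) * (p * 2 powr p * D * \<beta> powr p)"
      using dp \<theta>_nonneg by (intro mult_left_mono) auto
    also have "\<dots> \<le> A * (p * 2 powr p * D * \<beta> powr p)"
      using \<theta>(2) p D by (intro mult_right_mono) auto
    finally show "\<theta> \<tau> (V \<tau>) * (u powr p - v powr p) \<le> A * (p * 2 powr p * D * \<beta> powr p)" .
  qed
  also have "\<dots> = \<theta> \<tau> (V \<tau>) * v powr p + (D * (\<Lambda> * 2 powr p + A * p * 2 powr p)) * \<beta> powr p"
    by (simp add: algebra_simps)
  finally have "ennreal (\<theta> \<tau> (U \<tau>) * u powr p)
    \<le> ennreal (\<theta> \<tau> (V \<tau>) * v powr p + (D * (\<Lambda> * 2 powr p + A * p * 2 powr p)) * \<beta> powr p)"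
    by (rule ennreal_leI)
  then show ?thesis
    using real D \<Lambda> A p \<theta>_nonneg by (simp add: force_def u_def v_def ennreal_mult)
qed

lemma contraction:
  assumes U: "admissible U" and V: "admissible V" and t: "0 \<le> t" "t \<le> T" and D: "0 < D"
    and UV: "\<And>\<tau> y. 0 \<le> \<tau> \<Longrightarrow> \<tau> \<le> T \<Longrightarrow> ennreal \<bar>U \<tau> y - V \<tau> y\<bar> \<le> ennreal D * B \<tau> y"
  shows "ennreal \<bar>mild_map U t x - mild_map V t x\<bar> \<le> ennreal (D / 2) * B t x"
proof (cases "B t x = top")
  case True
  then show ?thesis using D by (simp add: ennreal_mult_top)
next
  case False
  define L where "L = \<Lambda> * 2 powr p + A * p * 2 powr p"
  have L: "0 \<le> L" using \<Lambda> A p by (simp add: L_def)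
  have half: "ennreal (D * L) * duhamel 0 t (\<lambda>\<tau> y. epow (B \<tau> y) p) x \<le> ennreal (D / 2) * B t x"
  proof -
    have "ennreal (D * L) * duhamel 0 t (\<lambda>\<tau> y. epow (B \<tau> y) p) x \<le> ennreal (D * L) * (ennreal \<epsilon> * B t x)"
      by (intro mult_left_mono duhamel_B t) auto
    also have "\<dots> = ennreal (D * (\<epsilon> * L)) * B t x"
      using D L \<epsilon> by (simp add: ennreal_mult mult_ac)
    also have "\<dots> \<le> ennreal (D * (1 / 2)) * B t x"
      using small(2) D by (intro mult_right_mono ennreal_leI mult_left_mono) (auto simp: L_def)
    finally show ?thesis by simp
  qed
  have *: "duhamel 0 t (force U) x \<le> duhamel 0 t (force V) x + ennreal (D / 2) * B t x"
    if U: "admissible U" and V: "admissible V" and UV: "\<And>\<tau> y. 0 \<le> \<tau> \<Longrightarrow> \<tau> \<le> T \<Longrightarrow> ennreal \<bar>U \<tau> y - V \<tau> y\<bar> \<le> ennreal D * B \<tau> y" for U V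
  proof -
    note [measurable (raw)] = measurable_uncurry[OF measurable_epow_B]
    have "duhamel 0 t (force U) x \<le> duhamel 0 t (\<lambda>\<tau> y. force V \<tau> y + ennreal (D * L) * epow (B \<tau> y) p) x"
      using t D unfolding L_def by (intro duhamel_mono force_diff U V UV) auto
    also have "\<dots> = duhamel 0 t (force V) x + ennreal (D * L) * duhamel 0 t (\<lambda>\<tau> y. epow (B \<tau> y) p) x"
      by (subst duhamel_add)
         (auto intro!: measurable_force admissible_measurable V duhamel_cmult measurable_epow_B)
    finally show ?thesis using half by (meson add_left_mono order_trans)
  qed
  have "ennreal \<bar>enn2real (duhamel 0 t (force U) x) - enn2real (duhamel 0 t (force V) x)\<bar> \<le> ennreal (D / 2) * B t x"
  proof (rule ennreal_abs_enn2real_diff_le)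
    show "duhamel 0 t (force U) x \<le> duhamel 0 t (force V) x + ennreal (D / 2) * B t x"
      by (rule *[OF U V UV])
    show "duhamel 0 t (force V) x \<le> duhamel 0 t (force U) x + ennreal (D / 2) * B t x"
      by (rule *[OF V U]) (use UV in \<open>simp add: abs_minus_commute\<close>)
    show "duhamel 0 t (force U) x < top" "duhamel 0 t (force V) x < top"
      using False duhamel_force_le[OF U t, of x] duhamel_force_le[OF V t, of x]
      by (auto simp: top.not_eq_extremum intro: le_less_trans)
  qed
  then show ?thesis by (simp add: mild_map_def)
qed

text \<open>Two elements of the ball differ by at most \<open>4 B\<close>, and inserting both
  equations halves any such bound; iterating leaves 0 wherever \<open>B\<close> is finite.\<close>

lemma fixed_points_eq:
  assumes U: "admissible U" and V: "admissible V"
    and fixU: "\<And>t x. 0 \<le> t \<Longrightarrow> t \<le> T \<Longrightarrow> B t x < top \<Longrightarrow> U t x = mild_map U t x"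
    and fixV: "\<And>t x. 0 \<le> t \<Longrightarrow> t \<le> T \<Longrightarrow> B t x < top \<Longrightarrow> V t x = mild_map V t x"
    and t: "0 \<le> t" "t \<le> T" and fin: "B t x < top"
  shows "U t x = V t x"
proof -
  have le: "ennreal \<bar>U t x - V t x\<bar> \<le> ennreal (4 * (1 / 2) ^ n) * B t x" if "0 \<le> t" "t \<le> T" for n t x
    using that
  proof (induction n arbitrary: t x)
    case 0
    have "ennreal \<bar>U t x - V t x\<bar> \<le> ennreal (\<bar>U t x\<bar> + \<bar>V t x\<bar>)"
      by (intro ennreal_leI) simp
    also have "\<dots> \<le> 2 * B t x + 2 * B t x"
      using admissible_le[OF U 0, of x] admissible_le[OF V 0, of x] by (simp add: add_mono)
    finally show ?case by (simp add: distrib_right[symmetric])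
  next
    case (Suc n)
    show ?case
    proof (cases "B t x = top")
      case False
      then have "B t x < top" by (simp add: top.not_eq_extremum)
      then show ?thesis
        using contraction[OF U V Suc.prems, of "4 * (1 / 2) ^ n" x] Suc.IH fixU fixV Suc.prems by simp
    qed (simp add: ennreal_mult_top)
  qed
  obtain \<beta> where \<beta>: "B t x = ennreal \<beta>" "0 \<le> \<beta>" using fin by (cases "B t x") auto
  have "\<bar>U t x - V t x\<bar> \<le> (4 * (1 / 2) ^ n) * \<beta>" for n
    using le[OF t, of x n] \<beta> by (simp add: ennreal_mult[symmetric])
  moreover have "(\<lambda>n. (4 * (1 / 2) ^ n) * \<beta>) \<longlonglongrightarrow> (4 * 0) * \<beta>"
    by (intro tendsto_intros LIMSEQ_realpow_zero) auto
  ultimately have "\<bar>U t x - V t x\<bar> \<le> 0"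
    by (intro LIMSEQ_le_const[where X = "\<lambda>n. (4 * (1 / 2) ^ n) * \<beta>"]) auto
  then show ?thesis by simp
qed

text \<open>Banach's fixed point theorem run point by point. The increments of the Picard iterates
  starting from 0 are dominated by \<open>2 (1/2)^n B\<close>, so the telescoping series converges
  wherever \<open>B\<close> is finite, and no complete function space has to be set up. Elsewhere
  the value 0 keeps the limit admissible.\<close>

lemma fixed_point_exists:
  obtains U where "admissible U"
    and "\<And>t x. 0 \<le> t \<Longrightarrow> t \<le> T \<Longrightarrow> B t x < top \<Longrightarrow> U t x = mild_map U t x"
proof -
  define W where "W n = (mild_map ^^ n) (\<lambda>_ _. 0)" for n
  have W0: "W 0 = (\<lambda>_ _. 0)" and WS: "W (Suc n) = mild_map (W n)" for n
    by (simp_all add: W_def)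
  have adm: "admissible (W n)" for n
  proof (induction n)
    case 0
    then show ?case by (simp add: W0 admissible_def)
  qed (simp add: WS admissible_mild_map)
  have step: "ennreal \<bar>W (Suc n) t x - W n t x\<bar> \<le> ennreal (2 * (1 / 2) ^ n) * B t x" if "0 \<le> t" "t \<le> T" for n t x
    using that
  proof (induction n arbitrary: t x)
    case 0
    then show ?case using admissible_le[OF adm[of 1] 0, of x] by (simp add: W0)
  next
    case (Suc n)
    then show ?case
      using contraction[OF adm[of "Suc n"] adm[of n] Suc.prems, of "2 * (1 / 2) ^ n" x] by (simp add: WS)
  qed
  define d where "d n t x = W (Suc n) t x - W n t x" for n t x
  have Wsum: "W n t x = (\<Sum>k<n. d k t x)" for n t x
    using sum_lessThan_telescope[of "\<lambda>k. W k t x" n] by (simp add: d_def W0)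
  define U where "U t x = (if 0 \<le> t \<and> t \<le> T \<and> B t x < top then \<Sum>k. d k t x else 0)" for t x
  have tail: "\<bar>U t x - W n t x\<bar> \<le> 4 * (1 / 2) ^ n * \<beta>"
    if t: "0 \<le> t" "t \<le> T" and \<beta>: "B t x = ennreal \<beta>" "0 \<le> \<beta>" for t x \<beta> n
  proof -
    have dle: "\<bar>d k t x\<bar> \<le> 2 * \<beta> * (1 / 2) ^ k" for k
      using step[OF t, of k x] \<beta> by (simp add: d_def ennreal_mult[symmetric] mult_ac)
    have geo: "(\<lambda>k. 2 * \<beta> * (1 / 2) ^ (k + n)) sums (4 * (1 / 2) ^ n * \<beta>)"
      using sums_mult[OF geometric_sums[of "1 / 2 :: real"], of "2 * \<beta> * (1 / 2) ^ n"]
      by (simp add: power_add mult_ac)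
    have sa: "summable (\<lambda>k. \<bar>d k t x\<bar>)"
      by (rule summable_comparison_test'[where g = "\<lambda>k. 2 * \<beta> * (1 / 2) ^ k" and N = 0])
         (use dle in \<open>auto intro!: summable_mult summable_geometric\<close>)
    then have sd: "summable (\<lambda>k. d k t x)" by (rule summable_rabs_cancel)
    have "U t x = (\<Sum>k. d k t x)" using t \<beta> by (simp add: U_def)
    also have "\<dots> = (\<Sum>k. d (k + n) t x) + W n t x"
      using suminf_split_initial_segment[OF sd, of n] by (simp add: Wsum)
    finally have "\<bar>U t x - W n t x\<bar> = \<bar>\<Sum>k. d (k + n) t x\<bar>" by simp
    also have "\<dots> \<le> (\<Sum>k. \<bar>d (k + n) t x\<bar>)"
      using summable_ignore_initial_segment[OF sa, of n] by (rule summable_rabs)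
    also have "\<dots> \<le> (\<Sum>k. 2 * \<beta> * (1 / 2) ^ (k + n))"
      using summable_ignore_initial_segment[OF sa, of n] geo dle
      by (intro suminf_le) (auto simp: sums_iff)
    also have "\<dots> = 4 * (1 / 2) ^ n * \<beta>" using geo by (simp add: sums_iff)
    finally show ?thesis .
  qed
  have lim: "(\<lambda>n. 4 * (1 / 2) ^ n * \<beta>) \<longlonglongrightarrow> 0" for \<beta> :: real
  proof -
    have "(\<lambda>n. 4 * (1 / 2) ^ n * \<beta>) \<longlonglongrightarrow> 4 * 0 * \<beta>"
      by (intro tendsto_intros LIMSEQ_realpow_zero) auto
    then show ?thesis by simp
  qed
  have tail': "ennreal \<bar>U t x - W n t x\<bar> \<le> ennreal (4 * (1 / 2) ^ n) * B t x" if t: "0 \<le> t" "t \<le> T" for t x n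
    using tail[OF t, of x _ n] by (cases "B t x") (auto simp: ennreal_mult[symmetric] ennreal_mult_top)
  have admU: "admissible U"
  proof -
    have [measurable (raw)]: "(\<lambda>z. d n (f z) (g z)) \<in> borel_measurable M"
      if "f \<in> borel_measurable M" "g \<in> borel_measurable M" for f g n and M :: "'c measure"
      unfolding d_def
      by (intro borel_measurable_diff measurable_uncurry[OF admissible_measurable[OF adm]] that)
    note [measurable (raw)] = measurable_uncurry[OF B]
    have "(\<lambda>z. U (fst z) (snd z)) \<in> borel_measurable (borel \<Otimes>\<^sub>M borel)"
      unfolding U_def by measurable
    moreover have "ennreal \<bar>U t x\<bar> \<le> 2 * B t x" if t: "0 \<le> t" "t \<le> T" for t x
    proof (cases "B t x")
      case (real \<beta>)
      have "\<bar>U t x\<bar> \<le> 2 * \<beta> + 4 * (1 / 2) ^ n * \<beta>" for n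
      proof -
        have "\<bar>W n t x\<bar> \<le> 2 * \<beta>"
          using admissible_le[OF adm t, of n x] real by (simp add: ennreal_mult[symmetric] flip: ennreal_numeral)
        then show ?thesis using tail[OF t real(2,1), of n] by linarith
      qed
      moreover have "(\<lambda>n. 2 * \<beta> + 4 * (1 / 2) ^ n * \<beta>) \<longlonglongrightarrow> 2 * \<beta> + 0"
        by (intro tendsto_intros lim)
      ultimately have "\<bar>U t x\<bar> \<le> 2 * \<beta>"
        by (intro LIMSEQ_le_const[where X = "\<lambda>n. 2 * \<beta> + 4 * (1 / 2) ^ n * \<beta>"]) auto
      then have "ennreal \<bar>U t x\<bar> \<le> ennreal (2 * \<beta>)" by (rule ennreal_leI)
      then show ?thesis using real by (simp add: ennreal_mult)
    qed (simp add: ennreal_mult_top)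
    ultimately show ?thesis by (simp add: admissible_def split_beta')
  qed
  show thesis
  proof (rule that[OF admU])
    fix t x assume t: "0 \<le> t" "t \<le> T" and fin: "B t x < top"
    then obtain \<beta> where \<beta>: "B t x = ennreal \<beta>" "0 \<le> \<beta>" by (cases "B t x") auto
    \<comment> \<open>Both \<open>U\<close> and \<open>mild_map U\<close> are compared with
      \<open>W (Suc n) = mild_map (W n)\<close>, each at distance at most
      \<open>2 (1/2)^n \<beta>\<close>.\<close>
    have "\<bar>U t x - mild_map U t x\<bar> \<le> 4 * (1 / 2) ^ n * \<beta>" for n
    proof -
      have "ennreal \<bar>mild_map U t x - mild_map (W n) t x\<bar> \<le> ennreal (4 * (1 / 2) ^ n / 2) * B t x"
        by (intro contraction admU adm t tail') auto
      then have "\<bar>mild_map U t x - W (Suc n) t x\<bar> \<le> 2 * (1 / 2) ^ n * \<beta>"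
        using \<beta> by (simp add: WS ennreal_mult[symmetric] mult_ac)
      moreover have "\<bar>U t x - W (Suc n) t x\<bar> \<le> 2 * (1 / 2) ^ n * \<beta>"
        using tail[OF t \<beta>, of "Suc n"] by simp
      ultimately show ?thesis by simp
    qed
    with lim[of \<beta>] have "\<bar>U t x - mild_map U t x\<bar> \<le> 0"
      by (intro LIMSEQ_le_const[where X = "\<lambda>n. 4 * (1 / 2) ^ n * \<beta>"]) auto
    then show "U t x = mild_map U t x" by simp
  qed
qed

end

section \<open>Strong continuity of the heat semigroup\<close>

lemma nn_heat_Lq_finite:
  fixes f :: "real ^ 'n \<Rightarrow> real"
  assumes f: "f \<in> Lq q" and q: "1 \<le> q" and t: "0 < t"
  shows "nn_heat t (\<lambda>y. ennreal \<bar>f y\<bar>) x < top"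
proof -
  note [measurable] = Lq_measurable[OF f]
  have "epow (nn_heat t (\<lambda>y. ennreal \<bar>f y\<bar>) x) q \<le> nn_heat t (\<lambda>y. epow (ennreal \<bar>f y\<bar>) q) x"
    using q by (intro nn_heat_jensen) measurable
  also have "\<dots> \<le> ennreal ((4 * pi * t) powr (- real CARD('n) / 2)) * (\<integral>\<^sup>+y. epow (ennreal \<bar>f y\<bar>) q \<partial>lborel)"
    using t by (intro nn_heat_smoothing) measurable
  also have "\<dots> < top"
    using nn_integral_Lq[OF f] by (simp add: ennreal_mult_less_top del: epow_ennreal)
  finally show ?thesis by simp
qed

lemma heat_semigroup_defined_Lq:
  "f \<in> Lq q \<Longrightarrow> 1 \<le> q \<Longrightarrow> 0 \<le> t \<Longrightarrow> heat_semigroup_defined t f x"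
  using heat_semigroup_defined_iff[of f t x] nn_heat_Lq_finite[of f q t x]
  by (cases "t = 0") (auto simp: heat_semigroup_defined_def dest: Lq_measurable)

lemma measurable_heat_semigroup:
  assumes [measurable]: "f \<in> borel_measurable borel"
  shows "heat_semigroup t f \<in> borel_measurable borel"
proof (cases "t = 0")
  case True
  then show ?thesis by (simp add: heat_semigroup_def[abs_def])
next
  case False
  then show ?thesis by (simp add: heat_semigroup_def[abs_def])
qed

lemma heat_semigroup_0 [simp]: "heat_semigroup 0 f = f"
  by (simp add: heat_semigroup_def fun_eq_iff)

lemma heat_semigroup_abs_le:
  assumes [measurable]: "f \<in> borel_measurable borel" and "0 \<le> t"
  shows "ennreal \<bar>heat_semigroup t f x\<bar> \<le> nn_heat t (\<lambda>y. ennreal \<bar>f y\<bar>) x"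
proof (cases "t = 0")
  case False
  show ?thesis
  proof (cases "integrable lborel (\<lambda>y. heat_kernel t (x - y) * f y)")
    case True
    from integral_norm_bound_ennreal[OF True] False assms(2) show ?thesis
      by (simp add: heat_semigroup_def nn_heat_def abs_mult ennreal_mult)
  next
    case F: False
    with False show ?thesis by (simp add: heat_semigroup_def not_integrable_integral_eq)
  qed
qed simp

lemma heat_semigroup_Lq:
  assumes f: "f \<in> Lq q" and q: "1 \<le> q" and t: "0 \<le> t"
  shows "heat_semigroup t f \<in> Lq q" and "Lq_norm q (heat_semigroup t f) \<le> Lq_norm q f"
proof -
  note [measurable] = Lq_measurable[OF f] measurable_heat_semigroup[OF Lq_measurable[OF f]]
  have "(\<integral>\<^sup>+x. epow (nn_heat t (\<lambda>y. ennreal \<bar>f y\<bar>) x) q \<partial>lborel) \<le> (\<integral>\<^sup>+x. epow (ennreal \<bar>f x\<bar>) q \<partial>lborel)"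
    using q by (intro nn_heat_contraction) measurable
  also have "\<dots> = ennreal (Lq_norm q f powr q)"
    using f q by (intro nn_integral_Lq_norm) auto
  finally have *: "(\<integral>\<^sup>+x. epow (nn_heat t (\<lambda>y. ennreal \<bar>f y\<bar>) x) q \<partial>lborel) \<le> ennreal (Lq_norm q f powr q)" .
  have AE: "AE x in lborel. ennreal \<bar>heat_semigroup t f x\<bar> \<le> ennreal 1 * nn_heat t (\<lambda>y. ennreal \<bar>f y\<bar>) x"
    using t by (simp add: heat_semigroup_abs_le)
  have m: "nn_heat t (\<lambda>y. ennreal \<bar>f y\<bar>) \<in> borel_measurable borel" by measurable
  show "heat_semigroup t f \<in> Lq q" "Lq_norm q (heat_semigroup t f) \<le> Lq_norm q f"
    using Lq_bound_majorant[OF _ m _ _ _ * AE] q by simp_all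
qed

lemma heat_semigroup_add:
  assumes "f \<in> Lq q" "g \<in> Lq q" "1 \<le> q" "0 \<le> t"
  shows "heat_semigroup t (\<lambda>y. f y + g y) x = heat_semigroup t f x + heat_semigroup t g x"
  using heat_semigroup_defined_Lq[of f q t x] heat_semigroup_defined_Lq[of g q t x] assms
  by (auto simp: heat_semigroup_def heat_semigroup_defined_def distrib_left)

lemma heat_semigroup_cmult: "heat_semigroup t (\<lambda>y. c * f y) x = c * heat_semigroup t f x"
  by (simp add: heat_semigroup_def mult.left_commute[of _ c])

lemma heat_semigroup_diff:
  assumes "f \<in> Lq q" "g \<in> Lq q" "1 \<le> q" "0 \<le> t"
  shows "heat_semigroup t (\<lambda>y. f y - g y) x = heat_semigroup t f x - heat_semigroup t g x"
  using heat_semigroup_defined_Lq[of f q t x] heat_semigroup_defined_Lq[of g q t x] assms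
  by (auto simp: heat_semigroup_def heat_semigroup_defined_def right_diff_distrib)

lemma heat_semigroup_heat_semigroup:
  assumes f: "f \<in> Lq q" and q: "1 \<le> q" and st: "0 \<le> s" "0 \<le> t" and nn: "\<And>x. 0 \<le> f x"
  shows "heat_semigroup s (heat_semigroup t f) x = heat_semigroup (s + t) f x"
proof -
  note [measurable] = Lq_measurable[OF f] measurable_heat_semigroup[OF Lq_measurable[OF f]]
  have fin: "nn_heat t (\<lambda>y. ennreal (f y)) y < top" for y
    using nn_heat_Lq_finite[OF f q, of t y] nn st by (cases "t = 0") auto
  have eq: "heat_semigroup t f = (\<lambda>y. enn2real (nn_heat t (\<lambda>y. ennreal (f y)) y))"
    using heat_semigroup_nonneg[of f t] st nn by (auto simp: fun_eq_iff)
  have "heat_semigroup s (heat_semigroup t f) x = enn2real (nn_heat s (\<lambda>y. ennreal (heat_semigroup t f y)) x)"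
    by (intro heat_semigroup_nonneg) (auto simp: eq st)
  also have "(\<lambda>y. ennreal (heat_semigroup t f y)) = nn_heat t (\<lambda>y. ennreal (f y))"
    using fin by (simp add: eq fun_eq_iff)
  also have "nn_heat s \<dots> x = nn_heat (s + t) (\<lambda>y. ennreal (f y)) x"
    using st by (simp add: nn_heat_nn_heat)
  finally show ?thesis
    using st nn by (simp add: heat_semigroup_nonneg)
qed

section \<open>Strong continuity at time 0: open sets, Borel sets, simple functions, all of the
  space\<close>

definition heat_continuous_at_0 :: "real \<Rightarrow> (real ^ 'n \<Rightarrow> real) \<Rightarrow> bool" where
  "heat_continuous_at_0 q f \<longleftrightarrow> (\<forall>e>0. \<exists>d>0. \<forall>t. 0 \<le> t \<longrightarrow> t < d \<longrightarrow> Lq_norm q (\<lambda>x. heat_semigroup t f x - f x) < e)"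

lemma heat_continuous_at_0D:
  assumes "heat_continuous_at_0 q f" "0 < e"
  obtains d where "0 < d" "\<And>t. 0 \<le> t \<Longrightarrow> t < d \<Longrightarrow> Lq_norm q (\<lambda>x. heat_semigroup t f x - f x) < e"
  using assms unfolding heat_continuous_at_0_def by blast

text \<open>The property is closed under limits in \<open>L^q\<close>: since the flow is a
  contraction, replacing \<open>f\<close> by \<open>g\<close> costs the distance of \<open>f\<close>
  and \<open>g\<close> twice, independently of \<open>t\<close>.\<close>

lemma heat_continuous_at_0_approx:
  assumes f: "f \<in> Lq q" and q: "1 \<le> q"
    and approx: "\<And>e. 0 < e \<Longrightarrow> \<exists>g \<in> Lq q. heat_continuous_at_0 q g \<and> Lq_norm q (\<lambda>x. g x - f x) < e"
  shows "heat_continuous_at_0 q f"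
  unfolding heat_continuous_at_0_def
proof (intro allI impI)
  fix e :: real assume e: "0 < e"
  obtain g where g: "g \<in> Lq q" "heat_continuous_at_0 q g" "Lq_norm q (\<lambda>x. g x - f x) < e / 3"
    using approx[of "e / 3"] e by auto
  obtain d where d: "0 < d" "\<And>t. 0 \<le> t \<Longrightarrow> t < d \<Longrightarrow> Lq_norm q (\<lambda>x. heat_semigroup t g x - g x) < e / 3"
    using heat_continuous_at_0D[OF g(2), of "e / 3"] e by auto
  have "Lq_norm q (\<lambda>x. heat_semigroup t f x - f x) < e" if t: "0 \<le> t" "t < d" for t
  proof -
    note Sf = heat_semigroup_Lq(1)[OF f q t(1)] and Sg = heat_semigroup_Lq(1)[OF g(1) q t(1)]
    have "Lq_norm q (\<lambda>x. heat_semigroup t f x - f x)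
      \<le> Lq_norm q (\<lambda>x. heat_semigroup t f x - heat_semigroup t g x) + Lq_norm q (\<lambda>x. heat_semigroup t g x - f x)"
      by (rule Lq_norm_diff_triangle[OF Sf Sg f q])
    also have "Lq_norm q (\<lambda>x. heat_semigroup t g x - f x)
      \<le> Lq_norm q (\<lambda>x. heat_semigroup t g x - g x) + Lq_norm q (\<lambda>x. g x - f x)"
      by (rule Lq_norm_diff_triangle[OF Sg g(1) f q])
    also have "(\<lambda>x. heat_semigroup t f x - heat_semigroup t g x) = heat_semigroup t (\<lambda>x. f x - g x)"
      using heat_semigroup_diff[OF f g(1) q t(1)] by (simp add: fun_eq_iff)
    also have "Lq_norm q \<dots> \<le> Lq_norm q (\<lambda>x. f x - g x)"
      by (rule heat_semigroup_Lq(2)[OF Lq_diff[OF f g(1) q] q t(1)])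
    also have "Lq_norm q (\<lambda>x. f x - g x) = Lq_norm q (\<lambda>x. g x - f x)" by (rule Lq_norm_minus_commute)
    finally show ?thesis using d(2)[OF t] g(3) by simp
  qed
  with d(1) show "\<exists>d>0. \<forall>t. 0 \<le> t \<longrightarrow> t < d \<longrightarrow> Lq_norm q (\<lambda>x. heat_semigroup t f x - f x) < e"
    by blast
qed

lemma heat_continuous_at_0_add:
  assumes f: "f \<in> Lq q" "heat_continuous_at_0 q f" and g: "g \<in> Lq q" "heat_continuous_at_0 q g" and q: "1 \<le> q"
  shows "heat_continuous_at_0 q (\<lambda>x. f x + g x)"
  unfolding heat_continuous_at_0_def
proof (intro allI impI)
  fix e :: real assume e: "0 < e"
  obtain d where d: "0 < d" "\<And>t. 0 \<le> t \<Longrightarrow> t < d \<Longrightarrow> Lq_norm q (\<lambda>x. heat_semigroup t f x - f x) < e / 2"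
    using heat_continuous_at_0D[OF f(2), of "e / 2"] e by auto
  obtain d' where d': "0 < d'" "\<And>t. 0 \<le> t \<Longrightarrow> t < d' \<Longrightarrow> Lq_norm q (\<lambda>x. heat_semigroup t g x - g x) < e / 2"
    using heat_continuous_at_0D[OF g(2), of "e / 2"] e by auto
  have "Lq_norm q (\<lambda>x. heat_semigroup t (\<lambda>x. f x + g x) x - (f x + g x)) < e" if t: "0 \<le> t" "t < min d d'" for t
  proof -
    have "Lq_norm q (\<lambda>x. (heat_semigroup t f x - f x) + (heat_semigroup t g x - g x))
      \<le> Lq_norm q (\<lambda>x. heat_semigroup t f x - f x) + Lq_norm q (\<lambda>x. heat_semigroup t g x - g x)"
      by (intro Lq_norm_triangle Lq_diff heat_semigroup_Lq f g q t)
    moreover have "(\<lambda>x. heat_semigroup t (\<lambda>x. f x + g x) x - (f x + g x))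
      = (\<lambda>x. (heat_semigroup t f x - f x) + (heat_semigroup t g x - g x))"
      using heat_semigroup_add[OF f(1) g(1) q t(1)] by (simp add: fun_eq_iff)
    ultimately show ?thesis using d(2)[of t] d'(2)[of t] t by simp
  qed
  then show "\<exists>d>0. \<forall>t. 0 \<le> t \<longrightarrow> t < d \<longrightarrow> Lq_norm q (\<lambda>x. heat_semigroup t (\<lambda>x. f x + g x) x - (f x + g x)) < e"
    using d(1) d'(1) by (intro exI[of _ "min d d'"]) auto
qed

lemma Lq_cmult: "f \<in> Lq q \<Longrightarrow> (\<lambda>x. c * f x) \<in> Lq q"
  by (auto simp: Lq_def abs_mult powr_mult intro!: borel_measurable_times)

lemma Lq_norm_cmult: "0 < q \<Longrightarrow> Lq_norm q (\<lambda>x. c * f x) = \<bar>c\<bar> * Lq_norm q f"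
  by (simp add: Lq_norm_def abs_mult powr_mult powr_powr)

lemma heat_continuous_at_0_cmult:
  assumes f: "heat_continuous_at_0 q f" and q: "1 \<le> q"
  shows "heat_continuous_at_0 q (\<lambda>x. c * f x)"
  unfolding heat_continuous_at_0_def
proof (intro allI impI)
  fix e :: real assume e: "0 < e"
  obtain d where d: "0 < d" "\<And>t. 0 \<le> t \<Longrightarrow> t < d \<Longrightarrow> Lq_norm q (\<lambda>x. heat_semigroup t f x - f x) < e / (\<bar>c\<bar> + 1)"
    using heat_continuous_at_0D[OF f, of "e / (\<bar>c\<bar> + 1)"] e by (auto simp: add_nonneg_pos)
  have "Lq_norm q (\<lambda>x. heat_semigroup t (\<lambda>x. c * f x) x - c * f x) < e" if t: "0 \<le> t" "t < d" for t
  proof -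
    have "Lq_norm q (\<lambda>x. heat_semigroup t (\<lambda>x. c * f x) x - c * f x) = \<bar>c\<bar> * Lq_norm q (\<lambda>x. heat_semigroup t f x - f x)"
      using q Lq_norm_cmult[of q c "\<lambda>x. heat_semigroup t f x - f x"]
      by (simp add: heat_semigroup_cmult right_diff_distrib)
    also have "\<dots> \<le> (\<bar>c\<bar> + 1) * Lq_norm q (\<lambda>x. heat_semigroup t f x - f x)"
      by (intro mult_right_mono) auto
    also have "\<dots> < e" using d(2)[OF t] by (simp add: field_simps add_nonneg_pos)
    finally show ?thesis .
  qed
  with d(1) show "\<exists>d>0. \<forall>t. 0 \<le> t \<longrightarrow> t < d \<longrightarrow> Lq_norm q (\<lambda>x. heat_semigroup t (\<lambda>x. c * f x) x - c * f x) < e"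
    by blast
qed

lemma heat_prefactor_double:
  "(4 * pi * t) powr (- real n / 2) = 2 powr (real n / 2) * (4 * pi * (2 * t)) powr (- real n / 2)"
proof -
  have "4 * pi * (2 * t) = 2 * (4 * pi * t)" by simp
  then have "(4 * pi * (2 * t)) powr (- real n / 2) = 2 powr (- (real n / 2)) * (4 * pi * t) powr (- real n / 2)"
    by (simp only: powr_mult minus_divide_left)
  then show ?thesis by (simp only: powr_minus) simp
qed

text \<open>Half of the Gaussian exponent is spent on the factor \<open>exp (- r^2 / (8 t))\<close>;
  the other half is the exponent of the kernel at time \<open>2 t\<close>, which is still
  integrable.\<close>

lemma heat_kernel_tail:
  assumes "0 < t" "0 \<le> r" "r \<le> norm (x :: real ^ 'n)"
  shows "heat_kernel t x \<le> 2 powr (real CARD('n) / 2) * exp (- r\<^sup>2 / (8 * t)) * heat_kernel (2 * t) x"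
proof -
  have "exp (- (norm x)\<^sup>2 / (4 * t)) = exp (- (norm x)\<^sup>2 / (8 * t)) * exp (- (norm x)\<^sup>2 / (8 * t))"
    by (simp add: exp_add[symmetric] field_simps)
  also have "\<dots> \<le> exp (- r\<^sup>2 / (8 * t)) * exp (- (norm x)\<^sup>2 / (8 * t))"
    using assms by (intro mult_right_mono) (auto intro!: divide_right_mono power_mono)
  finally have "exp (- (norm x)\<^sup>2 / (4 * t)) \<le> exp (- r\<^sup>2 / (8 * t)) * exp (- (norm x)\<^sup>2 / (8 * t))" .
  moreover note heat_prefactor_double[of t "CARD('n)"]
  ultimately show ?thesis
    using mult_left_mono[of "exp (- (norm x)\<^sup>2 / (4 * t))" "exp (- r\<^sup>2 / (8 * t)) * exp (- (norm x)\<^sup>2 / (8 * t))"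
        "(4 * pi * t) powr (- real CARD('n) / 2)"]
    unfolding heat_kernel_def by (simp only: powr_ge_zero mult_ac) simp
qed

lemma heat_semigroup_indicator_bounds:
  assumes [measurable]: "U \<in> sets borel" and "0 \<le> t"
  shows "0 \<le> heat_semigroup t (indicator U) x" "heat_semigroup t (indicator U) x \<le> 1"
    "nn_heat t (indicator U) x = ennreal (heat_semigroup t (indicator U) x)"
proof -
  have "nn_heat t (indicator U) x \<le> nn_heat t (\<lambda>_. 1) x"
    by (intro nn_heat_mono) (simp add: indicator_def)
  then have 1: "nn_heat t (indicator U) x \<le> 1" by (simp add: nn_heat_const)
  have 2: "heat_semigroup t (indicator U) x = enn2real (nn_heat t (indicator U) x)"
    using heat_semigroup_nonneg[of "indicator U" t x] assms(2)
    by (simp add: ennreal_indicator[abs_def])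
  show "0 \<le> heat_semigroup t (indicator U) x" by (simp add: 2)
  show "heat_semigroup t (indicator U) x \<le> 1"
    using enn2real_mono[OF 1] by (simp add: 2)
  show "nn_heat t (indicator U) x = ennreal (heat_semigroup t (indicator U) x)"
    unfolding 2 using 1 by (auto simp: top_unique intro!: ennreal_enn2real[symmetric] simp: less_top[symmetric])
qed

text \<open>A ball of radius \<open>r\<close> around \<open>x\<close> lies in \<open>U\<close>, and
  by \<open>heat_kernel_tail\<close> the mass of the kernel outside it is at most
  \<open>c s\<close>, which vanishes as \<open>s\<close> tends to 0.\<close>

lemma heat_semigroup_indicator_open:
  fixes U :: "(real ^ 'n) set"
  assumes U: "open U" and x: "x \<in> U" and t: "\<And>n. 0 < t n" "t \<longlonglongrightarrow> 0"
  shows "(\<lambda>n. heat_semigroup (t n) (indicator U) x) \<longlonglongrightarrow> 1"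
proof -
  have [measurable]: "U \<in> sets borel" using U by simp
  obtain r where r: "0 < r" "ball x r \<subseteq> U" using U x by (auto simp: open_contains_ball)
  define c where "c s = 2 powr (real CARD('n) / 2) * exp (- r\<^sup>2 / (8 * s))" for s
  have low: "1 - c s \<le> heat_semigroup s (indicator U) x" if s: "0 < s" for s
  proof -
    have "1 = (\<integral>\<^sup>+y. ennreal (heat_kernel s (x - y)) \<partial>lborel)"
      using s by (simp add: nn_integral_heat_kernel_diff)
    also have "\<dots> \<le> (\<integral>\<^sup>+y. ennreal (heat_kernel s (x - y)) * indicator U y + ennreal (c s) * ennreal (heat_kernel (2 * s) (x - y)) \<partial>lborel)"
    proof (intro nn_integral_mono)
      fix y
      show "ennreal (heat_kernel s (x - y)) \<le> ennreal (heat_kernel s (x - y)) * indicator U y + ennreal (c s) * ennreal (heat_kernel (2 * s) (x - y))"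
      proof (cases "y \<in> U")
        case False
        then have "r \<le> norm (x - y)" using r(2) by (force simp: dist_norm)
        from heat_kernel_tail[OF s _ this] r show ?thesis
          using False by (simp add: c_def ennreal_mult[symmetric] ennreal_leI)
      qed simp
    qed
    also have "\<dots> = nn_heat s (indicator U) x + ennreal (c s)"
      using s by (simp add: nn_integral_add nn_integral_cmult nn_integral_heat_kernel_diff nn_heat_def)
    also have "\<dots> = ennreal (heat_semigroup s (indicator U) x + c s)"
      using s heat_semigroup_indicator_bounds[of U s x] by (simp add: c_def)
    finally have "ennreal 1 \<le> ennreal (heat_semigroup s (indicator U) x + c s)" by simp
    then have "1 \<le> heat_semigroup s (indicator U) x + c s"
      using s heat_semigroup_indicator_bounds(1)[of U s x] by (subst (asm) ennreal_le_iff) (auto simp: c_def)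
    then show ?thesis by simp
  qed
  have "((\<lambda>s. 1 - c s) \<longlongrightarrow> 1 - 0) (at_right 0)"
    unfolding c_def using r(1) by real_asymp
  moreover have "filterlim t (at_right 0) sequentially"
    using t less_imp_neq[OF t(1), symmetric] by (auto simp: filterlim_at)
  ultimately have "(\<lambda>n. 1 - c (t n)) \<longlonglongrightarrow> 1"
    using filterlim_compose[of "\<lambda>s. 1 - c s"] by force
  then show ?thesis
  proof (rule tendsto_sandwich[rotated 2, OF _ tendsto_const])
    show "\<forall>\<^sub>F n in sequentially. 1 - c (t n) \<le> heat_semigroup (t n) (indicator U) x"
      using low t by simp
    show "\<forall>\<^sub>F n in sequentially. heat_semigroup (t n) (indicator U) x \<le> 1"
      using heat_semigroup_indicator_bounds(2)[of U _ x] t by (simp add: less_imp_le)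
  qed
qed

text \<open>If \<open>g\<close> has no more mass than \<open>f\<close>, the excess of
  \<open>g\<close> is compensated by its deficit, so the latter controls the \<open>L^1\<close>
  distance. For an indicator and its flow the deficit lives on the set itself, where pointwise
  convergence is known.\<close>

lemma integral_abs_diff_le:
  fixes f g :: "'a \<Rightarrow> real"
  assumes f: "integrable M f" and g: "integrable M g" and le: "(LINT x|M. g x) \<le> (LINT x|M. f x)"
  shows "(LINT x|M. \<bar>g x - f x\<bar>) \<le> 2 * (LINT x|M. max 0 (f x - g x))"
proof -
  have "\<bar>g x - f x\<bar> = 2 * max 0 (f x - g x) + (g x - f x)" for x by (auto simp: max_def)
  then have "(LINT x|M. \<bar>g x - f x\<bar>) = 2 * (LINT x|M. max 0 (f x - g x)) + ((LINT x|M. g x) - (LINT x|M. f x))"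
    using f g by simp
  with le show ?thesis by simp
qed

text \<open>For open \<open>U\<close> the semigroup preserves the mass of the indicator, and \<open>S(t) 1\<^sub>U\<close>
  tends to 1 pointwise on \<open>U\<close>; so it suffices to control the part of the difference living on \<open>U\<close>.\<close>

lemma heat_semigroup_indicator_open_L1:
  fixes U :: "(real ^ 'n) set"
  assumes U: "open U" and fin: "emeasure lborel U < top" and t: "\<And>n. 0 < t n" "t \<longlonglongrightarrow> 0"
  shows "(\<lambda>n. LINT x|lborel. \<bar>heat_semigroup (t n) (indicator U) x - indicator U x\<bar>) \<longlonglongrightarrow> 0"
proof -
  have [measurable]: "U \<in> sets borel" using U by simp
  note [measurable] = measurable_heat_semigroup
  have iU: "integrable lborel (indicator U :: real ^ 'n \<Rightarrow> real)"
    using fin by (simp add: integrable_indicator_iff)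
  have mass: "(\<integral>\<^sup>+x. ennreal (heat_semigroup s (indicator U) x) \<partial>lborel) = emeasure lborel U" if "0 < s" for s
    using that heat_semigroup_indicator_bounds(3)[of U s] nn_integral_nn_heat[of "indicator U" s]
    by simp
  have iS: "integrable lborel (heat_semigroup s (indicator U))" if "0 < s" for s
    using mass[OF that] fin heat_semigroup_indicator_bounds(1)[of U s] that
    by (subst integrable_iff_bounded) simp
  have eq: "(LINT x|lborel. heat_semigroup s (indicator U) x) = (LINT x|lborel. indicator U x)" if "0 < s" for s
    using mass[OF that] heat_semigroup_indicator_bounds(1)[of U s] that
    by (subst integral_eq_nn_integral) (auto simp: measure_def)
  have "(\<lambda>n. LINT x|lborel. max 0 (indicator U x - heat_semigroup (t n) (indicator U) x))
     \<longlonglongrightarrow> (LINT x|(lborel :: (real ^ 'n) measure). 0)"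
  proof (rule integral_dominated_convergence[where w = "indicator U"])
    show "AE x in lborel. (\<lambda>n. max 0 (indicator U x - heat_semigroup (t n) (indicator U) x)) \<longlonglongrightarrow> 0"
    proof (rule AE_I2)
      fix x
      show "(\<lambda>n. max 0 (indicator U x - heat_semigroup (t n) (indicator U) x)) \<longlonglongrightarrow> 0"
      proof (cases "x \<in> U")
        case True
        have "(\<lambda>n. max 0 (1 - heat_semigroup (t n) (indicator U) x)) \<longlonglongrightarrow> max 0 (1 - 1)"
          by (intro tendsto_intros heat_semigroup_indicator_open U True t)
        with True show ?thesis by simp
      next
        case False
        then have "max 0 (indicator U x - heat_semigroup (t n) (indicator U) x) = 0" for n
          using heat_semigroup_indicator_bounds(1)[of U "t n" x] t(1)[of n] by simp
        then show ?thesis by simp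
      qed
    qed
    show "AE x in lborel. norm (max 0 (indicator U x - heat_semigroup (t n) (indicator U) x)) \<le> indicator U x" for n
      using heat_semigroup_indicator_bounds(1)[of U "t n"] t(1)[of n] by (intro AE_I2) (auto simp: indicator_def)
  qed (use iU in auto)
  then have lim: "(\<lambda>n. 2 * (LINT x|lborel. max 0 (indicator U x - heat_semigroup (t n) (indicator U) x))) \<longlonglongrightarrow> 0"
    by (simp add: tendsto_mult_right_zero)
  have le: "(LINT x|lborel. \<bar>heat_semigroup (t n) (indicator U) x - indicator U x\<bar>)
      \<le> 2 * (LINT x|lborel. max 0 (indicator U x - heat_semigroup (t n) (indicator U) x))" for n
    using integral_abs_diff_le[OF iU iS[OF t(1)], of n] eq[OF t(1), of n] by simp
  show ?thesis
    by (rule tendsto_sandwich[OF always_eventually always_eventually tendsto_const lim]) (simp_all add: le)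
qed

lemma Lq_norm_le_L1:
  assumes [measurable]: "f \<in> borel_measurable borel" and q: "1 \<le> q" and le: "\<And>x. \<bar>f x\<bar> \<le> 1"
    and int: "integrable lborel f"
  shows "f \<in> Lq q" "Lq_norm q f \<le> (LINT x|lborel. \<bar>f x\<bar>) powr (1 / q)"
proof -
  have pt: "\<bar>f x\<bar> powr q \<le> \<bar>f x\<bar>" for x
  proof (cases "f x = 0")
    case False
    then show ?thesis using powr_mono'[of 1 q "\<bar>f x\<bar>"] le[of x] q by simp
  qed simp
  have i: "integrable lborel (\<lambda>x. \<bar>f x\<bar> powr q)"
    by (rule Bochner_Integration.integrable_bound[OF int]) (use pt in auto)
  then show "f \<in> Lq q" by (simp add: Lq_def)
  show "Lq_norm q f \<le> (LINT x|lborel. \<bar>f x\<bar>) powr (1 / q)"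
    unfolding Lq_norm_def using i int pt q by (intro powr_mono2 integral_mono) auto
qed

text \<open>Argued by contradiction along a sequence of times, because dominated convergence is
  sequential. The difference has values in [-1, 1], which turns \<open>L^1\<close> convergence into
  \<open>L^q\<close> convergence.\<close>

lemma heat_continuous_at_0_open:
  fixes U :: "(real ^ 'n) set"
  assumes U: "open U" and fin: "emeasure lborel U < top" and q: "1 \<le> q"
  shows "heat_continuous_at_0 q (indicator U)"
proof (rule ccontr)
  assume "\<not> ?thesis"
  then obtain e where e1: "0 < e"
    and "\<not> (\<exists>d>0. \<forall>t. 0 \<le> t \<longrightarrow> t < d \<longrightarrow> Lq_norm q (\<lambda>x. heat_semigroup t (indicator U) x - indicator U x) < e)"
    unfolding heat_continuous_at_0_def by blast
  then have "\<exists>t. 0 \<le> t \<and> t < d \<and> e \<le> Lq_norm q (\<lambda>x. heat_semigroup t (indicator U) x - indicator U x)" if "0 < d" for d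
    using that by (meson not_less)
  note e = e1 this
  have "\<forall>n. \<exists>t. 0 \<le> t \<and> t < inverse (real (Suc n)) \<and> e \<le> Lq_norm q (\<lambda>x. heat_semigroup t (indicator U) x - indicator U x)"
    using e(2) by simp
  then obtain t where t: "\<And>n. 0 \<le> t n" "\<And>n. t n < inverse (real (Suc n))"
    "\<And>n. e \<le> Lq_norm q (\<lambda>x. heat_semigroup (t n) (indicator U) x - indicator U x)"
    by metis
  have [measurable]: "U \<in> sets borel" using U by simp
  note [measurable] = measurable_heat_semigroup
  \<comment> \<open>At time 0 the difference vanishes identically, so the times of a counterexample
    are positive, as the convergence lemmas require.\<close>
  have tpos: "0 < t n" for n
  proof (rule ccontr)
    assume "\<not> 0 < t n"
    then have "t n = 0" using t(1)[of n] by simp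
    with t(3)[of n] e(1) q show False by (simp add: Lq_norm_def)
  qed
  have tlim: "t \<longlonglongrightarrow> 0"
    by (rule tendsto_sandwich[of "\<lambda>_. 0" _ _ "\<lambda>n. inverse (real (Suc n))"])
       (use t(1,2) LIMSEQ_inverse_real_of_nat in \<open>auto intro!: always_eventually intro: less_imp_le\<close>)
  have iU: "integrable lborel (indicator U :: real ^ 'n \<Rightarrow> real)"
    using fin by (simp add: integrable_indicator_iff)
  have iS: "integrable lborel (heat_semigroup s (indicator U))" if "0 < s" for s
    using fin heat_semigroup_indicator_bounds(1,3)[of U s] that nn_integral_nn_heat[of "indicator U" s]
    by (subst integrable_iff_bounded) simp
  have "e \<le> (LINT x|lborel. \<bar>heat_semigroup (t n) (indicator U) x - indicator U x\<bar>) powr (1 / q)" for n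
  proof (rule order_trans[OF t(3) Lq_norm_le_L1(2)])
    show "\<bar>heat_semigroup (t n) (indicator U) x - indicator U x\<bar> \<le> 1" for x
      using heat_semigroup_indicator_bounds(1,2)[of U "t n" x] t(1)[of n] by (auto simp: indicator_def)
    show "integrable lborel (\<lambda>x. heat_semigroup (t n) (indicator U) x - indicator U x)"
      using iU iS[OF tpos] by simp
  qed (use q in auto)
  moreover have "(\<lambda>n. (LINT x|lborel. \<bar>heat_semigroup (t n) (indicator U) x - indicator U x\<bar>) powr (1 / q)) \<longlonglongrightarrow> 0 powr (1 / q)"
    using q by (intro tendsto_powr' heat_semigroup_indicator_open_L1 U fin tpos tlim tendsto_const) auto
  ultimately have "e \<le> 0"
    by (intro LIMSEQ_le_const[where X = "\<lambda>n. (LINT x|lborel. \<bar>heat_semigroup (t n) (indicator U) x - indicator U x\<bar>) powr (1 / q)"]) auto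
  with e(1) show False by simp
qed

lemma Lq_indicator:
  assumes [measurable]: "A \<in> sets borel" and "emeasure lborel A < top"
  shows "indicator A \<in> Lq q"
proof -
  have "(\<lambda>x. \<bar>indicator A x\<bar> powr q) = (indicator A :: _ \<Rightarrow> real)"
    by (auto simp: indicator_def fun_eq_iff)
  then show ?thesis using assms by (simp add: Lq_def integrable_indicator_iff)
qed

lemma Lq_norm_indicator:
  "Lq_norm q (indicator A) = measure lborel A powr (1 / q)"
proof -
  have "(\<lambda>x. \<bar>indicator A x\<bar> powr q) = (indicator A :: _ \<Rightarrow> real)"
    by (auto simp: indicator_def fun_eq_iff)
  then show ?thesis by (simp add: Lq_norm_def)
qed

lemma heat_continuous_at_0_indicator:
  fixes A :: "(real ^ 'n) set"
  assumes A: "A \<in> sets borel" and fin: "emeasure lborel A < top" and q: "1 \<le> q"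
  shows "heat_continuous_at_0 q (indicator A)"
proof (rule heat_continuous_at_0_approx[OF Lq_indicator[OF A fin] q])
  fix e :: real assume e: "0 < e"
  \<comment> \<open>An open superset exceeding \<open>A\<close> by measure less than
    \<open>\<eta>\<close> has an indicator at \<open>L^q\<close> distance at most
    \<open>e / 2\<close> from that of \<open>A\<close>.\<close>
  define \<eta> where "\<eta> = (e / 2) powr q"
  have \<eta>: "0 < \<eta>" using e by (simp add: \<eta>_def)
  obtain U where U: "A \<subseteq> U" "open U" "emeasure lborel (U - A) < ennreal \<eta>"
    by (rule outer_regular_lborel[OF A \<eta>])
  have [measurable]: "U \<in> sets borel" "A \<in> sets borel" using U A by auto
  have "emeasure lborel U \<le> emeasure lborel A + emeasure lborel (U - A)"
    using U(1) by (subst plus_emeasure) (auto simp: Un_absorb1)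
  also have "\<dots> < top"
    using fin order.strict_trans[OF U(3) ennreal_less_top] by simp
  finally have Ufin: "emeasure lborel U < top" .
  have "(\<lambda>x. indicator U x - indicator A x) = (indicator (U - A) :: _ \<Rightarrow> real)"
    using U(1) by (auto simp: indicator_def fun_eq_iff)
  then have "Lq_norm q (\<lambda>x. indicator U x - indicator A x) = measure lborel (U - A) powr (1 / q)"
    by (simp add: Lq_norm_indicator)
  also have "\<dots> \<le> \<eta> powr (1 / q)"
    using U(3) \<eta> q by (intro powr_mono2) (auto simp: measure_def enn2real_leI less_imp_le)
  also have "\<dots> < e" using e q by (simp add: \<eta>_def powr_powr)
  finally show "\<exists>g\<in>Lq q. heat_continuous_at_0 q g \<and> Lq_norm q (\<lambda>x. g x - indicator A x) < e"
    using heat_continuous_at_0_open[OF U(2) Ufin q] Lq_indicator[OF _ Ufin] by (intro bexI[of _ "indicator U"]) auto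
qed

text \<open>The level set of the value 0 may have infinite measure and is left out of the
  representation; the others have finite measure by Chebyshev's inequality.\<close>

lemma heat_continuous_at_0_simple:
  fixes s :: "real ^ 'n \<Rightarrow> real"
  assumes s: "simple_function lborel s" "s \<in> Lq q" and q: "1 \<le> q"
  shows "heat_continuous_at_0 q s"
proof -
  have [measurable]: "s \<in> borel_measurable borel" using s(2) by (rule Lq_measurable)
  have fin: "emeasure lborel (s -` {c}) < top" if "c \<noteq> 0" for c
  proof -
    have "ennreal (\<bar>c\<bar> powr q) * emeasure lborel (s -` {c}) = (\<integral>\<^sup>+x. ennreal (\<bar>c\<bar> powr q) * indicator (s -` {c}) x \<partial>lborel)"
      by (subst nn_integral_cmult_indicator) (simp_all add: measurable_sets_borel[of s borel])
    also have "\<dots> \<le> (\<integral>\<^sup>+x. epow (ennreal \<bar>s x\<bar>) q \<partial>lborel)"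
      by (intro nn_integral_mono) (auto simp: indicator_def)
    also have "\<dots> < top" using s(2) by (simp add: Lq_iff del: epow_ennreal)
    finally show ?thesis using that by (auto simp: ennreal_mult_less_top)
  qed
  have main: "(\<lambda>x. \<Sum>c\<in>C. c * indicator (s -` {c}) x) \<in> Lq q \<and> heat_continuous_at_0 q (\<lambda>x. \<Sum>c\<in>C. c * indicator (s -` {c}) x)"
    if "finite C" "0 \<notin> C" for C
    using that
  proof (induction C)
    case empty
    have "heat_continuous_at_0 q (\<lambda>x. 0 * indicator {} x :: real)"
      using q by (intro heat_continuous_at_0_cmult heat_continuous_at_0_indicator) auto
    then show ?case by (simp add: Lq_def)
  next
    case (insert c C)
    have m: "s -` {c} \<in> sets borel" by (rule measurable_sets_borel[of s borel]) auto
    have f: "emeasure lborel (s -` {c}) < top" using insert by (intro fin) auto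
    have 1: "(\<lambda>x. c * indicator (s -` {c}) x) \<in> Lq q" by (intro Lq_cmult Lq_indicator m f)
    have 2: "heat_continuous_at_0 q (\<lambda>x. c * indicator (s -` {c}) x)"
      by (intro heat_continuous_at_0_cmult heat_continuous_at_0_indicator m f q)
    have "0 \<notin> C" using insert.prems by simp
    note IH = conjunct1[OF insert.IH[OF this]] conjunct2[OF insert.IH[OF this]]
    show ?case
      unfolding sum.insert[OF insert.hyps]
      by (rule conjI[OF Lq_add[OF 1 IH(1) q] heat_continuous_at_0_add[OF 1 2 IH q]])
  qed
  have eq: "s = (\<lambda>x. \<Sum>c\<in>range s - {0}. c * indicator (s -` {c}) x)"
  proof
    fix x
    have f: "finite (range s)" using simple_functionD(1)[OF s(1)] by simp
    have "(\<Sum>c\<in>range s - {0}. c * indicator (s -` {c}) x) = (\<Sum>c\<in>range s. c * indicator (s -` {c}) x)"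
      using f by (intro sum.mono_neutral_left) auto
    also have "\<dots> = (\<Sum>c\<in>{s x}. c * indicator (s -` {c}) x)"
      using f by (intro sum.mono_neutral_right) (auto simp: indicator_def)
    finally show "s x = (\<Sum>c\<in>range s - {0}. c * indicator (s -` {c}) x)" by simp
  qed
  have "finite (range s - {0})" using simple_functionD(1)[OF s(1)] by simp
  then show ?thesis
    by (subst eq) (rule conjunct2[OF main], auto)
qed

lemma heat_semigroup_continuous_at_0:
  fixes f :: "real ^ 'n \<Rightarrow> real"
  assumes f: "f \<in> Lq q" and q: "1 \<le> q"
  shows "heat_continuous_at_0 q f"
proof (rule heat_continuous_at_0_approx[OF f q])
  fix e :: real assume e: "0 < e"
  have [measurable]: "f \<in> borel_measurable borel" using f by (rule Lq_measurable)
  \<comment> \<open>Approximating relative to the point 0 yields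
    \<open>|s i x| \<le> 2 |f x|\<close>, hence membership in \<open>Lq\<close> and the dominating
    function \<open>(3 |f|)^q\<close>.\<close>
  obtain s where s: "\<And>i. simple_function lborel (s i)" "\<And>x. (\<lambda>i. s i x) \<longlonglongrightarrow> f x" "\<And>i x. norm (s i x) \<le> 2 * norm (f x)"
    using borel_measurable_implies_sequence_metric[of f lborel 0] by (auto simp: dist_norm)
  have [measurable]: "s i \<in> borel_measurable borel" for i using borel_measurable_simple_function[OF s(1)] by simp
  have sL: "s i \<in> Lq q" for i
    using Lq_mono(1)[OF _ Lq_cmult[OF f, of 2], of "s i"] s(3) q by (auto simp: abs_mult)
  have "(\<lambda>i. LINT x|lborel. \<bar>s i x - f x\<bar> powr q) \<longlonglongrightarrow> (LINT x|(lborel :: (real ^ 'n) measure). 0)"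
  proof (rule integral_dominated_convergence[where w = "\<lambda>x. 3 powr q * \<bar>f x\<bar> powr q"])
    show "integrable lborel (\<lambda>x. 3 powr q * \<bar>f x\<bar> powr q)" using f by (simp add: Lq_def)
    show "AE x in lborel. (\<lambda>i. \<bar>s i x - f x\<bar> powr q) \<longlonglongrightarrow> 0"
    proof (rule AE_I2)
      fix x
      have "(\<lambda>i. \<bar>s i x - f x\<bar> powr q) \<longlonglongrightarrow> \<bar>f x - f x\<bar> powr q"
        using q by (intro tendsto_powr' tendsto_intros s(2)) auto
      then show "(\<lambda>i. \<bar>s i x - f x\<bar> powr q) \<longlonglongrightarrow> 0" by simp
    qed
    show "AE x in lborel. norm (\<bar>s i x - f x\<bar> powr q) \<le> 3 powr q * \<bar>f x\<bar> powr q" for i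
    proof (rule AE_I2)
      fix x
      have "\<bar>s i x - f x\<bar> \<le> 3 * \<bar>f x\<bar>" using s(3)[of i x] by simp
      then have "\<bar>s i x - f x\<bar> powr q \<le> (3 * \<bar>f x\<bar>) powr q" using q by (intro powr_mono2) auto
      then show "norm (\<bar>s i x - f x\<bar> powr q) \<le> 3 powr q * \<bar>f x\<bar> powr q" by (simp add: powr_mult)
    qed
  qed auto
  then have "(\<lambda>i. Lq_norm q (\<lambda>x. s i x - f x)) \<longlonglongrightarrow> 0 powr (1 / q)"
    unfolding Lq_norm_def using q by (intro tendsto_powr' tendsto_const) auto
  then have "eventually (\<lambda>i. Lq_norm q (\<lambda>x. s i x - f x) < e) sequentially"
    using e by (intro order_tendstoD(2)[of _ "0 powr (1 / q)"]) auto
  then obtain i where "Lq_norm q (\<lambda>x. s i x - f x) < e" by (auto simp: eventually_sequentially)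
  then show "\<exists>g\<in>Lq q. heat_continuous_at_0 q g \<and> Lq_norm q (\<lambda>x. g x - f x) < e"
    using heat_continuous_at_0_simple[OF s(1) sL q] sL by blast
qed

section \<open>Continuity of curves in Lebesgue spaces\<close>

lemma Lq_norm_zero [simp]: "Lq_norm q (\<lambda>x. 0) = 0"
  by (simp add: Lq_norm_def)

lemma continuous_Lq_iff:
  "continuous_Lq q T u \<longleftrightarrow> (\<forall>t\<in>{0..T}. u t \<in> Lq q) \<and>
    (\<forall>t\<in>{0..T}. \<forall>e>0. \<exists>d>0. \<forall>s\<in>{0..T}. \<bar>s - t\<bar> < d \<longrightarrow> Lq_norm q (\<lambda>x. u s x - u t x) < e)"
proof -
  have "((\<lambda>s. Lq_norm q (\<lambda>x. u s x - u t x)) \<longlongrightarrow> 0) (at t within {0..T}) \<longleftrightarrow>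
    (\<forall>e>0. \<exists>d>0. \<forall>s\<in>{0..T}. \<bar>s - t\<bar> < d \<longrightarrow> Lq_norm q (\<lambda>x. u s x - u t x) < e)" for t
  proof -
    have *: "(0 < \<bar>s - t\<bar> \<and> \<bar>s - t\<bar> < d \<longrightarrow> \<bar>Lq_norm q (\<lambda>x. u s x - u t x) - 0\<bar> < e)
      \<longleftrightarrow> (\<bar>s - t\<bar> < d \<longrightarrow> Lq_norm q (\<lambda>x. u s x - u t x) < e)" if "0 < e" for s d e
      using that by (cases "s = t") auto
    have "(\<forall>s\<in>{0..T}. 0 < \<bar>s - t\<bar> \<and> \<bar>s - t\<bar> < d \<longrightarrow> \<bar>Lq_norm q (\<lambda>x. u s x - u t x) - 0\<bar> < e)
      \<longleftrightarrow> (\<forall>s\<in>{0..T}. \<bar>s - t\<bar> < d \<longrightarrow> Lq_norm q (\<lambda>x. u s x - u t x) < e)" if "0 < e" for d e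
      by (intro ball_cong refl *[OF that])
    then show ?thesis
      unfolding Lim_within dist_real_def
      by (intro all_cong1 imp_cong refl ex_cong1 conj_cong) blast
  qed
  then show ?thesis by (simp add: continuous_Lq_def)
qed

lemma continuous_Lq_add:
  assumes u: "continuous_Lq q T u" and v: "continuous_Lq q T v" and q: "1 \<le> q"
  shows "continuous_Lq q T (\<lambda>t x. u t x + v t x)"
  unfolding continuous_Lq_iff
proof (intro conjI ballI allI impI)
  have L: "u t \<in> Lq q" "v t \<in> Lq q" if "t \<in> {0..T}" for t
    using u v that by (auto simp: continuous_Lq_def)
  fix t assume t: "t \<in> {0..T}"
  show "(\<lambda>x. u t x + v t x) \<in> Lq q" using L[OF t] q by (intro Lq_add)
  fix e :: real assume "0 < e"
  then have e: "0 < e / 2" by simp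
  obtain d1 where d1: "0 < d1" "\<And>s. s \<in> {0..T} \<Longrightarrow> \<bar>s - t\<bar> < d1 \<Longrightarrow> Lq_norm q (\<lambda>x. u s x - u t x) < e / 2"
    using u t e unfolding continuous_Lq_iff by blast
  obtain d2 where d2: "0 < d2" "\<And>s. s \<in> {0..T} \<Longrightarrow> \<bar>s - t\<bar> < d2 \<Longrightarrow> Lq_norm q (\<lambda>x. v s x - v t x) < e / 2"
    using v t e unfolding continuous_Lq_iff by blast
  have "Lq_norm q (\<lambda>x. (u s x + v s x) - (u t x + v t x)) < e" if s: "s \<in> {0..T}" "\<bar>s - t\<bar> < min d1 d2" for s
  proof -
    have "Lq_norm q (\<lambda>x. (u s x - u t x) + (v s x - v t x))
        \<le> Lq_norm q (\<lambda>x. u s x - u t x) + Lq_norm q (\<lambda>x. v s x - v t x)"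
      by (intro Lq_norm_triangle Lq_diff L s t q)
    moreover have "(\<lambda>x. (u s x + v s x) - (u t x + v t x)) = (\<lambda>x. (u s x - u t x) + (v s x - v t x))"
      by (simp add: fun_eq_iff)
    ultimately show ?thesis using d1(2)[OF s(1)] d2(2)[OF s(1)] s(2) by simp
  qed
  then show "\<exists>d>0. \<forall>s\<in>{0..T}. \<bar>s - t\<bar> < d \<longrightarrow> Lq_norm q (\<lambda>x. (u s x + v s x) - (u t x + v t x)) < e"
    using d1(1) d2(1) by (intro exI[of _ "min d1 d2"]) auto
qed

lemma continuous_Lq_uminus:
  assumes "continuous_Lq q T u"
  shows "continuous_Lq q T (\<lambda>t x. - u t x)"
proof -
  have "Lq_norm q (\<lambda>x. - u s x - - u t x) = Lq_norm q (\<lambda>x. u s x - u t x)" for s t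
    by simp (rule Lq_norm_minus_commute)
  with assms show ?thesis
    by (simp add: continuous_Lq_iff Lq_uminus)
qed

lemma continuous_Lq_diff:
  assumes u: "continuous_Lq q T u" and v: "continuous_Lq q T v" and q: "1 \<le> q"
  shows "continuous_Lq q T (\<lambda>t x. u t x - v t x)"
  using continuous_Lq_add[OF u continuous_Lq_uminus[OF v] q] by simp

lemma continuous_Lq_cong_AE:
  assumes u: "continuous_Lq q T u" and m: "\<And>t. t \<in> {0..T} \<Longrightarrow> v t \<in> borel_measurable borel"
    and eq: "\<And>t. t \<in> {0..T} \<Longrightarrow> AE x in lborel. u t x = v t x"
  shows "continuous_Lq q T v"
proof -
  have L: "u t \<in> Lq q" if "t \<in> {0..T}" for t
    using u that by (auto simp: continuous_Lq_def)
  have "Lq_norm q (\<lambda>x. u s x - u t x) = Lq_norm q (\<lambda>x. v s x - v t x)" if "s \<in> {0..T}" "t \<in> {0..T}" for s t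
  proof (rule Lq_norm_cong_AE)
    show "AE x in lborel. u s x - u t x = v s x - v t x"
      using eq[OF that(1)] eq[OF that(2)] by eventually_elim simp
  qed (use L m that in \<open>auto intro!: borel_measurable_diff dest: Lq_measurable\<close>)
  moreover have "v t \<in> Lq q" if "t \<in> {0..T}" for t
    using Lq_cong_AE[OF eq L m] that by blast
  ultimately show ?thesis
    using u by (simp add: continuous_Lq_iff)
qed

text \<open>Heine-Cantor, argued with sequences in the compact interval because the curve consists
  of representatives whose distance is only a seminorm.\<close>

lemma continuous_Lq_uniform:
  assumes v: "continuous_Lq q T v" and q: "1 \<le> q" and e: "0 < e"
  obtains d where "0 < d" "\<And>s t. s \<in> {0..T} \<Longrightarrow> t \<in> {0..T} \<Longrightarrow> \<bar>s - t\<bar> < d \<Longrightarrow> Lq_norm q (\<lambda>x. v s x - v t x) < e"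
proof (rule ccontr)
  note found = that
  assume "\<not> thesis"
  then have neg: "\<exists>s t. s \<in> {0..T} \<and> t \<in> {0..T} \<and> \<bar>s - t\<bar> < d \<and> e \<le> Lq_norm q (\<lambda>x. v s x - v t x)" if "0 < d" for d
    using found[OF that] by (meson not_less)
  have "\<forall>n. \<exists>s t. s \<in> {0..T} \<and> t \<in> {0..T} \<and> \<bar>s - t\<bar> < inverse (real (Suc n)) \<and> e \<le> Lq_norm q (\<lambda>x. v s x - v t x)"
    using neg by simp
  then obtain s t where st: "\<And>n. s n \<in> {0..T}" "\<And>n. t n \<in> {0..T}" "\<And>n. \<bar>s n - t n\<bar> < inverse (real (Suc n))"
    "\<And>n. e \<le> Lq_norm q (\<lambda>x. v (s n) x - v (t n) x)"
    by metis
  have L: "v r \<in> Lq q" if "r \<in> {0..T}" for r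
    using v that by (auto simp: continuous_Lq_def)
  have "seq_compact {0..T}" by (intro compact_imp_seq_compact compact_Icc)
  then obtain l r where lr: "l \<in> {0..T}" "strict_mono r" "(s \<circ> r) \<longlonglongrightarrow> l"
    using st(1) by (meson seq_compactE)
  have "(\<lambda>n. s n - t n) \<longlonglongrightarrow> 0"
    by (rule tendsto_rabs_zero_cancel, rule tendsto_sandwich[of "\<lambda>_. 0" _ _ "\<lambda>n. inverse (real (Suc n))"])
       (use st(3) LIMSEQ_inverse_real_of_nat in \<open>auto intro!: always_eventually intro: less_imp_le\<close>)
  then have "((\<lambda>n. s n - t n) \<circ> r) \<longlonglongrightarrow> 0" using lr(2) by (rule LIMSEQ_subseq_LIMSEQ)
  from tendsto_diff[OF lr(3) this] have tl: "(t \<circ> r) \<longlonglongrightarrow> l" by (simp add: o_def)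
  obtain d where d: "0 < d" "\<And>s. s \<in> {0..T} \<Longrightarrow> \<bar>s - l\<bar> < d \<Longrightarrow> Lq_norm q (\<lambda>x. v s x - v l x) < e / 2"
    using v lr(1) e unfolding continuous_Lq_iff by (meson half_gt_zero)
  have "eventually (\<lambda>n. \<bar>(s \<circ> r) n - l\<bar> < d \<and> \<bar>(t \<circ> r) n - l\<bar> < d) sequentially"
    using tendstoD[OF lr(3) d(1)] tendstoD[OF tl d(1)] by (simp add: eventually_conj dist_real_def)
  then obtain n where n: "\<bar>s (r n) - l\<bar> < d" "\<bar>t (r n) - l\<bar> < d"
    by (auto simp: eventually_sequentially)
  have "Lq_norm q (\<lambda>x. v (s (r n)) x - v (t (r n)) x)
      \<le> Lq_norm q (\<lambda>x. v (s (r n)) x - v l x) + Lq_norm q (\<lambda>x. v l x - v (t (r n)) x)"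
    by (intro Lq_norm_diff_triangle L st lr q)
  also have "\<dots> < e"
    using d(2)[OF st(1) n(1)] d(2)[OF st(2) n(2)] by (simp add: Lq_norm_minus_commute[of q "v l"])
  finally show False using st(4)[of "r n"] by simp
qed

text \<open>A mild solution prescribes only a class at each time, whereas Tonelli in
  \<open>(\<tau>, x)\<close> needs joint measurability. Step curves at distance below
  \<open>(1/2)^n\<close> converge almost everywhere at each fixed time, since the integrals of the
  \<open>q\<close>-th powers of the errors are summable; the pointwise limit of the step curves is
  the version.\<close>

lemma continuous_Lq_measurable_version:
  fixes v :: "real \<Rightarrow> real ^ 'n \<Rightarrow> real"
  assumes v: "continuous_Lq q T v" and q: "1 \<le> q"
  obtains V where "case_prod V \<in> borel_measurable (borel \<Otimes>\<^sub>M borel)"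
    and "\<And>t. t \<in> {0..T} \<Longrightarrow> AE x in lborel. V t x = v t x"
proof -
  have L: "v r \<in> Lq q" if "r \<in> {0..T}" for r
    using v that by (auto simp: continuous_Lq_def)
  have "\<exists>d. 0 < d \<and> (\<forall>s t. s \<in> {0..T} \<longrightarrow> t \<in> {0..T} \<longrightarrow> \<bar>s - t\<bar> < d \<longrightarrow> Lq_norm q (\<lambda>x. v s x - v t x) < (1 / 2) ^ n)" for n :: nat
    by (rule continuous_Lq_uniform[OF v q, of "(1 / 2) ^ n"]) auto
  then obtain d where "\<And>n. 0 < d n \<and> (\<forall>s t. s \<in> {0..T} \<longrightarrow> t \<in> {0..T} \<longrightarrow> \<bar>s - t\<bar> < d n \<longrightarrow> Lq_norm q (\<lambda>x. v s x - v t x) < (1 / 2) ^ n)"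
    by metis
  then have d: "\<And>n. 0 < d n"
    "\<And>n s t. s \<in> {0..T} \<Longrightarrow> t \<in> {0..T} \<Longrightarrow> \<bar>s - t\<bar> < d n \<Longrightarrow> Lq_norm q (\<lambda>x. v s x - v t x) < (1 / 2) ^ n"
    by blast+
  define w where "w s x = (if s \<in> {0..T} then v s x else 0)" for s x
  have w [measurable]: "w s \<in> borel_measurable borel" for s
    using L[of s] by (cases "s \<in> {0..T}") (auto simp: w_def[abs_def] dest: Lq_measurable)
  \<comment> \<open>Rounding down keeps the node in [0, T], and only countably many nodes occur, so
    each step curve is jointly measurable.\<close>
  define step where "step n t = d n * of_int \<lfloor>t / d n\<rfloor>" for n t
  define V where "V t x = lim (\<lambda>n. w (step n t) x)" for t x
  have wm [measurable]: "(\<lambda>z. w (step n (fst z)) (snd z)) \<in> borel_measurable (borel \<Otimes>\<^sub>M borel)" for n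
    unfolding step_def
    by (rule measurable_compose_countable[where f = "\<lambda>i z. w (d n * of_int i) (snd z)" and g = "\<lambda>z. \<lfloor>fst z / d n\<rfloor>"]) measurable
  have "(\<lambda>z. V (fst z) (snd z)) \<in> borel_measurable (borel \<Otimes>\<^sub>M borel)"
    unfolding V_def by measurable
  moreover have "AE x in lborel. V t x = v t x" if t: "t \<in> {0..T}" for t
  proof -
    have step: "step n t \<in> {0..T}" "\<bar>step n t - t\<bar> < d n" for n
    proof -
      have fl: "of_int \<lfloor>t / d n\<rfloor> \<le> t / d n" "t / d n < of_int \<lfloor>t / d n\<rfloor> + 1" "0 \<le> \<lfloor>t / d n\<rfloor>"
        using d(1)[of n] t by auto
      have "step n t \<le> t"
        using mult_left_mono[OF fl(1), of "d n"] d(1)[of n] by (simp add: step_def)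
      moreover have "t < step n t + d n" "0 \<le> step n t"
        using fl(2,3) d(1)[of n] by (auto simp: step_def field_simps)
      ultimately have "step n t \<le> t" "t < step n t + d n" "0 \<le> step n t" by blast+
      then show "step n t \<in> {0..T}" "\<bar>step n t - t\<bar> < d n" using t by auto
    qed
    note [measurable] = Lq_measurable[OF L[OF t]] Lq_measurable[OF L[OF step(1)]]
    have "(\<integral>\<^sup>+x. epow (ennreal \<bar>v (step n t) x - v t x\<bar>) q \<partial>lborel) \<le> ennreal ((1 / 2) ^ n)" for n
    proof -
      have "(\<integral>\<^sup>+x. epow (ennreal \<bar>v (step n t) x - v t x\<bar>) q \<partial>lborel) = ennreal (Lq_norm q (\<lambda>x. v (step n t) x - v t x) powr q)"
        using q by (intro nn_integral_Lq_norm Lq_diff L step t) auto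
      also have "\<dots> \<le> ennreal (((1 / 2) ^ n) powr q)"
        using d(2)[OF step(1)[of n] t step(2)[of n]] q by (intro ennreal_leI powr_mono2) auto
      also have "\<dots> \<le> ennreal (((1 / 2) ^ n) powr 1)"
        using q by (intro ennreal_leI powr_mono') (auto simp: power_le_one)
      finally show ?thesis by simp
    qed
    then have "(\<Sum>n. \<integral>\<^sup>+x. epow (ennreal \<bar>v (step n t) x - v t x\<bar>) q \<partial>lborel) \<le> (\<Sum>n. ennreal ((1 / 2) ^ n))"
      by (intro suminf_le) auto
    also have "\<dots> = ennreal (\<Sum>n. (1 / 2) ^ n)"
      by (intro suminf_ennreal2) (auto intro!: summable_geometric)
    also have "\<dots> < top" by simp
    finally have "(\<integral>\<^sup>+x. (\<Sum>n. epow (ennreal \<bar>v (step n t) x - v t x\<bar>) q) \<partial>lborel) < top"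
      by (subst nn_integral_suminf) auto
    then have "(\<integral>\<^sup>+x. (\<Sum>n. epow (ennreal \<bar>v (step n t) x - v t x\<bar>) q) \<partial>lborel) \<noteq> \<infinity>"
      by (simp only: infinity_ennreal_def less_top)
    then have "AE x in lborel. (\<Sum>n. epow (ennreal \<bar>v (step n t) x - v t x\<bar>) q) \<noteq> \<infinity>"
      by (rule nn_integral_PInf_AE[rotated]) measurable
    then show ?thesis
    proof eventually_elim
      case (elim x)
      then have "(\<Sum>n. ennreal (\<bar>v (step n t) x - v t x\<bar> powr q)) \<noteq> top" by simp
      then have "summable (\<lambda>n. \<bar>v (step n t) x - v t x\<bar> powr q)"
        by (intro summable_suminf_not_top) auto
      then have "(\<lambda>n. \<bar>v (step n t) x - v t x\<bar> powr q) \<longlonglongrightarrow> 0" by (rule summable_LIMSEQ_zero)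
      then have "(\<lambda>n. (\<bar>v (step n t) x - v t x\<bar> powr q) powr (1 / q)) \<longlonglongrightarrow> 0 powr (1 / q)"
        using q by (intro tendsto_powr' tendsto_const) auto
      then have "(\<lambda>n. v (step n t) x - v t x) \<longlonglongrightarrow> 0"
        using q by (simp add: powr_powr tendsto_rabs_zero_iff)
      then have "(\<lambda>n. w (step n t) x) \<longlonglongrightarrow> v t x"
        using step(1) by (simp add: w_def LIM_zero_iff)
      then show ?case unfolding V_def by (rule limI)
    qed
  qed
  ultimately show thesis using that[of V] by (simp add: split_beta')
qed

text \<open>Restarting the Duhamel formula at a time \<open>a\<close> slightly before \<open>t\<close> leaves, up to a
  small remainder, the curve \<open>s \<mapsto> S(s - a) X(a)\<close>.\<close>

lemma duhamel_continuous:
  fixes F :: "real \<Rightarrow> real ^ 'n \<Rightarrow> ennreal"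
  assumes \<phi> [measurable]: "\<phi> \<in> borel_measurable borel"
    and F: "case_prod F \<in> borel_measurable (borel \<Otimes>\<^sub>M borel)" and q: "1 \<le> q"
    and fin: "\<And>t. 0 \<le> t \<Longrightarrow> t \<le> T \<Longrightarrow> (\<integral>\<^sup>+x. epow (nn_heat t \<phi> x + duhamel 0 t F x) q \<partial>lborel) < top"
    and small: "\<And>e. 0 < e \<Longrightarrow> \<exists>d>0. \<forall>a t. 0 \<le> a \<longrightarrow> a \<le> t \<longrightarrow> t \<le> T \<longrightarrow> t - a < d \<longrightarrow>
      (\<integral>\<^sup>+x. epow (duhamel a t F x) q \<partial>lborel) \<le> ennreal (e powr q)"
  shows "continuous_Lq q T (\<lambda>t x. enn2real (nn_heat t \<phi> x + duhamel 0 t F x))"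
proof -
  note [measurable (raw)] = measurable_duhamel[OF F]
  define E where "E t x = nn_heat t \<phi> x + duhamel 0 t F x" for t x
  have [measurable]: "E t \<in> borel_measurable borel" for t unfolding E_def by measurable
  define X where "X t x = enn2real (E t x)" for t x
  have [measurable]: "X t \<in> borel_measurable borel" for t unfolding X_def by measurable
  have EX: "AE x in lborel. E t x = ennreal (X t x)" if "0 \<le> t" "t \<le> T" for t
  proof -
    have "AE x in lborel. epow (E t x) q \<noteq> top"
      using nn_integral_PInf_AE[of "\<lambda>x. epow (E t x) q" lborel] fin[OF that] by (auto simp: E_def)
    then show ?thesis by eventually_elim (simp add: X_def less_top)
  qed
  have XL: "X t \<in> Lq q" if t: "0 \<le> t" "t \<le> T" for t
  proof -
    have "(\<integral>\<^sup>+x. epow (ennreal \<bar>X t x\<bar>) q \<partial>lborel) = (\<integral>\<^sup>+x. epow (E t x) q \<partial>lborel)"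
    proof (intro nn_integral_cong_AE)
      have "\<bar>X t x\<bar> = X t x" for x by (simp add: X_def)
      then show "AE x in lborel. epow (ennreal \<bar>X t x\<bar>) q = epow (E t x) q"
        using EX[OF t] by (elim eventually_mono) (simp only:)
    qed
    with fin[OF t] show ?thesis by (simp add: Lq_iff E_def del: epow_ennreal)
  qed
  define R where "R a t x = enn2real (duhamel a t F x)" for a t x
  have [measurable]: "R a t \<in> borel_measurable borel" for a t unfolding R_def by measurable
  \<comment> \<open>The restart identity holds exactly in [0, top]. Off a null set its terms are
    finite and it passes to real values; for \<open>t > a\<close> the flow does not notice the null
    set on which \<open>E a\<close> is infinite.\<close>
  have restart: "AE x in lborel. X t x = heat_semigroup (t - a) (X a) x + R a t x"
    if t: "0 \<le> a" "a \<le> t" "t \<le> T" for a t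
  proof -
    have "AE x in lborel. E t x = ennreal (X t x)" using t by (intro EX) auto
    moreover have "AE x in lborel. E a x = ennreal (X a x)" using t by (intro EX) auto
    moreover from this have "AE x in lborel. nn_heat (t - a) (E a) x = nn_heat (t - a) (\<lambda>y. ennreal (X a y)) x"
      using t by (cases "t = a") (auto intro!: nn_heat_cong_AE AE_I2)
    ultimately show ?thesis
    proof eventually_elim
      case (elim x)
      have "E t x = nn_heat (t - a) (nn_heat a \<phi>) x + (nn_heat (t - a) (duhamel 0 a F) x + duhamel a t F x)"
        unfolding E_def using t by (subst duhamel_split[OF F t(1,2)]) (simp add: nn_heat_nn_heat)
      also have "\<dots> = nn_heat (t - a) (E a) x + duhamel a t F x"
        unfolding E_def by (subst nn_heat_add) (auto simp: add.assoc)
      finally have eq: "E t x = nn_heat (t - a) (\<lambda>y. ennreal (X a y)) x + duhamel a t F x"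
        using elim by simp
      then have "nn_heat (t - a) (\<lambda>y. ennreal (X a y)) x < top" "duhamel a t F x < top"
        using elim(1) by (auto simp: less_top[symmetric] dest: sym)
      then have "X t x = enn2real (nn_heat (t - a) (\<lambda>y. ennreal (X a y)) x) + R a t x"
        unfolding X_def[of t] eq R_def by (rule enn2real_plus)
      then show ?case using t by (simp add: heat_semigroup_nonneg X_def)
    qed
  qed
  show ?thesis
    unfolding continuous_Lq_iff E_def[symmetric] X_def[symmetric]
  proof (intro conjI ballI allI impI)
    fix t assume "t \<in> {0..T}"
    then have t: "0 \<le> t" "t \<le> T" by auto
    show "X t \<in> Lq q" by (rule XL[OF t])
    fix e :: real assume e: "0 < e"
    obtain d where d: "0 < d" "\<And>a t. 0 \<le> a \<Longrightarrow> a \<le> t \<Longrightarrow> t \<le> T \<Longrightarrow> t - a < d \<Longrightarrow>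
      (\<integral>\<^sup>+x. epow (duhamel a t F x) q \<partial>lborel) \<le> ennreal ((e / 3) powr q)"
      using small[of "e / 3"] e by auto
    \<comment> \<open>Half of \<open>d\<close> before \<open>t\<close>: then every time
      \<open>s\<close> in [0, T] with \<open>|s - t| < d / 2\<close> lies after \<open>a\<close> and
      still satisfies \<open>s - a < d\<close>, so one restart point serves both sides of
      \<open>t\<close>.\<close>
    define a where "a = max 0 (t - d / 2)"
    have a: "0 \<le> a" "a \<le> t" "t - a < d" using t d(1) by (auto simp: a_def)
    have Xa: "X a \<in> Lq q" using a t by (intro XL) auto
    obtain d' where d': "0 < d'" "\<And>s. 0 \<le> s \<Longrightarrow> s < d' \<Longrightarrow> Lq_norm q (\<lambda>x. heat_semigroup s (X a) x - X a x) < e / 3"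
      using heat_continuous_at_0D[OF heat_semigroup_continuous_at_0[OF Xa q], of "e / 3"] e by auto
    \<comment> \<open>The semigroup law and contraction reduce this to strong continuity at 0 for
      the single function \<open>X a\<close>, uniformly in \<open>s\<close>.\<close>
    have sym: "Lq_norm q (\<lambda>x. heat_semigroup (r - a) (X a) x - heat_semigroup (s - a) (X a) x) < e / 3"
      if "a \<le> s" "s \<le> r" "r - s < d'" for r s
    proof -
      have "heat_semigroup (r - a) (X a) x = heat_semigroup (s - a) (heat_semigroup (r - s) (X a)) x" for x
        using that by (subst heat_semigroup_heat_semigroup[OF Xa q]) (auto simp: X_def)
      then have eq: "(\<lambda>x. heat_semigroup (r - a) (X a) x - heat_semigroup (s - a) (X a) x)
         = heat_semigroup (s - a) (\<lambda>x. heat_semigroup (r - s) (X a) x - X a x)"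
        using that heat_semigroup_diff[OF heat_semigroup_Lq(1)[OF Xa q] Xa q] by (simp add: fun_eq_iff)
      have "Lq_norm q (\<lambda>x. heat_semigroup (r - a) (X a) x - heat_semigroup (s - a) (X a) x)
          \<le> Lq_norm q (\<lambda>x. heat_semigroup (r - s) (X a) x - X a x)"
        unfolding eq using that by (intro heat_semigroup_Lq(2) Lq_diff heat_semigroup_Lq(1) Xa q) auto
      also have "\<dots> < e / 3" using that by (intro d') auto
      finally show ?thesis .
    qed
    have RL: "R a s \<in> Lq q" "Lq_norm q (R a s) \<le> e / 3" if s: "a \<le> s" "s \<le> T" "s - a < d" for s
    proof -
      have "(\<integral>\<^sup>+x. epow (ennreal \<bar>R a s x\<bar>) q \<partial>lborel) \<le> (\<integral>\<^sup>+x. epow (duhamel a s F x) q \<partial>lborel)"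
        unfolding R_def using q by (intro nn_integral_mono epow_mono) (auto simp: ennreal_enn2real_if)
      also have "\<dots> \<le> ennreal ((e / 3) powr q)" using a s by (intro d) auto
      finally have *: "(\<integral>\<^sup>+x. epow (ennreal \<bar>R a s x\<bar>) q \<partial>lborel) \<le> ennreal ((e / 3) powr q)" .
      show "R a s \<in> Lq q" "Lq_norm q (R a s) \<le> e / 3"
        using Lq_bound[OF _ _ _ *] q e by auto
    qed
    have "Lq_norm q (\<lambda>x. X s x - X t x) < e" if "s \<in> {0..T}" and st: "\<bar>s - t\<bar> < min (d / 2) d'" for s
    proof -
      have "s - t < d / 2" "t - s < d / 2" using st by linarith+
      then have s: "0 \<le> s" "s \<le> T" "a \<le> s" "s - a < d" using that(1) t d(1) unfolding a_def by (auto simp: max_def)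
      let ?Hs = "heat_semigroup (s - a) (X a)" and ?Ht = "heat_semigroup (t - a) (X a)"
      have H: "?Hs \<in> Lq q" "?Ht \<in> Lq q" using s a by (auto intro!: heat_semigroup_Lq Xa q)
      note R = RL[OF s(3,2,4)] RL[OF a(2) t(2) a(3)]
      note [measurable] = Lq_measurable[OF H(1)] Lq_measurable[OF H(2)]
      have "AE x in lborel. X s x - X t x = (?Hs x - ?Ht x) + (R a s x - R a t x)"
        using restart[OF a(1) s(3,2)] restart[OF a(1,2) t(2)] by eventually_elim simp
      then have "Lq_norm q (\<lambda>x. X s x - X t x) = Lq_norm q (\<lambda>x. (?Hs x - ?Ht x) + (R a s x - R a t x))"
        by (rule Lq_norm_cong_AE) auto
      also have "\<dots> \<le> Lq_norm q (\<lambda>x. ?Hs x - ?Ht x) + Lq_norm q (\<lambda>x. R a s x - R a t x)"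
        by (intro Lq_norm_triangle Lq_diff H R q)
      also have "Lq_norm q (\<lambda>x. R a s x - R a t x) \<le> Lq_norm q (R a s) + Lq_norm q (R a t)"
        using Lq_norm_triangle[OF R(1) Lq_uminus[OF R(3)] q] by (simp add: Lq_norm_uminus)
      also have "Lq_norm q (\<lambda>x. ?Hs x - ?Ht x) < e / 3"
      proof (cases "s \<le> t")
        case True
        then show ?thesis using sym[of s t] s st by (subst Lq_norm_minus_commute) auto
      next
        case False
        then show ?thesis using sym[of t s] a st by auto
      qed
      finally show ?thesis using R by simp
    qed
    then show "\<exists>da>0. \<forall>s\<in>{0..T}. \<bar>s - t\<bar> < da \<longrightarrow> Lq_norm q (\<lambda>x. X s x - X t x) < e"
      using d(1) d'(1) by (intro exI[of _ "min (d / 2) d'"]) auto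
  qed
qed

section \<open>An exponentially decaying weight\<close>

text \<open>With this norm the weight \<open>exp (- l1norm x)\<close> is a product over the
  coordinates, so its integrability is a one-dimensional matter.\<close>

definition l1norm :: "'a::euclidean_space \<Rightarrow> real" where
  "l1norm x = (\<Sum>b\<in>Basis. \<bar>x \<bullet> b\<bar>)"

definition decay :: "'a::euclidean_space \<Rightarrow> real" where
  "decay x = exp (- l1norm x)"

lemma measurable_l1norm [measurable]: "l1norm \<in> borel_measurable borel"
  unfolding l1norm_def[abs_def] by measurable

lemma measurable_decay [measurable]: "decay \<in> borel_measurable borel"
  unfolding decay_def[abs_def] by measurable

lemma decay_pos [simp]: "0 < decay x" and decay_nonneg [simp]: "0 \<le> decay x"
  by (simp_all add: decay_def)

lemma decay_le_1: "decay x \<le> 1"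
  by (simp add: decay_def l1norm_def sum_nonneg)

lemma l1norm_triangle: "l1norm (x + y) \<le> l1norm x + l1norm y"
  by (simp add: l1norm_def inner_add_left sum.distrib[symmetric] sum_mono abs_triangle_ineq)

lemma l1norm_minus_commute: "l1norm (x - y) = l1norm (y - x)"
  by (simp add: l1norm_def inner_diff_left abs_minus_commute)

lemma decay_le: "decay z \<le> decay y * exp (l1norm (y - z))"
  using l1norm_triangle[of "y - z" z] by (simp add: decay_def exp_add[symmetric])

lemma nn_integral_decay: "(\<integral>\<^sup>+x. ennreal (decay (x :: real ^ 'n)) \<partial>lborel) < top"
proof -
  have half: "(\<integral>\<^sup>+x. ennreal (exponential_density 1 x) \<partial>lborel) = 1"
  proof -
    interpret prob_space "density lborel (exponential_density 1)"
      by (rule prob_space_exponential_density) simp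
    show ?thesis using emeasure_space_1 by (simp add: emeasure_density)
  qed
  have half': "(\<integral>\<^sup>+x. ennreal (exponential_density 1 (- x)) \<partial>lborel) = 1"
    using half nn_integral_real_affine[of "\<lambda>x. ennreal (exponential_density 1 x)" "-1" 0] by simp
  have "(\<integral>\<^sup>+x. ennreal (exp (- \<bar>x\<bar>)) \<partial>lborel)
    \<le> (\<integral>\<^sup>+x. ennreal (exponential_density 1 x) + ennreal (exponential_density 1 (- x)) \<partial>lborel)"
    by (intro nn_integral_mono) (auto simp: exponential_density_def abs_if simp flip: ennreal_plus intro!: ennreal_leI)
  also have "\<dots> = 2" using half half' by (subst nn_integral_add) auto
  also have "2 < (top :: ennreal)" by simp
  finally have 1: "(\<integral>\<^sup>+x. ennreal (exp (- \<bar>x\<bar>)) \<partial>lborel) < top" .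
  have "ennreal (decay x) = (\<Prod>b\<in>Basis. ennreal (exp (- \<bar>x \<bullet> b\<bar>)))" for x :: "real ^ 'n"
    by (simp add: decay_def l1norm_def exp_sum prod_ennreal flip: sum_negf)
  then have "(\<integral>\<^sup>+x. ennreal (decay (x :: real ^ 'n)) \<partial>lborel)
    = (\<integral>\<^sup>+x. (\<Prod>b\<in>(Basis :: (real ^ 'n) set). ennreal (exp (- \<bar>x \<bullet> b\<bar>))) \<partial>lborel)"
    by (intro nn_integral_cong)
  also have "\<dots> = (\<Prod>b\<in>(Basis :: (real ^ 'n) set). (\<integral>\<^sup>+x. ennreal (exp (- \<bar>x\<bar>)) \<partial>lborel))"
    by (rule nn_integral_lborel_prod) auto
  also have "\<dots> < top" using 1 by (simp add: power_less_top_ennreal)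
  finally show ?thesis .
qed

text \<open>In each coordinate this is \<open>(|a| - 4 s)^2 \<ge> 0\<close>. The coefficient
  \<open>1 / (8 s)\<close> is half of the Gaussian exponent at time \<open>s\<close>, so absorbing
  \<open>exp (l1norm x)\<close> into the kernel leaves exactly the exponent at time
  \<open>2 s\<close>.\<close>

lemma l1norm_le:
  assumes "0 < s"
  shows "l1norm (x :: real ^ 'n) \<le> (norm x)\<^sup>2 / (8 * s) + 2 * s * real CARD('n)"
proof -
  have "\<bar>a\<bar> \<le> a\<^sup>2 / (8 * s) + 2 * s" for a :: real
  proof -
    have "0 \<le> (\<bar>a\<bar> - 4 * s)\<^sup>2 / (8 * s)" using assms by simp
    also have "\<dots> = a\<^sup>2 / (8 * s) - \<bar>a\<bar> + 2 * s"
      using assms by (simp add: power2_diff field_simps power2_eq_square)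
    finally show ?thesis by simp
  qed
  then have "l1norm x \<le> (\<Sum>b\<in>(Basis :: (real ^ 'n) set). (x \<bullet> b)\<^sup>2 / (8 * s) + 2 * s)"
    unfolding l1norm_def by (intro sum_mono)
  then show ?thesis
    by (simp add: sum.distrib sum_divide_distrib[symmetric] norm_eq_sum_Basis mult_ac)
qed

lemma heat_kernel_exp_l1norm:
  assumes s: "0 < s" "s \<le> 1"
  shows "heat_kernel s (x :: real ^ 'n) * exp (l1norm x)
    \<le> 2 powr (real CARD('n) / 2) * exp (2 * real CARD('n)) * heat_kernel (2 * s) x"
proof -
  have "- (norm x)\<^sup>2 / (4 * s) + l1norm x \<le> - (norm x)\<^sup>2 / (4 * (2 * s)) + 2 * real CARD('n)"
  proof -
    define A where "A = (norm x)\<^sup>2 / (8 * s)"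
    have "- (norm x)\<^sup>2 / (4 * s) = - (2 * A)" "- (norm x)\<^sup>2 / (4 * (2 * s)) = - A" by (simp_all add: A_def)
    moreover have "l1norm x \<le> A + 2 * s * real CARD('n)" unfolding A_def by (rule l1norm_le[OF s(1)])
    moreover have "2 * s * real CARD('n) \<le> 2 * real CARD('n)" using s by simp
    ultimately show ?thesis by linarith
  qed
  then have 1: "exp (- (norm x)\<^sup>2 / (4 * s)) * exp (l1norm x) \<le> exp (- (norm x)\<^sup>2 / (4 * (2 * s))) * exp (2 * real CARD('n))"
    using s by (simp add: exp_add[symmetric])
  have "heat_kernel s x * exp (l1norm x) = (4 * pi * s) powr (- real CARD('n) / 2) * (exp (- (norm x)\<^sup>2 / (4 * s)) * exp (l1norm x))"
    by (simp add: heat_kernel_def)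
  also have "\<dots> \<le> (4 * pi * s) powr (- real CARD('n) / 2) * (exp (- (norm x)\<^sup>2 / (4 * (2 * s))) * exp (2 * real CARD('n)))"
    using 1 by (intro mult_left_mono) auto
  also have "\<dots> = 2 powr (real CARD('n) / 2) * exp (2 * real CARD('n)) * heat_kernel (2 * s) x"
    unfolding heat_prefactor_double[of s] heat_kernel_def by (simp only: mult_ac)
  finally show ?thesis .
qed

text \<open>From \<open>z\<close> to \<open>y\<close> the weight changes by at most the factor
  \<open>exp (l1norm (y - z))\<close>, which the kernel absorbs at the price of doubling the time.
  The restriction \<open>s \<le> 1\<close> makes the constant uniform.\<close>

lemma nn_heat_decay_le:
  fixes \<psi> :: "real ^ 'n \<Rightarrow> ennreal"
  assumes [measurable]: "\<psi> \<in> borel_measurable borel" and s: "0 < s" "s \<le> 1"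
  shows "nn_heat s (\<lambda>z. ennreal (decay z) * \<psi> z) y
    \<le> ennreal (2 powr (real CARD('n) / 2) * exp (2 * real CARD('n))) * ennreal (decay y) * nn_heat (2 * s) \<psi> y"
proof -
  define C where "C = 2 powr (real CARD('n) / 2) * exp (2 * real CARD('n))"
  have C: "0 \<le> C" by (simp add: C_def)
  have pt: "heat_kernel s (y - z) * decay z \<le> C * decay y * heat_kernel (2 * s) (y - z)" for z
  proof -
    have "heat_kernel s (y - z) * decay z \<le> heat_kernel s (y - z) * (decay y * exp (l1norm (y - z)))"
      by (intro mult_left_mono decay_le) simp
    also have "\<dots> = decay y * (heat_kernel s (y - z) * exp (l1norm (y - z)))" by simp
    also have "\<dots> \<le> decay y * (C * heat_kernel (2 * s) (y - z))"
      unfolding C_def by (intro mult_left_mono heat_kernel_exp_l1norm s) simp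
    finally show ?thesis by (simp add: mult_ac)
  qed
  have "nn_heat s (\<lambda>z. ennreal (decay z) * \<psi> z) y = (\<integral>\<^sup>+z. ennreal (heat_kernel s (y - z) * decay z) * \<psi> z \<partial>lborel)"
    using s by (simp add: nn_heat_def ennreal_mult mult.assoc)
  also have "\<dots> \<le> (\<integral>\<^sup>+z. ennreal (C * decay y * heat_kernel (2 * s) (y - z)) * \<psi> z \<partial>lborel)"
    by (intro nn_integral_mono mult_right_mono ennreal_leI pt) simp
  also have "\<dots> = (\<integral>\<^sup>+z. ennreal (C * decay y) * (ennreal (heat_kernel (2 * s) (y - z)) * \<psi> z) \<partial>lborel)"
    using C by (simp add: ennreal_mult mult.assoc)
  also have "\<dots> = ennreal (C * decay y) * nn_heat (2 * s) \<psi> y"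
    using s by (simp add: nn_heat_def nn_integral_cmult)
  finally show ?thesis using C by (simp add: C_def ennreal_mult)
qed

text \<open>The flow cannot destroy the weight within unit time. This allows the weight to be
  replaced by its flow, which symmetry then moves onto another function.\<close>

lemma decay_le_nn_heat:
  assumes s: "0 \<le> s" "s \<le> 1"
  shows "ennreal (exp (- real CARD('n)) * 2 powr (- real CARD('n) / 2)) * ennreal (decay y)
    \<le> nn_heat s (\<lambda>z. ennreal (decay z)) (y :: real ^ 'n)"
proof (cases "s = 0")
  case True
  have "2 powr (- real CARD('n) / 2) \<le> 2 powr 0" by (intro powr_mono) auto
  then have "exp (- real CARD('n)) * 2 powr (- real CARD('n) / 2) \<le> 1 * 1" by (intro mult_mono) auto
  then have "ennreal (exp (- real CARD('n)) * 2 powr (- real CARD('n) / 2)) * ennreal (decay y) \<le> 1 * ennreal (decay y)"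
    by (intro mult_right_mono) (auto simp: ennreal_le_1)
  with True show ?thesis by simp
next
  case False
  with s have s: "0 < s" "s \<le> 1" by auto
  define c where "c = exp (- real CARD('n)) * 2 powr (- real CARD('n) / 2)"
  \<comment> \<open>Here \<open>1 / s' = 1 / s + 1\<close>, so the Gaussian at time
    \<open>s'\<close> is the one at time \<open>s\<close> times \<open>exp (- |x|^2 / 4)\<close>,
    and the latter is at most a constant times \<open>exp (- l1norm x)\<close>. The prefactors are
    compared by \<open>s \<le> 2 s'\<close>, true for \<open>s \<le> 1\<close>.\<close>
  define s' where "s' = s / (1 + s)"
  have s': "0 < s'" using s by (simp add: s'_def)
  have pt: "c * decay y * heat_kernel s' (y - z) \<le> heat_kernel s (y - z) * decay z" for z
  proof -
    define x where "x = y - z"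
    have "l1norm x \<le> (norm x)\<^sup>2 / 4 + real CARD('n)"
      using l1norm_le[of "1 / 2" x] by simp
    moreover have "(norm x)\<^sup>2 / (4 * s') = (norm x)\<^sup>2 / (4 * s) + (norm x)\<^sup>2 / 4"
      using s by (simp add: s'_def field_simps)
    ultimately have "- real CARD('n) + - (norm x)\<^sup>2 / (4 * s') \<le> - (norm x)\<^sup>2 / (4 * s) + - l1norm x"
      by simp
    then have 1: "exp (- real CARD('n)) * exp (- (norm x)\<^sup>2 / (4 * s')) \<le> exp (- (norm x)\<^sup>2 / (4 * s)) * exp (- l1norm x)"
      by (simp only: exp_add[symmetric] exp_le_cancel_iff)
    have "4 * pi * s \<le> 2 * (4 * pi * s')"
      using s by (simp add: s'_def field_simps)
    then have "(2 * (4 * pi * s')) powr (- real CARD('n) / 2) \<le> (4 * pi * s) powr (- real CARD('n) / 2)"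
      using s by (intro powr_mono2') auto
    then have 2: "2 powr (- real CARD('n) / 2) * (4 * pi * s') powr (- real CARD('n) / 2) \<le> (4 * pi * s) powr (- real CARD('n) / 2)"
      by (simp only: powr_mult)
    have 3: "decay y * exp (- l1norm x) \<le> decay z"
      using decay_le[of y z] l1norm_minus_commute[of y z] by (simp add: x_def exp_minus field_simps)
    have "c * decay y * heat_kernel s' x = decay y * ((2 powr (- real CARD('n) / 2) * (4 * pi * s') powr (- real CARD('n) / 2)) *
       (exp (- real CARD('n)) * exp (- (norm x)\<^sup>2 / (4 * s'))))"
      by (simp add: c_def heat_kernel_def mult_ac)
    also have "\<dots> \<le> decay y * ((4 * pi * s) powr (- real CARD('n) / 2) * (exp (- (norm x)\<^sup>2 / (4 * s)) * exp (- l1norm x)))"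
      by (intro mult_left_mono mult_mono 1 2) auto
    also have "\<dots> = heat_kernel s x * (decay y * exp (- l1norm x))"
      by (simp add: heat_kernel_def mult_ac)
    also have "\<dots> \<le> heat_kernel s x * decay z"
      by (intro mult_left_mono 3) simp
    finally show ?thesis by (simp add: x_def)
  qed
  have "ennreal c * ennreal (decay y) = (\<integral>\<^sup>+z. ennreal (c * decay y) * ennreal (heat_kernel s' (y - z)) \<partial>lborel)"
    using s' by (subst nn_integral_cmult) (auto simp: nn_integral_heat_kernel_diff ennreal_mult c_def)
  also have "\<dots> \<le> (\<integral>\<^sup>+z. ennreal (heat_kernel s (y - z)) * ennreal (decay z) \<partial>lborel)"
    using pt by (intro nn_integral_mono) (simp add: ennreal_mult[symmetric] c_def ennreal_leI)
  finally show ?thesis using s by (simp add: c_def nn_heat_def)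
qed

section \<open>A space-time Kato estimate\<close>

lemma nn_heat_smoothing_Lq:
  fixes g :: "real ^ 'n \<Rightarrow> ennreal"
  assumes [measurable]: "g \<in> borel_measurable borel" and q: "1 \<le> q" and s: "0 < s" and M: "0 \<le> M"
    and g: "(\<integral>\<^sup>+x. epow (g x) q \<partial>lborel) \<le> ennreal (M powr q)"
  shows "nn_heat (2 * s) g y \<le> ennreal (s powr (- real CARD('n) / (2 * q)) * M)"
proof -
  have "epow (nn_heat (2 * s) g y) q \<le> nn_heat (2 * s) (\<lambda>x. epow (g x) q) y"
    using q by (intro nn_heat_jensen) measurable
  also have "\<dots> \<le> ennreal ((4 * pi * (2 * s)) powr (- real CARD('n) / 2)) * (\<integral>\<^sup>+x. epow (g x) q \<partial>lborel)"
    using s by (intro nn_heat_smoothing) auto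
  also have "\<dots> \<le> ennreal (s powr (- real CARD('n) / 2)) * ennreal (M powr q)"
  proof (intro mult_mono g ennreal_leI powr_mono2')
    have "1 \<le> 4 * pi * 2" using pi_ge_two by linarith
    then have "s * 1 \<le> s * (4 * pi * 2)" using s by (intro mult_left_mono) auto
    then show "s \<le> 4 * pi * (2 * s)" by (simp add: mult_ac)
  qed (use s in auto)
  also have "\<dots> = ennreal ((s powr (- real CARD('n) / (2 * q)) * M) powr q)"
    using q M by (simp add: ennreal_mult[symmetric] powr_mult powr_powr)
  finally have "epow (epow (nn_heat (2 * s) g y) q) (1 / q) \<le> epow (ennreal ((s powr (- real CARD('n) / (2 * q)) * M) powr q)) (1 / q)"
    using q by (intro epow_mono) auto
  then show ?thesis using q M by (simp add: epow_epow powr_powr)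
qed

text \<open>Jensen's inequality for a concave power, deduced from the convex exponent
  \<open>1 / \<beta>\<close>. On a time interval of length at most \<open>s\<close> the factor
  \<open>c^(1 - \<beta>)\<close> becomes the gain \<open>s^(1 - \<beta>)\<close>.\<close>

lemma nn_integral_jensen_root:
  assumes [measurable]: "k \<in> borel_measurable M" "h \<in> borel_measurable M"
    and mass: "(\<integral>\<^sup>+x. k x \<partial>M) \<le> ennreal c" and c: "0 < c" and \<beta>: "0 < \<beta>" "\<beta> \<le> 1"
  shows "(\<integral>\<^sup>+x. k x * epow (h x) \<beta> \<partial>M) \<le> ennreal (c powr (1 - \<beta>)) * epow (\<integral>\<^sup>+x. k x * h x \<partial>M) \<beta>"
proof -
  have "epow (\<integral>\<^sup>+x. k x * epow (h x) \<beta> \<partial>M) (1 / \<beta>) \<le> ennreal (c powr (1 / \<beta> - 1)) * (\<integral>\<^sup>+x. k x * h x \<partial>M)"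
    using nn_integral_jensen[of k M "\<lambda>x. epow (h x) \<beta>" c "1 / \<beta>"] assms by (simp add: epow_epow)
  then have "epow (epow (\<integral>\<^sup>+x. k x * epow (h x) \<beta> \<partial>M) (1 / \<beta>)) \<beta>
      \<le> epow (ennreal (c powr (1 / \<beta> - 1)) * (\<integral>\<^sup>+x. k x * h x \<partial>M)) \<beta>"
    using \<beta> by (intro epow_mono) auto
  moreover have "(1 / \<beta> - 1) * \<beta> = 1 - \<beta>" using \<beta> by (simp add: field_simps)
  ultimately show ?thesis using \<beta> by (simp add: epow_epow epow_mult powr_powr)
qed

text \<open>The solution bound \<open>duhamel 0 t f \<in> L\<^sup>q\<close> forces \<open>f \<ge> 0\<close> to be small on short
  time intervals away from \<open>\<tau>\<close>: there the kernel is comparable with that of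
  \<open>S(2s)\<close> applied to the Duhamel integral up to time \<open>\<tau> + s\<close>.\<close>

lemma kato_piece:
  fixes f :: "real \<Rightarrow> real ^ 'n \<Rightarrow> ennreal"
  assumes f: "case_prod f \<in> borel_measurable (borel \<Otimes>\<^sub>M borel)" and q: "1 \<le> q" and M: "0 \<le> M"
    and bd: "\<And>t. 0 \<le> t \<Longrightarrow> t \<le> T \<Longrightarrow> (\<integral>\<^sup>+x. epow (duhamel 0 t f x) q \<partial>lborel) \<le> ennreal (M powr q)"
    and \<tau>: "0 \<le> \<tau>" and s: "0 < s" "\<tau> + s \<le> T" and \<beta>: "0 < \<beta>" "\<beta> \<le> 1"
  shows "(\<integral>\<^sup>+t. indicator {\<tau> + s / 2<..\<tau> + s} t * nn_heat (2 * (t - \<tau>)) (\<lambda>z. epow (f t z) \<beta>) y \<partial>lborel)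
    \<le> ennreal (3 powr (real CARD('n) / 2 * \<beta>) * M powr \<beta> * s powr (1 - \<beta> - real CARD('n) * \<beta> / (2 * q)))"
proof -
  note [measurable (raw)] = measurable_nn_heat_uncurry[OF f] measurable_duhamel[OF f]
  have fm [measurable]: "f t \<in> borel_measurable borel" for t by (rule measurable_slice[OF f])
  define P where "P = {\<tau> + s / 2<..\<tau> + s}"
  have "(\<integral>\<^sup>+t. indicator P t * nn_heat (2 * (t - \<tau>)) (\<lambda>z. epow (f t z) \<beta>) y \<partial>lborel)
    \<le> (\<integral>\<^sup>+t. indicator P t * epow (nn_heat (2 * (t - \<tau>)) (f t) y) \<beta> \<partial>lborel)"
    using nn_heat_jensen_root[OF fm, of "1 / \<beta>"] \<beta> by (intro nn_integral_mono mult_left_mono) auto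
  also have "\<dots> \<le> ennreal (s powr (1 - \<beta>)) * epow (\<integral>\<^sup>+t. indicator P t * nn_heat (2 * (t - \<tau>)) (f t) y \<partial>lborel) \<beta>"
  proof (rule nn_integral_jensen_root[OF _ _ _ s(1) \<beta>])
    have "emeasure lborel P \<le> ennreal s"
      using s by (auto simp: P_def intro!: ennreal_leI)
    then show "(\<integral>\<^sup>+t. indicator P t \<partial>lborel) \<le> ennreal s"
      by (subst nn_integral_indicator) (auto simp: P_def)
  qed (auto simp: P_def)
  also have "(\<integral>\<^sup>+t. indicator P t * nn_heat (2 * (t - \<tau>)) (f t) y \<partial>lborel)
    \<le> (\<integral>\<^sup>+t. ennreal (3 powr (real CARD('n) / 2)) * (indicator {0..\<tau> + s} t * nn_heat (2 * s + (\<tau> + s - t)) (f t) y) \<partial>lborel)"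
  proof (intro nn_integral_mono)
    fix t
    show "indicator P t * nn_heat (2 * (t - \<tau>)) (f t) y
      \<le> ennreal (3 powr (real CARD('n) / 2)) * (indicator {0..\<tau> + s} t * nn_heat (2 * s + (\<tau> + s - t)) (f t) y)"
    proof (cases "t \<in> P")
      case True
      then have t: "\<tau> + s / 2 < t" "t \<le> \<tau> + s" by (auto simp: P_def)
      \<comment> \<open>With \<open>r = t - \<tau>\<close> in \<open>(s/2, s]\<close> the two times
        are \<open>2 r\<close> and \<open>3 s - r\<close>; their quotient lies between 1 and
        3.\<close>
      have "nn_heat (2 * (t - \<tau>)) (f t) y \<le> ennreal (3 powr (real CARD('n) / 2)) * nn_heat (2 * s + (\<tau> + s - t)) (f t) y"
        using t s by (intro nn_heat_ratio) auto
      then show ?thesis using True t s \<tau> by simp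
    qed simp
  qed
  also have "\<dots> = ennreal (3 powr (real CARD('n) / 2)) * nn_heat (2 * s) (duhamel 0 (\<tau> + s) f) y"
    using s by (simp add: nn_integral_cmult nn_heat_duhamel[OF f])
  also have "\<dots> \<le> ennreal (3 powr (real CARD('n) / 2)) * ennreal (s powr (- real CARD('n) / (2 * q)) * M)"
    using s \<tau> M q by (intro mult_left_mono nn_heat_smoothing_Lq bd) auto
  finally have "(\<integral>\<^sup>+t. indicator P t * nn_heat (2 * (t - \<tau>)) (\<lambda>z. epow (f t z) \<beta>) y \<partial>lborel)
     \<le> ennreal (s powr (1 - \<beta>)) * epow (ennreal (3 powr (real CARD('n) / 2)) * ennreal (s powr (- real CARD('n) / (2 * q)) * M)) \<beta>"
    using \<beta> by (auto simp: mult_left_mono epow_mono)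
  also have "\<dots> = ennreal (3 powr (real CARD('n) / 2 * \<beta>) * M powr \<beta> * s powr (1 - \<beta> - real CARD('n) * \<beta> / (2 * q)))"
  proof -
    have "s powr (1 - \<beta> - real CARD('n) * \<beta> / (2 * q)) = s powr (1 - \<beta>) * s powr (- real CARD('n) / (2 * q) * \<beta>)"
      by (simp add: powr_add[symmetric])
    then show ?thesis
      using M by (simp add: ennreal_mult[symmetric] powr_mult powr_powr mult_ac)
  qed
  finally show ?thesis unfolding P_def .
qed

lemma dyadic_cover:
  fixes \<delta> r :: real
  assumes "0 < r" "r \<le> \<delta>"
  obtains j where "\<delta> * (1 / 2) ^ Suc j < r" "r \<le> \<delta> * (1 / 2) ^ j"
proof -
  have "\<exists>n. (1 / 2 :: real) ^ n < r / \<delta>" using assms by (intro real_arch_pow_inv) auto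
  then obtain n where n: "\<delta> * (1 / 2) ^ n < r" using assms by (auto simp: field_simps)
  define k where "k = (LEAST n. \<delta> * (1 / 2) ^ n < r)"
  have k: "\<delta> * (1 / 2) ^ k < r" unfolding k_def using n by (rule LeastI)
  with assms have "k \<noteq> 0" by (auto intro: ccontr)
  then obtain j where j: "k = Suc j" by (auto simp: gr0_conv_Suc)
  then have "\<not> \<delta> * (1 / 2) ^ j < r" using not_less_Least[of j "\<lambda>n. \<delta> * (1 / 2) ^ n < r"] by (simp add: k_def)
  with k j show thesis by (intro that[of j]) auto
qed

text \<open>Summing \<open>kato_piece\<close> over dyadic distances from \<open>\<tau>\<close> gives
  a geometric series of ratio \<open>(1/2)^e\<close>. The exponent \<open>e\<close> balances the
  gain \<open>1 - \<beta>\<close> of Jensen in time against the loss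
  \<open>N \<beta> / (2 q)\<close> of smoothing; its positivity makes the series converge, and
  \<open>T^e\<close> makes the bound small for short times.\<close>

lemma kato_estimate:
  fixes f :: "real \<Rightarrow> real ^ 'n \<Rightarrow> ennreal" and q \<beta> :: real
  defines "C \<equiv> 2 powr (real CARD('n) / 2) * exp (2 * real CARD('n))"
  defines "e \<equiv> 1 - \<beta> - real CARD('n) * \<beta> / (2 * q)"
  assumes f: "case_prod f \<in> borel_measurable (borel \<Otimes>\<^sub>M borel)" and q: "1 \<le> q" and M: "0 \<le> M"
    and bd: "\<And>t. 0 \<le> t \<Longrightarrow> t \<le> T \<Longrightarrow> (\<integral>\<^sup>+x. epow (duhamel 0 t f x) q \<partial>lborel) \<le> ennreal (M powr q)"
    and \<tau>: "0 \<le> \<tau>" "\<tau> \<le> T" and T: "T \<le> 1" and \<beta>: "0 < \<beta>" "\<beta> \<le> 1" and e: "0 < e"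
  shows "(\<integral>\<^sup>+t. indicator {\<tau>..T} t * nn_heat (t - \<tau>) (\<lambda>z. ennreal (decay z) * epow (f t z) \<beta>) y \<partial>lborel)
    \<le> ennreal (C * (3 powr (real CARD('n) / 2 * \<beta>) * M powr \<beta> * (T powr e / (1 - (1 / 2) powr e)))) * ennreal (decay y)"
proof -
  define \<delta> where "\<delta> = T - \<tau>"
  have \<delta>: "0 \<le> \<delta>" "\<delta> \<le> T" using \<tau> by (auto simp: \<delta>_def)
  have feb: "case_prod (\<lambda>t z. epow (f t z) \<beta>) \<in> borel_measurable (borel \<Otimes>\<^sub>M borel)"
  proof -
    note [measurable (raw)] = measurable_uncurry[OF f]
    show ?thesis by measurable
  qed
  note [measurable (raw)] = measurable_nn_heat_uncurry[OF feb]
  \<comment> \<open>The doubled time is what \<open>nn_heat_decay_le\<close> charges for pulling the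
    weight out of the flow.\<close>
  define Y where "Y t = nn_heat (2 * (t - \<tau>)) (\<lambda>z. epow (f t z) \<beta>) y" for t
  have [measurable]: "Y \<in> borel_measurable borel" unfolding Y_def by measurable
  define s where "s j = \<delta> * (1 / 2) ^ j" for j :: nat
  define P where "P j = {\<tau> + s j / 2<..\<tau> + s j}" for j
  define K where "K = 3 powr (real CARD('n) / 2 * \<beta>) * M powr \<beta>"
  have K: "0 \<le> K" by (simp add: K_def)
  have C: "0 \<le> C" by (simp add: C_def)
  have piece: "(\<integral>\<^sup>+t. indicator (P j) t * Y t \<partial>lborel) \<le> ennreal (K * T powr e * ((1 / 2) powr e) ^ j)" for j
  proof (cases "\<delta> = 0")
    case True
    then show ?thesis by (simp add: P_def s_def)
  next
    case False
    have "(1 / 2 :: real) ^ j \<le> 1" by (simp add: power_le_one)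
    then have "s j \<le> \<delta>" unfolding s_def using \<delta>(1) by (rule mult_left_le)
    moreover have "0 < s j" using False \<delta>(1) by (simp add: s_def)
    ultimately have sj: "0 < s j" "\<tau> + s j \<le> T" by (auto simp: \<delta>_def)
    have "(\<integral>\<^sup>+t. indicator (P j) t * Y t \<partial>lborel) \<le> ennreal (K * s j powr e)"
      unfolding P_def Y_def K_def e_def using kato_piece[OF f q M bd \<tau>(1) sj \<beta>, of y] by simp
    also have "s j powr e = \<delta> powr e * ((1 / 2) powr e) ^ j"
      using \<delta> by (simp add: s_def powr_mult powr_realpow[symmetric] powr_powr mult_ac)
    also have "ennreal (K * (\<delta> powr e * ((1 / 2) powr e) ^ j)) \<le> ennreal (K * (T powr e * ((1 / 2) powr e) ^ j))"
      using \<delta> e K by (intro ennreal_leI mult_left_mono mult_right_mono powr_mono2) auto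
    finally show ?thesis by (simp add: mult_ac)
  qed
  have half: "(1 / 2 :: real) powr e < 1" using e powr_less_mono2[of e "1 / 2" 1] by simp
  have "(\<integral>\<^sup>+t. indicator {\<tau>..T} t * nn_heat (t - \<tau>) (\<lambda>z. ennreal (decay z) * epow (f t z) \<beta>) y \<partial>lborel)
    \<le> (\<integral>\<^sup>+t. ennreal C * ennreal (decay y) * (\<Sum>j. indicator (P j) t * Y t) \<partial>lborel)"
  proof (intro nn_integral_mono_AE)
    have "AE t in lborel. t \<noteq> \<tau>" by (rule AE_lborel_singleton)
    then show "AE t in lborel. indicator {\<tau>..T} t * nn_heat (t - \<tau>) (\<lambda>z. ennreal (decay z) * epow (f t z) \<beta>) y
      \<le> ennreal C * ennreal (decay y) * (\<Sum>j. indicator (P j) t * Y t)"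
    proof eventually_elim
      case (elim t)
      show ?case
      proof (cases "t \<in> {\<tau>..T}")
        case True
        then have t: "0 < t - \<tau>" "t - \<tau> \<le> \<delta>" "t - \<tau> \<le> 1" using elim T \<tau> by (auto simp: \<delta>_def)
        obtain j where "\<delta> * (1 / 2) ^ Suc j < t - \<tau>" "t - \<tau> \<le> \<delta> * (1 / 2) ^ j"
          using dyadic_cover[OF t(1,2)] .
        then have "t \<in> P j" by (auto simp: P_def s_def)
        then have Yle: "Y t \<le> (\<Sum>j. indicator (P j) t * Y t)"
          using sum_le_suminf[of "\<lambda>j. indicator (P j) t * Y t" "{j}"] by simp
        have "nn_heat (t - \<tau>) (\<lambda>z. ennreal (decay z) * epow (f t z) \<beta>) y \<le> ennreal C * ennreal (decay y) * Y t"
          unfolding C_def Y_def by (rule nn_heat_decay_le[OF measurable_slice[OF feb] t(1,3)])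
        also have "\<dots> \<le> ennreal C * ennreal (decay y) * (\<Sum>j. indicator (P j) t * Y t)"
          using Yle by (rule mult_left_mono) simp
        finally show ?thesis using True by simp
      qed simp
    qed
  qed
  also have "\<dots> = ennreal C * ennreal (decay y) * (\<integral>\<^sup>+t. (\<Sum>j. indicator (P j) t * Y t) \<partial>lborel)"
    by (rule nn_integral_cmult) (simp add: P_def)
  also have "(\<integral>\<^sup>+t. (\<Sum>j. indicator (P j) t * Y t) \<partial>lborel) = (\<Sum>j. \<integral>\<^sup>+t. indicator (P j) t * Y t \<partial>lborel)"
    by (rule nn_integral_suminf) (simp add: P_def)
  also have "\<dots> \<le> (\<Sum>j. ennreal (K * T powr e * ((1 / 2) powr e) ^ j))"
    by (intro suminf_le piece) auto
  also have "\<dots> = ennreal (\<Sum>j. K * T powr e * ((1 / 2) powr e) ^ j)"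
    using half K by (intro suminf_ennreal2) (auto intro!: summable_mult summable_geometric)
  also have "(\<Sum>j. K * T powr e * ((1 / 2) powr e) ^ j) = K * (T powr e / (1 - (1 / 2) powr e))"
    using half by (subst suminf_mult) (auto intro!: summable_geometric simp: suminf_geometric)
  finally have "(\<integral>\<^sup>+t. indicator {\<tau>..T} t * nn_heat (t - \<tau>) (\<lambda>z. ennreal (decay z) * epow (f t z) \<beta>) y \<partial>lborel)
      \<le> ennreal C * ennreal (decay y) * ennreal (K * (T powr e / (1 - (1 / 2) powr e)))"
    by (simp add: mult_left_mono)
  also have "\<dots> = ennreal (C * (K * (T powr e / (1 - (1 / 2) powr e)))) * ennreal (decay y)"
    using C K half by (simp add: ennreal_mult[symmetric] mult_ac)
  finally show ?thesis unfolding K_def .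
qed

lemma measurable_fst_lborel [measurable]: "fst \<in> borel_measurable (lborel \<Otimes>\<^sub>M M)"
  using measurable_fst[of lborel M] by simp

lemma measurable_snd_lborel [measurable]: "snd \<in> borel_measurable (M \<Otimes>\<^sub>M lborel)"
  using measurable_snd[of M lborel] by simp

text \<open>Testing \<open>z \<le> duhamel 0 t (W z)\<close> against \<open>decay \<cdot> W\<close> and exchanging the order
  of integration, the Kato smallness of \<open>W\<close> gives \<open>J \<le> J / 2\<close> for the finite
  quantity \<open>J = \<integral>\<integral> decay W z\<close>.\<close>

lemma duhamel_gronwall_zero:
  fixes z W :: "real \<Rightarrow> real ^ 'n \<Rightarrow> ennreal"
  assumes z: "case_prod z \<in> borel_measurable (borel \<Otimes>\<^sub>M borel)"
    and W: "case_prod W \<in> borel_measurable (borel \<Otimes>\<^sub>M borel)"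
    and kato: "\<And>\<tau> y. 0 \<le> \<tau> \<Longrightarrow> \<tau> \<le> T \<Longrightarrow>
      (\<integral>\<^sup>+t. indicator {\<tau>..T} t * nn_heat (t - \<tau>) (\<lambda>x. ennreal (decay x) * W t x) y \<partial>lborel) \<le> ennreal (1 / 2) * ennreal (decay y)"
    and le: "\<And>t. 0 \<le> t \<Longrightarrow> t \<le> T \<Longrightarrow> AE x in lborel. z t x \<le> duhamel 0 t (\<lambda>\<tau> y. W \<tau> y * z \<tau> y) x"
    and fin: "(\<integral>\<^sup>+t. indicator {0..T} t * (\<integral>\<^sup>+x. ennreal (decay x) * (W t x * z t x) \<partial>lborel) \<partial>lborel) < top"
    and t: "0 \<le> t" "t \<le> T"
  shows "AE x in lborel. z t x = 0"
proof -
  define F where "F \<tau> y = W \<tau> y * z \<tau> y" for \<tau> y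
  have F: "case_prod F \<in> borel_measurable (borel \<Otimes>\<^sub>M borel)"
  proof -
    note [measurable (raw)] = measurable_uncurry[OF z] measurable_uncurry[OF W]
    show ?thesis unfolding F_def by measurable
  qed
  define G where "G t x = ennreal (decay x) * W t x" for t x
  have G: "case_prod G \<in> borel_measurable (borel \<Otimes>\<^sub>M borel)"
  proof -
    note [measurable (raw)] = measurable_uncurry[OF W]
    show ?thesis unfolding G_def by measurable
  qed
  note [measurable (raw)] = measurable_uncurry[OF F] measurable_uncurry[OF G]
    measurable_nn_heat_uncurry[OF F] measurable_nn_heat_uncurry[OF G] measurable_duhamel[OF F]
    measurable_uncurry[OF z]
  note [simp] = measurable_slice[OF F] measurable_slice[OF G]
  define J where "J = (\<integral>\<^sup>+t. indicator {0..T} t * (\<integral>\<^sup>+x. ennreal (decay x) * F t x \<partial>lborel) \<partial>lborel)"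
  have ind: "indicator {a..b} s = (if a \<le> s \<and> s \<le> b then 1 else 0 :: ennreal)" for a b s :: real
    by (simp add: indicator_def)
  have "J \<le> (\<integral>\<^sup>+t. indicator {0..T} t * (\<integral>\<^sup>+x. G t x * duhamel 0 t F x \<partial>lborel) \<partial>lborel)"
    unfolding J_def
  proof (intro nn_integral_mono)
    fix t
    have "(\<integral>\<^sup>+x. ennreal (decay x) * F t x \<partial>lborel) \<le> (\<integral>\<^sup>+x. G t x * duhamel 0 t F x \<partial>lborel)" if "0 \<le> t" "t \<le> T"
    proof (intro nn_integral_mono_AE)
      show "AE x in lborel. ennreal (decay x) * F t x \<le> G t x * duhamel 0 t F x"
        using le[OF that] by eventually_elim (auto simp: F_def[abs_def] G_def mult.assoc intro!: mult_left_mono)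
    qed
    then show "indicator {0..T} t * (\<integral>\<^sup>+x. ennreal (decay x) * F t x \<partial>lborel)
        \<le> indicator {0..T} t * (\<integral>\<^sup>+x. G t x * duhamel 0 t F x \<partial>lborel)"
      by (auto simp: indicator_def)
  qed
  also have "\<dots> = (\<integral>\<^sup>+t. indicator {0..T} t * (\<integral>\<^sup>+x. \<integral>\<^sup>+\<tau>. indicator {0..t} \<tau> * (nn_heat (t - \<tau>) (F \<tau>) x * G t x) \<partial>lborel \<partial>lborel) \<partial>lborel)"
    unfolding duhamel_def ind by (simp add: nn_integral_cmult[symmetric] mult_ac)
  also have "\<dots> = (\<integral>\<^sup>+t. indicator {0..T} t * (\<integral>\<^sup>+\<tau>. \<integral>\<^sup>+x. indicator {0..t} \<tau> * (nn_heat (t - \<tau>) (F \<tau>) x * G t x) \<partial>lborel \<partial>lborel) \<partial>lborel)"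
  proof -
    have "(\<integral>\<^sup>+x. \<integral>\<^sup>+\<tau>. indicator {0..t} \<tau> * (nn_heat (t - \<tau>) (F \<tau>) x * G t x) \<partial>lborel \<partial>lborel)
      = (\<integral>\<^sup>+\<tau>. \<integral>\<^sup>+x. indicator {0..t} \<tau> * (nn_heat (t - \<tau>) (F \<tau>) x * G t x) \<partial>lborel \<partial>lborel)" for t
      unfolding ind by (rule lborel_pair.Fubini') measurable
    then show ?thesis by simp
  qed
  also have "\<dots> = (\<integral>\<^sup>+t. indicator {0..T} t * (\<integral>\<^sup>+\<tau>. indicator {0..t} \<tau> * (\<integral>\<^sup>+x. F \<tau> x * nn_heat (t - \<tau>) (G t) x \<partial>lborel) \<partial>lborel) \<partial>lborel)"
    unfolding ind by (simp add: nn_integral_cmult nn_heat_symmetric)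
  \<comment> \<open>The triangle \<open>0 \<le> \<tau> \<le> t \<le> T\<close> is described with
    \<open>\<tau>\<close> as the outer variable, in preparation for the exchange. By symmetry the
    flow already acts on \<open>G t\<close>, that is on the weight times \<open>W\<close>, where the
    Kato bound applies.\<close>
  also have "\<dots> = (\<integral>\<^sup>+t. \<integral>\<^sup>+\<tau>. indicator {0..T} \<tau> * (indicator {\<tau>..T} t * (\<integral>\<^sup>+x. F \<tau> x * nn_heat (t - \<tau>) (G t) x \<partial>lborel)) \<partial>lborel \<partial>lborel)"
    unfolding ind by (subst nn_integral_cmult[symmetric]) (measurable, auto intro!: nn_integral_cong)
  also have "\<dots> = (\<integral>\<^sup>+\<tau>. \<integral>\<^sup>+t. indicator {0..T} \<tau> * (indicator {\<tau>..T} t * (\<integral>\<^sup>+x. F \<tau> x * nn_heat (t - \<tau>) (G t) x \<partial>lborel)) \<partial>lborel \<partial>lborel)"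
    unfolding ind by (rule lborel_pair.Fubini') measurable
  also have "\<dots> = (\<integral>\<^sup>+\<tau>. indicator {0..T} \<tau> * (\<integral>\<^sup>+t. \<integral>\<^sup>+x. F \<tau> x * (indicator {\<tau>..T} t * nn_heat (t - \<tau>) (G t) x) \<partial>lborel \<partial>lborel) \<partial>lborel)"
    unfolding ind by (simp add: nn_integral_cmult[symmetric] mult_ac)
  also have "\<dots> = (\<integral>\<^sup>+\<tau>. indicator {0..T} \<tau> * (\<integral>\<^sup>+x. \<integral>\<^sup>+t. F \<tau> x * (indicator {\<tau>..T} t * nn_heat (t - \<tau>) (G t) x) \<partial>lborel \<partial>lborel) \<partial>lborel)"
    unfolding ind by (intro nn_integral_cong arg_cong2[where f = "(*)"] refl lborel_pair.Fubini') measurable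
  also have "\<dots> = (\<integral>\<^sup>+\<tau>. indicator {0..T} \<tau> * (\<integral>\<^sup>+x. F \<tau> x * (\<integral>\<^sup>+t. indicator {\<tau>..T} t * nn_heat (t - \<tau>) (G t) x \<partial>lborel) \<partial>lborel) \<partial>lborel)"
    unfolding ind by (simp add: nn_integral_cmult)
  also have "\<dots> \<le> (\<integral>\<^sup>+\<tau>. indicator {0..T} \<tau> * (\<integral>\<^sup>+x. F \<tau> x * (ennreal (1 / 2) * ennreal (decay x)) \<partial>lborel) \<partial>lborel)"
    using kato by (intro nn_integral_mono) (auto simp: indicator_def[of "{0..T}"] G_def[abs_def] intro!: mult_left_mono nn_integral_mono)
  also have "\<dots> = ennreal (1 / 2) * J"
    unfolding J_def ind by (simp add: nn_integral_cmult[symmetric] mult_ac)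
  finally have half: "J \<le> ennreal (1 / 2) * J" .
  \<comment> \<open>The finiteness assumption enters only here: it permits absorbing half of
    \<open>J\<close>.\<close>
  have "J = 0"
  proof -
    have "J < top" using fin by (simp add: J_def F_def)
    then obtain r where r: "J = ennreal r" "0 \<le> r" by (cases J) auto
    with half have "r \<le> (1 / 2) * r" by (simp add: ennreal_mult[symmetric] del: ennreal_half)
    with r show ?thesis by simp
  qed
  then have "AE s in lborel. indicator {0..T} s * (\<integral>\<^sup>+x. ennreal (decay x) * F s x \<partial>lborel) = 0"
    unfolding J_def ind by (subst (asm) nn_integral_0_iff_AE) auto
  then have AE0: "AE s in lborel. s \<in> {0..T} \<longrightarrow> (AE x in lborel. F s x = 0)"
  proof eventually_elim
    case (elim s)
    show ?case
    proof
      assume "s \<in> {0..T}"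
      with elim have "(\<integral>\<^sup>+x. ennreal (decay x) * F s x \<partial>lborel) = 0" by simp
      then have "AE x in lborel. ennreal (decay x) * F s x = 0"
        by (subst (asm) nn_integral_0_iff_AE) auto
      then show "AE x in lborel. F s x = 0"
        by eventually_elim (metis decay_pos ennreal_eq_0_iff mult_eq_0_iff not_le)
    qed
  qed
  \<comment> \<open>\<open>J = 0\<close> only says that \<open>W z\<close> vanishes almost
    everywhere; \<open>z\<close> could still live where \<open>W = 0\<close>. Its own inequality, at
    the given time \<open>t\<close>, excludes this.\<close>
  have "duhamel 0 t F x = 0" for x
  proof -
    have "AE s in lborel. s \<noteq> t" by (rule AE_lborel_singleton)
    with AE0 have "AE s in lborel. indicator {0..t} s * nn_heat (t - s) (F s) x = 0"
    proof eventually_elim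
      case (elim s)
      show ?case
      proof (cases "s \<in> {0..t}")
        case True
        with elim t have "nn_heat (t - s) (F s) x = nn_heat (t - s) (\<lambda>_. 0) x"
          by (intro nn_heat_cong_AE) auto
        then show ?thesis by (simp add: nn_heat_const)
      qed simp
    qed
    then have "duhamel 0 t F x = (\<integral>\<^sup>+s. 0 \<partial>(lborel :: real measure))"
      unfolding duhamel_def by (intro nn_integral_cong_AE)
    then show ?thesis by simp
  qed
  then have eq: "duhamel 0 t (\<lambda>\<tau> y. W \<tau> y * z \<tau> y) x = 0" for x
    by (simp add: F_def[abs_def])
  show ?thesis using le[OF t] by (simp add: eq)
qed

text \<open>By \<open>decay_le_nn_heat\<close> the weight is at most a multiple of its flow over
  \<open>T - t\<close>. Moving that flow onto \<open>f t\<close> assembles the Duhamel integral at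
  the final time, whose weighted integral is controlled by its \<open>L^q\<close> bound and the
  finite mass of the weight.\<close>

lemma duhamel_decay_finite:
  fixes f :: "real \<Rightarrow> real ^ 'n \<Rightarrow> ennreal"
  assumes f: "case_prod f \<in> borel_measurable (borel \<Otimes>\<^sub>M borel)" and q: "1 \<le> q" and T: "T \<le> 1" and M: "M < top"
    and bd: "(\<integral>\<^sup>+x. epow (duhamel 0 T f x) q \<partial>lborel) \<le> M"
  shows "(\<integral>\<^sup>+t. indicator {0..T} t * (\<integral>\<^sup>+x. ennreal (decay x) * f t x \<partial>lborel) \<partial>lborel) < top"
proof -
  note [measurable (raw)] = measurable_uncurry[OF f] measurable_nn_heat_uncurry[OF f] measurable_duhamel[OF f]
  note [simp] = measurable_slice[OF f]
  have ind: "indicator {a..b} s = (if a \<le> s \<and> s \<le> b then 1 else 0 :: ennreal)" for a b s :: real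
    by (simp add: indicator_def)
  define c where "c = exp (- real CARD('n)) * 2 powr (- real CARD('n) / 2)"
  have c: "0 < c" by (simp add: c_def)
  have low: "ennreal c * ennreal (decay x) \<le> nn_heat s (\<lambda>z. ennreal (decay z)) (x :: real ^ 'n)"
    if "0 \<le> s" "s \<le> 1" for s x
    unfolding c_def by (rule decay_le_nn_heat[OF that])
  have "ennreal c * (\<integral>\<^sup>+t. indicator {0..T} t * (\<integral>\<^sup>+x. ennreal (decay x) * f t x \<partial>lborel) \<partial>lborel)
    = (\<integral>\<^sup>+t. indicator {0..T} t * (\<integral>\<^sup>+x. f t x * (ennreal c * ennreal (decay x)) \<partial>lborel) \<partial>lborel)"
  proof -
    have "(\<integral>\<^sup>+x. f t x * (ennreal c * ennreal (decay x)) \<partial>lborel) = ennreal c * (\<integral>\<^sup>+x. ennreal (decay x) * f t x \<partial>lborel)" for t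
      by (subst nn_integral_cmult[symmetric]) (auto simp: mult_ac)
    moreover have "(\<lambda>t. (if 0 \<le> t \<and> t \<le> T then 1 else 0) * (\<integral>\<^sup>+x. ennreal (decay x) * f t x \<partial>lborel)) \<in> borel_measurable borel"
      by measurable
    ultimately show ?thesis
      unfolding ind by (subst nn_integral_cmult[symmetric]) (auto simp: mult_ac)
  qed
  also have "\<dots> \<le> (\<integral>\<^sup>+t. indicator {0..T} t * (\<integral>\<^sup>+x. f t x * nn_heat (T - t) (\<lambda>z. ennreal (decay z)) x \<partial>lborel) \<partial>lborel)"
    using T
    by (intro nn_integral_mono) (auto simp: indicator_def intro!: nn_integral_mono mult_left_mono low)
  also have "\<dots> = (\<integral>\<^sup>+t. indicator {0..T} t * (\<integral>\<^sup>+x. nn_heat (T - t) (f t) x * ennreal (decay x) \<partial>lborel) \<partial>lborel)"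
    by (simp add: nn_heat_symmetric)
  also have "\<dots> = (\<integral>\<^sup>+t. \<integral>\<^sup>+x. (indicator {0..T} t * nn_heat (T - t) (f t) x) * ennreal (decay x) \<partial>lborel \<partial>lborel)"
    unfolding ind by (simp add: nn_integral_cmult[symmetric] mult_ac)
  also have "\<dots> = (\<integral>\<^sup>+x. \<integral>\<^sup>+t. (indicator {0..T} t * nn_heat (T - t) (f t) x) * ennreal (decay x) \<partial>lborel \<partial>lborel)"
    unfolding ind by (rule lborel_pair.Fubini') measurable
  also have "\<dots> = (\<integral>\<^sup>+x. duhamel 0 T f x * ennreal (decay x) \<partial>lborel)"
    unfolding duhamel_def ind by (simp add: nn_integral_multc)
  also have "\<dots> \<le> (\<integral>\<^sup>+x. ennreal (decay x) + epow (duhamel 0 T f x) q \<partial>lborel)"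
  proof (intro nn_integral_mono)
    fix x
    have "duhamel 0 T f x * ennreal (decay x) \<le> (1 + epow (duhamel 0 T f x) q) * ennreal (decay x)"
      using q by (intro mult_right_mono epow_le_1_plus) auto
    also have "\<dots> = ennreal (decay x) + epow (duhamel 0 T f x) q * ennreal (decay x)"
      by (simp add: distrib_right)
    also have "epow (duhamel 0 T f x) q * ennreal (decay x) \<le> epow (duhamel 0 T f x) q * 1"
      using decay_le_1 by (intro mult_left_mono) (auto simp: ennreal_le_1)
    finally show "duhamel 0 T f x * ennreal (decay x) \<le> ennreal (decay x) + epow (duhamel 0 T f x) q"
      by (simp add: add_left_mono)
  qed
  also have "\<dots> = (\<integral>\<^sup>+x. ennreal (decay (x :: real ^ 'n)) \<partial>lborel) + (\<integral>\<^sup>+x. epow (duhamel 0 T f x) q \<partial>lborel)"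
    by (rule nn_integral_add) measurable
  also have "\<dots> < top"
    using nn_integral_decay[where 'n = 'n] order.strict_trans1[OF bd M] by simp
  finally show ?thesis using c by (auto simp: ennreal_mult_less_top)
qed

section \<open>Duhamel integrals as iterated Bochner integrals\<close>

text \<open>Direction used for existence: a finite Duhamel integral of a jointly measurable function
  supplies every convergence requirement of a mild solution.\<close>

lemma duhamel_set_integral:
  fixes F :: "real \<Rightarrow> real ^ 'n \<Rightarrow> real"
  assumes F: "case_prod F \<in> borel_measurable (borel \<Otimes>\<^sub>M borel)" and nn: "\<And>\<tau> y. 0 \<le> F \<tau> y"
    and fin: "duhamel 0 t (\<lambda>\<tau> y. ennreal (F \<tau> y)) x < top"
  shows "AE \<tau> in lborel. \<tau> \<in> {0..t} \<longrightarrow> heat_semigroup_defined (t - \<tau>) (F \<tau>) x"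
    and "set_integrable lborel {0..t} (\<lambda>\<tau>. heat_semigroup (t - \<tau>) (F \<tau>) x)"
    and "(LINT \<tau>:{0..t}|lborel. heat_semigroup (t - \<tau>) (F \<tau>) x) = enn2real (duhamel 0 t (\<lambda>\<tau> y. ennreal (F \<tau> y)) x)"
proof -
  have Fe: "case_prod (\<lambda>\<tau> y. ennreal (F \<tau> y)) \<in> borel_measurable (borel \<Otimes>\<^sub>M borel)"
  proof -
    note [measurable (raw)] = measurable_uncurry[OF F]
    show ?thesis by measurable
  qed
  note [measurable (raw)] = measurable_nn_heat_uncurry[OF Fe]
  define n where "n \<tau> = indicator {0..t} \<tau> * nn_heat (t - \<tau>) (\<lambda>y. ennreal (F \<tau> y)) x" for \<tau>
  have [measurable]: "n \<in> borel_measurable borel" unfolding n_def by measurable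
  have int: "(\<integral>\<^sup>+\<tau>. n \<tau> \<partial>lborel) < top" using fin by (simp add: n_def duhamel_def)
  then have "(\<integral>\<^sup>+\<tau>. n \<tau> \<partial>lborel) \<noteq> \<infinity>" by simp
  then have "AE \<tau> in lborel. n \<tau> \<noteq> \<infinity>" by (rule nn_integral_PInf_AE[rotated]) simp
  then have AE: "AE \<tau> in lborel. n \<tau> < top" by eventually_elim (simp add: less_top)
  then show "AE \<tau> in lborel. \<tau> \<in> {0..t} \<longrightarrow> heat_semigroup_defined (t - \<tau>) (F \<tau>) x"
  proof eventually_elim
    case (elim \<tau>)
    show ?case
    proof
      assume \<tau>: "\<tau> \<in> {0..t}"
      show "heat_semigroup_defined (t - \<tau>) (F \<tau>) x"
      proof (cases "\<tau> = t")
        case False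
        then show ?thesis
          using \<tau> elim nn by (subst heat_semigroup_defined_iff) (auto simp: n_def measurable_slice[OF F])
      qed (simp add: heat_semigroup_defined_def)
    qed
  qed
  have hs: "indicator {0..t} \<tau> * heat_semigroup (t - \<tau>) (F \<tau>) x = enn2real (n \<tau>)" for \<tau>
  proof (cases "\<tau> \<in> {0..t}")
    case True
    then show ?thesis
      by (simp add: n_def heat_semigroup_nonneg[OF measurable_slice[OF F] _ nn])
  qed (simp add: n_def)
  have eq: "(\<integral>\<^sup>+\<tau>. ennreal (enn2real (n \<tau>)) \<partial>lborel) = duhamel 0 t (\<lambda>\<tau> y. ennreal (F \<tau> y)) x"
    unfolding duhamel_def n_def[symmetric] using AE by (intro nn_integral_cong_AE) auto
  show "set_integrable lborel {0..t} (\<lambda>\<tau>. heat_semigroup (t - \<tau>) (F \<tau>) x)"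
    unfolding set_integrable_def using fin by (simp add: hs eq integrable_iff_bounded)
  have "(LINT \<tau>:{0..t}|lborel. heat_semigroup (t - \<tau>) (F \<tau>) x) = (LINT \<tau>|lborel. enn2real (n \<tau>))"
    unfolding set_lebesgue_integral_def by (simp add: hs)
  also have "\<dots> = enn2real (duhamel 0 t (\<lambda>\<tau> y. ennreal (F \<tau> y)) x)"
    unfolding eq[symmetric] by (rule integral_eq_nn_integral) auto
  finally show "(LINT \<tau>:{0..t}|lborel. heat_semigroup (t - \<tau>) (F \<tau>) x) = enn2real (duhamel 0 t (\<lambda>\<tau> y. ennreal (F \<tau> y)) x)" .
qed

text \<open>Direction used for uniqueness: for an arbitrary solution \<open>F\<close> is measurable
  only at each fixed time, so a jointly measurable \<open>F'\<close> takes its place. The flow over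
  positive times does not see the difference, and the endpoint \<open>\<tau> = t\<close> is
  negligible.\<close>

lemma set_integral_eq_duhamel:
  fixes F F' :: "real \<Rightarrow> real ^ 'n \<Rightarrow> real"
  assumes F': "case_prod F' \<in> borel_measurable (borel \<Otimes>\<^sub>M borel)"
    and F: "\<And>\<tau>. \<tau> \<in> {0..t} \<Longrightarrow> F \<tau> \<in> borel_measurable borel" and nn: "\<And>\<tau> y. 0 \<le> F \<tau> y"
    and eq: "\<And>\<tau>. \<tau> \<in> {0..t} \<Longrightarrow> AE y in lborel. F' \<tau> y = F \<tau> y"
    and def: "AE \<tau> in lborel. \<tau> \<in> {0..t} \<longrightarrow> heat_semigroup_defined (t - \<tau>) (F \<tau>) x"
    and int: "set_integrable lborel {0..t} (\<lambda>\<tau>. heat_semigroup (t - \<tau>) (F \<tau>) x)"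
  shows "duhamel 0 t (\<lambda>\<tau> y. ennreal (F' \<tau> y)) x < top"
    and "(LINT \<tau>:{0..t}|lborel. heat_semigroup (t - \<tau>) (F \<tau>) x) = enn2real (duhamel 0 t (\<lambda>\<tau> y. ennreal (F' \<tau> y)) x)"
proof -
  define g where "g \<tau> = indicator {0..t} \<tau> * heat_semigroup (t - \<tau>) (F \<tau>) x" for \<tau>
  have ig: "integrable lborel g" using int by (simp add: set_integrable_def g_def[abs_def])
  have g0: "0 \<le> g \<tau>" for \<tau>
    using F[of \<tau>] nn by (auto simp: g_def indicator_def heat_semigroup_nonneg)
  have "AE \<tau> in lborel. \<tau> \<noteq> t" by (rule AE_lborel_singleton)
  with def have AE: "AE \<tau> in lborel. indicator {0..t} \<tau> * nn_heat (t - \<tau>) (\<lambda>y. ennreal (F' \<tau> y)) x = ennreal (g \<tau>)"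
  proof eventually_elim
    case (elim \<tau>)
    show ?case
    proof (cases "\<tau> \<in> {0..t}")
      case True
      with elim have t: "0 < t - \<tau>" by auto
      have "nn_heat (t - \<tau>) (\<lambda>y. ennreal (F' \<tau> y)) x = nn_heat (t - \<tau>) (\<lambda>y. ennreal (F \<tau> y)) x"
        using eq[OF True] t by (intro nn_heat_cong_AE) auto
      moreover have "nn_heat (t - \<tau>) (\<lambda>y. ennreal (F \<tau> y)) x < top"
        using elim True t nn heat_semigroup_defined_iff[OF F[OF True] t, of x] by simp
      ultimately show ?thesis
        using True t by (simp add: g_def heat_semigroup_nonneg[OF F[OF True] _ nn])
    qed (simp add: g_def)
  qed
  then have duh: "duhamel 0 t (\<lambda>\<tau> y. ennreal (F' \<tau> y)) x = (\<integral>\<^sup>+\<tau>. ennreal (g \<tau>) \<partial>lborel)"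
    unfolding duhamel_def by (rule nn_integral_cong_AE)
  then show "duhamel 0 t (\<lambda>\<tau> y. ennreal (F' \<tau> y)) x < top"
    using ig g0 by (simp add: integrable_iff_bounded)
  have "(LINT \<tau>:{0..t}|lborel. heat_semigroup (t - \<tau>) (F \<tau>) x) = (LINT \<tau>|lborel. g \<tau>)"
    by (simp add: set_lebesgue_integral_def g_def)
  also have "\<dots> = enn2real (\<integral>\<^sup>+\<tau>. ennreal (g \<tau>) \<partial>lborel)"
    using ig g0 by (intro integral_eq_nn_integral) auto
  finally show "(LINT \<tau>:{0..t}|lborel. heat_semigroup (t - \<tau>) (F \<tau>) x) = enn2real (duhamel 0 t (\<lambda>\<tau> y. ennreal (F' \<tau> y)) x)"
    by (simp add: duh)
qed

text \<open>Only the positive parts of \<open>u0\<close> and \<open>w\<close> contribute, as \<open>ennreal\<close> truncates negative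
  numbers to 0.\<close>

definition linear_part :: "real \<Rightarrow> (real ^ 'n \<Rightarrow> real) \<Rightarrow> (real ^ 'n \<Rightarrow> real) \<Rightarrow> real \<Rightarrow> real ^ 'n \<Rightarrow> ennreal" where
  "linear_part \<rho> u0 w t x = nn_heat t (\<lambda>y. ennreal (u0 y)) x
     + duhamel 0 t (\<lambda>\<tau> y. ennreal (\<tau> powr \<rho> * w y)) x"

definition linear_flow :: "real \<Rightarrow> (real ^ 'n \<Rightarrow> real) \<Rightarrow> (real ^ 'n \<Rightarrow> real) \<Rightarrow> real \<Rightarrow> real ^ 'n \<Rightarrow> real" where
  "linear_flow \<rho> u0 w t x = enn2real (linear_part \<rho> u0 w t x)
     - enn2real (linear_part \<rho> (\<lambda>y. - u0 y) (\<lambda>y. - w y) t x)"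

section \<open>Estimates for the linear evolution of the data\<close>

lemma measurable_powr_times:
  assumes [measurable]: "(w :: real ^ 'n \<Rightarrow> real) \<in> borel_measurable borel"
  shows "case_prod (\<lambda>\<tau> y. \<tau> powr \<rho> * w y) \<in> borel_measurable (borel \<Otimes>\<^sub>M borel)"
    and "case_prod (\<lambda>\<tau> y. ennreal (\<tau> powr \<rho> * w y)) \<in> borel_measurable (borel \<Otimes>\<^sub>M borel)"
  by measurable

lemma measurable_linear_part:
  fixes u0 w :: "real ^ 'n \<Rightarrow> real"
  assumes [measurable]: "u0 \<in> borel_measurable borel" "w \<in> borel_measurable borel"
  shows "case_prod (linear_part \<rho> u0 w) \<in> borel_measurable (borel \<Otimes>\<^sub>M borel)"
proof -
  note [measurable (raw)] = measurable_duhamel[OF measurable_powr_times(2)[OF assms(2)]]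
  have "(\<lambda>z. linear_part \<rho> u0 w (fst z) (snd z)) \<in> borel_measurable (borel \<Otimes>\<^sub>M borel)"
    unfolding linear_part_def by measurable
  then show ?thesis by (simp add: split_beta')
qed

lemma measurable_linear_flow:
  fixes u0 w :: "real ^ 'n \<Rightarrow> real"
  assumes [measurable]: "u0 \<in> borel_measurable borel" "w \<in> borel_measurable borel"
  shows "case_prod (linear_flow \<rho> u0 w) \<in> borel_measurable (borel \<Otimes>\<^sub>M borel)"
proof -
  have m: "(\<lambda>y. - u0 y) \<in> borel_measurable borel" "(\<lambda>y. - w y) \<in> borel_measurable borel" by measurable
  note [measurable (raw)] = measurable_uncurry[OF measurable_linear_part[OF assms]]
    measurable_uncurry[OF measurable_linear_part[OF m]]
  have "(\<lambda>z. linear_flow \<rho> u0 w (fst z) (snd z)) \<in> borel_measurable (borel \<Otimes>\<^sub>M borel)"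
    unfolding linear_flow_def by measurable
  then show ?thesis by (simp add: split_beta')
qed

lemma linear_part_le:
  "linear_part \<rho> u0 w t x \<le> linear_majorant \<rho> u0 w t x"
  "linear_part \<rho> (\<lambda>y. - u0 y) (\<lambda>y. - w y) t x \<le> linear_majorant \<rho> u0 w t x"
  unfolding linear_part_def linear_majorant_def
  by (intro add_mono nn_heat_mono duhamel_mono ennreal_leI mult_left_mono; simp)+

text \<open>The flow is a difference of two numbers between 0 and the majorant, so a single copy of
  the majorant bounds it.\<close>

lemma linear_flow_le: "ennreal \<bar>linear_flow \<rho> u0 w t x\<bar> \<le> linear_majorant \<rho> u0 w t x"
proof (cases "linear_majorant \<rho> u0 w t x = top")
  case False
  let ?a = "linear_part \<rho> u0 w t x" and ?b = "linear_part \<rho> (\<lambda>y. - u0 y) (\<lambda>y. - w y) t x"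
  have fin: "linear_majorant \<rho> u0 w t x < top" using False by (simp add: less_top)
  have "?a < top" "?b < top"
    using linear_part_le[of \<rho> u0 w t x] fin by (auto intro: le_less_trans)
  moreover have "?a \<le> ?b + linear_majorant \<rho> u0 w t x" "?b \<le> ?a + linear_majorant \<rho> u0 w t x"
    using linear_part_le[of \<rho> u0 w t x] by (auto intro: order_trans add_increasing)
  ultimately show ?thesis
    unfolding linear_flow_def by (intro ennreal_abs_enn2real_diff_le)
qed simp

lemma linear_flow_eq:
  fixes u0 w :: "real ^ 'n \<Rightarrow> real"
  assumes u0: "u0 \<in> Lq q" and w: "w \<in> Lq q" and q: "1 \<le> q" and t: "0 \<le> t"
    and fin: "linear_majorant \<rho> u0 w t x < top"
  shows "set_integrable lborel {0..t} (\<lambda>\<tau>. \<tau> powr \<rho> * heat_semigroup (t - \<tau>) w x)"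
    and "linear_flow \<rho> u0 w t x = heat_semigroup t u0 x
      + (LINT \<tau>:{0..t}|lborel. \<tau> powr \<rho> * heat_semigroup (t - \<tau>) w x)"
proof -
  note [measurable] = Lq_measurable[OF u0] Lq_measurable[OF w]
  \<comment> \<open>\<open>duhamel_set_integral\<close> asks for nonnegative functions. After
    truncation by \<open>ennreal\<close>, \<open>wp\<close> and \<open>wm\<close> agree with
    \<open>w\<close> and \<open>- w\<close>, so their Duhamel integrals are the ones in
    \<open>linear_part\<close>.\<close>
  define wp wm where "wp y = max 0 (w y)" and "wm y = max 0 (- w y)" for y
  have [measurable]: "wp \<in> borel_measurable borel" "wm \<in> borel_measurable borel"
    unfolding wp_def[abs_def] wm_def[abs_def] by measurable
  have L: "wp \<in> Lq q" "wm \<in> Lq q"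
    using q by (auto intro!: Lq_mono(1)[OF _ w] simp: wp_def wm_def)
  have fins: "nn_heat t (\<lambda>y. ennreal \<bar>u0 y\<bar>) x < top" "duhamel 0 t (\<lambda>\<tau> y. ennreal (\<tau> powr \<rho> * \<bar>w y\<bar>)) x < top"
    using fin by (auto simp: linear_majorant_def)
  have eqs: "ennreal (\<tau> powr \<rho> * wp y) = ennreal (\<tau> powr \<rho> * w y)"
    "ennreal (\<tau> powr \<rho> * wm y) = ennreal (\<tau> powr \<rho> * - w y)" for \<tau> y
    by (simp_all only: ennreal_mult'[OF powr_ge_zero]) (simp_all add: wp_def wm_def max_def ennreal_neg)
  define dp dm where "dp = duhamel 0 t (\<lambda>\<tau> y. ennreal (\<tau> powr \<rho> * w y)) x"
    and "dm = duhamel 0 t (\<lambda>\<tau> y. ennreal (\<tau> powr \<rho> * - w y)) x"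
  have "dp \<le> duhamel 0 t (\<lambda>\<tau> y. ennreal (\<tau> powr \<rho> * \<bar>w y\<bar>)) x" "dm \<le> duhamel 0 t (\<lambda>\<tau> y. ennreal (\<tau> powr \<rho> * \<bar>w y\<bar>)) x"
    unfolding dp_def dm_def by (intro duhamel_mono ennreal_leI mult_left_mono; simp)+
  then have d: "dp < top" "dm < top" using fins(2) by (auto intro: le_less_trans)
  have nnp: "0 \<le> \<tau> powr \<rho> * wp y" "0 \<le> \<tau> powr \<rho> * wm y" for \<tau> y by (simp_all add: wp_def wm_def)
  have dp': "duhamel 0 t (\<lambda>\<tau> y. ennreal (\<tau> powr \<rho> * wp y)) x = dp"
    and dm': "duhamel 0 t (\<lambda>\<tau> y. ennreal (\<tau> powr \<rho> * wm y)) x = dm"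
    by (simp_all only: eqs dp_def dm_def)
  note P = duhamel_set_integral(2,3)[where F = "\<lambda>\<tau> y. \<tau> powr \<rho> * wp y" and t = t and x = x,
      OF measurable_powr_times(1) nnp(1), unfolded dp']
  note M = duhamel_set_integral(2,3)[where F = "\<lambda>\<tau> y. \<tau> powr \<rho> * wm y" and t = t and x = x,
      OF measurable_powr_times(1) nnp(2), unfolded dm']
  have hs: "\<tau> powr \<rho> * heat_semigroup (t - \<tau>) w x
     = heat_semigroup (t - \<tau>) (\<lambda>y. \<tau> powr \<rho> * wp y) x - heat_semigroup (t - \<tau>) (\<lambda>y. \<tau> powr \<rho> * wm y) x"
    if "\<tau> \<in> {0..t}" for \<tau>
  proof -
    have "w = (\<lambda>y. wp y - wm y)" by (auto simp: wp_def wm_def fun_eq_iff)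
    then have "heat_semigroup (t - \<tau>) w x = heat_semigroup (t - \<tau>) (\<lambda>y. wp y - wm y) x" by simp
    also have "\<dots> = heat_semigroup (t - \<tau>) wp x - heat_semigroup (t - \<tau>) wm x"
      using that by (intro heat_semigroup_diff[OF L q]) auto
    finally show ?thesis by (simp add: heat_semigroup_cmult right_diff_distrib)
  qed
  have i: "set_integrable lborel {0..t} (\<lambda>\<tau>. heat_semigroup (t - \<tau>) (\<lambda>y. \<tau> powr \<rho> * wp y) x - heat_semigroup (t - \<tau>) (\<lambda>y. \<tau> powr \<rho> * wm y) x)"
    using P(1) M(1) d by (intro set_integral_diff) auto
  then show "set_integrable lborel {0..t} (\<lambda>\<tau>. \<tau> powr \<rho> * heat_semigroup (t - \<tau>) w x)"
    by (subst set_integrable_cong[OF refl refl hs]) auto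
  have "(LINT \<tau>:{0..t}|lborel. \<tau> powr \<rho> * heat_semigroup (t - \<tau>) w x)
    = (LINT \<tau>:{0..t}|lborel. heat_semigroup (t - \<tau>) (\<lambda>y. \<tau> powr \<rho> * wp y) x - heat_semigroup (t - \<tau>) (\<lambda>y. \<tau> powr \<rho> * wm y) x)"
    by (intro set_lebesgue_integral_cong) (use hs in auto)
  also have "\<dots> = enn2real dp - enn2real dm"
    using P M d by (subst set_integral_diff) auto
  finally have I: "(LINT \<tau>:{0..t}|lborel. \<tau> powr \<rho> * heat_semigroup (t - \<tau>) w x) = enn2real dp - enn2real dm" .
  have "nn_heat t (\<lambda>y. ennreal (u0 y)) x \<le> nn_heat t (\<lambda>y. ennreal \<bar>u0 y\<bar>) x"
    "nn_heat t (\<lambda>y. ennreal (- u0 y)) x \<le> nn_heat t (\<lambda>y. ennreal \<bar>u0 y\<bar>) x"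
    by (intro nn_heat_mono ennreal_leI; simp)+
  then have n: "nn_heat t (\<lambda>y. ennreal (u0 y)) x < top" "nn_heat t (\<lambda>y. ennreal (- u0 y)) x < top"
    using fins(1) by (auto intro: le_less_trans)
  have "linear_flow \<rho> u0 w t x = enn2real (nn_heat t (\<lambda>y. ennreal (u0 y)) x + dp) - enn2real (nn_heat t (\<lambda>y. ennreal (- u0 y)) x + dm)"
    by (simp add: linear_flow_def linear_part_def dp_def dm_def)
  also have "\<dots> = heat_semigroup t u0 x + (enn2real dp - enn2real dm)"
    using n d fins(1) t by (simp add: enn2real_plus heat_semigroup_eq_diff)
  finally show "linear_flow \<rho> u0 w t x = heat_semigroup t u0 x
      + (LINT \<tau>:{0..t}|lborel. \<tau> powr \<rho> * heat_semigroup (t - \<tau>) w x)"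
    by (simp add: I)
qed

text \<open>On [0, 1] the density is at most 1 if \<open>\<rho> \<ge> 0\<close>, and for
  \<open>\<rho> < 0\<close> moving its singularity from 0 to \<open>a\<close> increases it; the sum
  of both bounds covers the two cases. The result depends on \<open>t - a\<close> alone, which makes
  the restart uniform in \<open>a\<close>.\<close>

lemma nn_integral_powr_le:
  assumes "-1 < \<rho>" "0 \<le> a" "a \<le> t" "t \<le> 1"
  shows "(\<integral>\<^sup>+\<tau>. indicator {a..t} \<tau> * ennreal (\<tau> powr \<rho>) \<partial>lborel) \<le> ennreal ((t - a) + (t - a) powr (\<rho> + 1) / (\<rho> + 1))"
proof -
  have "AE \<tau> in lborel. \<tau> \<noteq> a" by (rule AE_lborel_singleton)
  then have "(\<integral>\<^sup>+\<tau>. indicator {a..t} \<tau> * ennreal (\<tau> powr \<rho>) \<partial>lborel)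
    \<le> (\<integral>\<^sup>+\<tau>. indicator {a..t} \<tau> + ennreal (indicator {a..t} \<tau> * (\<tau> - a) powr \<rho>) \<partial>lborel)"
  proof (intro nn_integral_mono_AE, eventually_elim)
    case (elim \<tau>)
    show ?case
    proof (cases "\<tau> \<in> {a..t}")
      case True
      with elim assms have \<tau>: "0 < \<tau> - a" "\<tau> - a \<le> \<tau>" "\<tau> \<le> 1" "0 < \<tau>" by auto
      have "\<tau> powr \<rho> \<le> 1 + (\<tau> - a) powr \<rho>"
      proof (cases "0 \<le> \<rho>")
        case True
        then have "\<tau> powr \<rho> \<le> 1 powr \<rho>" using \<tau> by (intro powr_mono2) auto
        then show ?thesis by (simp add: add_increasing2)
      next
        case False
        then have "\<tau> powr \<rho> \<le> (\<tau> - a) powr \<rho>" using \<tau> by (intro powr_mono2') auto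
        then show ?thesis by simp
      qed
      then have "ennreal (\<tau> powr \<rho>) \<le> ennreal (1 + (\<tau> - a) powr \<rho>)" by (rule ennreal_leI)
      with True show ?thesis by simp
    qed simp
  qed
  also have "\<dots> = (\<integral>\<^sup>+\<tau>. indicator {a..t} (\<tau> :: real) \<partial>lborel) + (\<integral>\<^sup>+\<tau>. ennreal (indicator {a..t} \<tau> * (\<tau> - a) powr \<rho>) \<partial>lborel)"
    by (rule nn_integral_add) auto
  also have "\<dots> = ennreal (t - a) + ennreal ((t - a) powr (\<rho> + 1) / (\<rho> + 1))"
    using assms nn_integral_powr_Icc[of \<rho> a t] by simp
  also have "\<dots> = ennreal ((t - a) + (t - a) powr (\<rho> + 1) / (\<rho> + 1))"
    using assms by (intro ennreal_plus[symmetric]) auto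
  finally show ?thesis .
qed

text \<open>Jensen with respect to the density \<open>k\<close> in time, followed by the contraction
  property of the flow at each time.\<close>

lemma duhamel_powr_norm:
  fixes w :: "real ^ 'n \<Rightarrow> real"
  assumes w: "w \<in> Lq q" and q: "1 \<le> q" and c: "0 < c"
    and mass: "(\<integral>\<^sup>+\<tau>. indicator {a..t} \<tau> * ennreal (\<tau> powr \<rho>) \<partial>lborel) \<le> ennreal c"
  shows "(\<integral>\<^sup>+x. epow (duhamel a t (\<lambda>\<tau> y. ennreal (\<tau> powr \<rho> * w y)) x) q \<partial>lborel) \<le> ennreal ((c * Lq_norm q w) powr q)"
proof -
  note [measurable] = Lq_measurable[OF w]
  have ind: "indicator {a..b} s = (if a \<le> s \<and> s \<le> b then 1 else 0 :: ennreal)" for a b s :: real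
    by (simp add: indicator_def)
  define k where "k \<tau> = indicator {a..t} \<tau> * ennreal (\<tau> powr \<rho>)" for \<tau>
  have [measurable]: "k \<in> borel_measurable borel" unfolding k_def by measurable
  have "duhamel a t (\<lambda>\<tau> y. ennreal (\<tau> powr \<rho> * w y)) x = (\<integral>\<^sup>+\<tau>. k \<tau> * nn_heat (t - \<tau>) (\<lambda>y. ennreal (w y)) x \<partial>lborel)" for x
    unfolding duhamel_def k_def by (simp add: ennreal_mult' nn_heat_cmult mult.assoc)
  then have "epow (duhamel a t (\<lambda>\<tau> y. ennreal (\<tau> powr \<rho> * w y)) x) q
    \<le> ennreal (c powr (q - 1)) * (\<integral>\<^sup>+\<tau>. k \<tau> * epow (nn_heat (t - \<tau>) (\<lambda>y. ennreal (w y)) x) q \<partial>lborel)" for x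
    using nn_integral_jensen[of k lborel "\<lambda>\<tau>. nn_heat (t - \<tau>) (\<lambda>y. ennreal (w y)) x" c q] mass q c
    by (simp add: k_def)
  then have "(\<integral>\<^sup>+x. epow (duhamel a t (\<lambda>\<tau> y. ennreal (\<tau> powr \<rho> * w y)) x) q \<partial>lborel)
    \<le> (\<integral>\<^sup>+x. ennreal (c powr (q - 1)) * (\<integral>\<^sup>+\<tau>. k \<tau> * epow (nn_heat (t - \<tau>) (\<lambda>y. ennreal (w y)) x) q \<partial>lborel) \<partial>lborel)"
    by (intro nn_integral_mono)
  also have "\<dots> = ennreal (c powr (q - 1)) * (\<integral>\<^sup>+x. \<integral>\<^sup>+\<tau>. k \<tau> * epow (nn_heat (t - \<tau>) (\<lambda>y. ennreal (w y)) x) q \<partial>lborel \<partial>lborel)"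
    by (rule nn_integral_cmult) measurable
  also have "(\<integral>\<^sup>+x. \<integral>\<^sup>+\<tau>. k \<tau> * epow (nn_heat (t - \<tau>) (\<lambda>y. ennreal (w y)) x) q \<partial>lborel \<partial>lborel)
    = (\<integral>\<^sup>+\<tau>. \<integral>\<^sup>+x. k \<tau> * epow (nn_heat (t - \<tau>) (\<lambda>y. ennreal (w y)) x) q \<partial>lborel \<partial>lborel)"
    by (rule lborel_pair.Fubini') measurable
  also have "\<dots> = (\<integral>\<^sup>+\<tau>. k \<tau> * (\<integral>\<^sup>+x. epow (nn_heat (t - \<tau>) (\<lambda>y. ennreal (w y)) x) q \<partial>lborel) \<partial>lborel)"
    by (intro nn_integral_cong nn_integral_cmult) measurable
  also have "\<dots> \<le> (\<integral>\<^sup>+\<tau>. k \<tau> * ennreal (Lq_norm q w powr q) \<partial>lborel)"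
  proof (intro nn_integral_mono mult_left_mono)
    fix \<tau>
    have "(\<integral>\<^sup>+x. epow (nn_heat (t - \<tau>) (\<lambda>y. ennreal (w y)) x) q \<partial>lborel) \<le> (\<integral>\<^sup>+x. epow (ennreal (w x)) q \<partial>lborel)"
      using q by (intro nn_heat_contraction) measurable
    also have "\<dots> \<le> (\<integral>\<^sup>+x. epow (ennreal \<bar>w x\<bar>) q \<partial>lborel)"
      using q by (intro nn_integral_mono epow_mono ennreal_leI) auto
    also have "\<dots> = ennreal (Lq_norm q w powr q)" using q by (intro nn_integral_Lq_norm[OF w]) auto
    finally show "(\<integral>\<^sup>+x. epow (nn_heat (t - \<tau>) (\<lambda>y. ennreal (w y)) x) q \<partial>lborel) \<le> ennreal (Lq_norm q w powr q)" .
  qed simp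
  also have "\<dots> = (\<integral>\<^sup>+\<tau>. k \<tau> \<partial>lborel) * ennreal (Lq_norm q w powr q)"
    by (rule nn_integral_multc) simp
  also have "\<dots> \<le> ennreal c * ennreal (Lq_norm q w powr q)"
    using mass by (intro mult_right_mono) (auto simp: k_def)
  also have "ennreal (c powr (q - 1)) * (ennreal c * ennreal (Lq_norm q w powr q)) = ennreal ((c * Lq_norm q w) powr q)"
    using c by (simp add: ennreal_mult[symmetric] powr_mult powr_diff)
  finally show ?thesis by (simp add: mult_left_mono)
qed

lemma powr_vanishes_at_0:
  fixes e c d :: real
  assumes "0 < e" "0 \<le> c" "0 < d"
  obtains T0 where "0 < T0" "\<And>T. 0 \<le> T \<Longrightarrow> T \<le> T0 \<Longrightarrow> c * T powr e \<le> d"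
proof (rule that)
  show "0 < (d / (c + 1)) powr (1 / e)" using assms by simp
  fix T assume T: "0 \<le> T" "T \<le> (d / (c + 1)) powr (1 / e)"
  have "T powr e \<le> ((d / (c + 1)) powr (1 / e)) powr e" using T assms by (intro powr_mono2) auto
  also have "\<dots> = d / (c + 1)" using assms by (simp add: powr_powr)
  finally have "c * T powr e \<le> c * (d / (c + 1))" using assms by (intro mult_left_mono)
  also have "\<dots> \<le> d" using assms by (simp add: field_simps)
  finally show "c * T powr e \<le> d" .
qed

section \<open>The fixed point problem\<close>

text \<open>As \<open>b\<close> bounds the norm of \<open>B t\<close>, functions below
  \<open>2 B\<close> have norm at most \<open>2 b\<close>. The constants \<open>A\<close> and
  \<open>\<Lambda>\<close> are nevertheless formed with \<open>2 b + 1\<close>: the surplus 1 is the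
  room in which the norm of an arbitrary solution may move during the continuation argument. In the
  Kato condition \<open>3 b + 1\<close> is the sum of \<open>2 b + 1\<close> for the solution and
  \<open>b\<close> for \<open>h\<close>, \<open>p * A powr (1 / p)\<close> comes from
  \<open>power_diff_kato\<close>, and the factor 2 counts the two solutions that are
  compared.\<close>

locale heat_problem =
  fixes p q \<alpha> \<rho> \<kappa> \<beta> e A \<Lambda> b C T :: real and u0 w :: "real ^ 'n \<Rightarrow> real"
    and B :: "real \<Rightarrow> real ^ 'n \<Rightarrow> ennreal"
  assumes p: "1 < p" and q: "1 \<le> q" and \<alpha>: "1 \<le> \<alpha>" and \<rho>: "-1 < \<rho>"
    and \<kappa>: "\<kappa> = real CARD('n) * (p - 1) / (2 * q)" "\<kappa> < 1"
    and \<beta>: "\<beta> = (p - 1) / p" and e: "e = 1 - \<beta> - real CARD('n) * \<beta> / (2 * q)"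
    and A: "A = (2 * b + 1) powr \<alpha>" and \<Lambda>: "\<Lambda> = \<alpha> * (2 * b + 1) powr (\<alpha> - 1) * b"
    and u0: "u0 \<in> Lq q" and w: "w \<in> Lq q"
    and B: "case_prod B \<in> borel_measurable (borel \<Otimes>\<^sub>M borel)"
    and B_linear: "\<And>t x. 0 \<le> t \<Longrightarrow> t \<le> 1 \<Longrightarrow> linear_majorant \<rho> u0 w t x \<le> B t x"
    and b: "0 \<le> b" "\<And>t. (\<integral>\<^sup>+x. epow (B t x) q \<partial>lborel) \<le> ennreal (b powr q)"
    and C: "0 \<le> C" "\<And>a t x. a \<le> t \<Longrightarrow>
      duhamel a t (\<lambda>\<tau> y. epow (B \<tau> y) p) x \<le> ennreal (C * (t - a) powr (1 - \<kappa>)) * B t x"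
    and T: "0 < T" "T \<le> 1"
    and small_map: "C * T powr (1 - \<kappa>) * (A * 2 powr p) \<le> 1"
      "C * T powr (1 - \<kappa>) * (\<Lambda> * 2 powr p + A * p * 2 powr p) \<le> 1 / 2"
    and small_kato: "2 * (p * A powr (1 / p)) * (2 powr (real CARD('n) / 2) * exp (2 * real CARD('n)) *
      (3 powr (real CARD('n) / 2 * \<beta>) * (3 * b + 1) powr \<beta> * (T powr e / (1 - (1 / 2) powr e)))) \<le> 1 / 2"
begin

lemma A_pos: "0 < A" and \<Lambda>_nonneg: "0 \<le> \<Lambda>"
  using b(1) \<alpha> by (auto simp: A \<Lambda>)

lemma \<beta>_bounds: "0 < \<beta>" "\<beta> \<le> 1"
  using p by (auto simp: \<beta>)

text \<open>Since \<open>1 - \<beta> = 1 / p\<close> and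
  \<open>N \<beta> / (2 q) = \<kappa> / p\<close>, the Kato exponent is
  \<open>(1 - \<kappa>) / p\<close>, positive under the very condition that makes the Duhamel
  integral of the majorant converge.\<close>

lemma e_pos: "0 < e"
proof -
  have "e = (1 - \<kappa>) / p"
    unfolding e \<kappa>(1) \<beta> using p q by (simp add: divide_simps)
  then show ?thesis using \<kappa>(2) p by simp
qed

definition h :: "real \<Rightarrow> real ^ 'n \<Rightarrow> real" where
  "h = linear_flow \<rho> u0 w"

lemma measurable_h: "case_prod h \<in> borel_measurable (borel \<Otimes>\<^sub>M borel)"
  unfolding h_def by (intro measurable_linear_flow Lq_measurable[OF u0] Lq_measurable[OF w])

lemma h_le: "0 \<le> t \<Longrightarrow> t \<le> T \<Longrightarrow> ennreal \<bar>h t x\<bar> \<le> B t x"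
  unfolding h_def using T(2) by (intro order_trans[OF linear_flow_le B_linear]) auto

lemma B_finite: "AE x in lborel. B t x < top"
proof -
  note [measurable (raw)] = measurable_uncurry[OF B]
  have "(\<integral>\<^sup>+x. epow (B t x) q \<partial>lborel) \<noteq> \<infinity>"
    using b(2)[of t] by (auto simp: top_unique)
  then have "AE x in lborel. epow (B t x) q \<noteq> \<infinity>"
    by (rule nn_integral_PInf_AE[rotated]) measurable
  then show ?thesis by eventually_elim (simp add: less_top)
qed

lemma Lq_norm_le_majorant:
  assumes "f \<in> borel_measurable borel" "0 \<le> c" "AE x in lborel. ennreal \<bar>f x\<bar> \<le> ennreal c * B t x"
  shows "f \<in> Lq q" "Lq_norm q f \<le> c * b"
  using Lq_bound_majorant[OF assms(1) measurable_slice[OF B] _ b(1) assms(2) b(2) assms(3)] q by auto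

lemma duhamel_B:
  assumes "0 \<le> t" "t \<le> T"
  shows "duhamel 0 t (\<lambda>\<tau> y. epow (B \<tau> y) p) x \<le> ennreal (C * T powr (1 - \<kappa>)) * B t x"
proof -
  have "duhamel 0 t (\<lambda>\<tau> y. epow (B \<tau> y) p) x \<le> ennreal (C * (t - 0) powr (1 - \<kappa>)) * B t x"
    using assms by (intro C)
  also have "\<dots> \<le> ennreal (C * T powr (1 - \<kappa>)) * B t x"
    using assms C(1) \<kappa>(2) by (intro mult_right_mono ennreal_leI mult_left_mono powr_mono2) auto
  finally show ?thesis .
qed

lemma Lq_norm_le_2b:
  assumes "V \<in> borel_measurable borel" "\<And>y. ennreal \<bar>V y\<bar> \<le> 2 * B \<tau> y"
  shows "V \<in> Lq q" "Lq_norm q V \<le> 2 * b"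
  using Lq_norm_le_majorant[of V 2 \<tau>] assms by auto

lemma nonlocal_contraction:
  assumes T1: "T1 \<le> T"
  shows "duhamel_contraction B p T1 A \<Lambda> (C * T powr (1 - \<kappa>)) (\<lambda>_ U. Lq_norm q U powr \<alpha>) h"
proof
  show "(\<lambda>\<tau>. Lq_norm q (U \<tau>) powr \<alpha>) \<in> borel_measurable borel"
    if "case_prod U \<in> borel_measurable (borel \<Otimes>\<^sub>M borel)" for U :: "real \<Rightarrow> real ^ 'n \<Rightarrow> real"
    using measurable_Lq_norm[OF that] by measurable
  show "Lq_norm q V powr \<alpha> \<le> A"
    if "V \<in> borel_measurable borel" "\<And>y. ennreal \<bar>V y\<bar> \<le> 2 * B \<tau> y" for V :: "real ^ 'n \<Rightarrow> real" and \<tau>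
    unfolding A using Lq_norm_le_2b(2)[OF that] \<alpha> by (intro powr_mono2) auto
  show "\<bar>Lq_norm q U powr \<alpha> - Lq_norm q V powr \<alpha>\<bar> \<le> \<Lambda> * D"
    if U: "U \<in> borel_measurable borel" "\<And>y. ennreal \<bar>U y\<bar> \<le> 2 * B \<tau> y"
      and V: "V \<in> borel_measurable borel" "\<And>y. ennreal \<bar>V y\<bar> \<le> 2 * B \<tau> y"
      and D: "0 \<le> D" "\<And>y. ennreal \<bar>U y - V y\<bar> \<le> ennreal D * B \<tau> y"
    for U V :: "real ^ 'n \<Rightarrow> real" and \<tau> D
  proof -
    note nU = Lq_norm_le_2b[OF U] and nV = Lq_norm_le_2b[OF V]
    have "\<bar>Lq_norm q U - Lq_norm q V\<bar> \<le> Lq_norm q (\<lambda>x. U x - V x)"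
      by (rule Lq_norm_diff_le[OF nU(1) nV(1) q])
    also have "\<dots> \<le> D * b"
      using U(1) V(1) D by (intro Lq_norm_le_majorant(2)[where t = \<tau>]) auto
    finally have d: "\<bar>Lq_norm q U - Lq_norm q V\<bar> \<le> D * b" .
    have "\<bar>Lq_norm q U powr \<alpha> - Lq_norm q V powr \<alpha>\<bar>
      \<le> \<alpha> * max (Lq_norm q U) (Lq_norm q V) powr (\<alpha> - 1) * \<bar>Lq_norm q U - Lq_norm q V\<bar>"
      using \<alpha> by (intro powr_diff_le) auto
    also have "\<dots> \<le> \<alpha> * (2 * b + 1) powr (\<alpha> - 1) * (D * b)"
      using nU(2) nV(2) \<alpha> d b(1) by (intro mult_mono mult_left_mono powr_mono2) (auto simp: max_def)
    finally show ?thesis by (simp add: \<Lambda> mult_ac)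
  qed
qed (use B measurable_h p A_pos \<Lambda>_nonneg C(1) T1 small_map in \<open>auto intro: h_le duhamel_B\<close>)

lemma frozen_contraction:
  assumes T1: "T1 \<le> T" and a: "a \<in> borel_measurable borel" "\<And>\<tau>. 0 \<le> a \<tau>" "\<And>\<tau>. 0 \<le> \<tau> \<Longrightarrow> \<tau> \<le> T1 \<Longrightarrow> a \<tau> \<le> A"
  shows "duhamel_contraction B p T1 A \<Lambda> (C * T powr (1 - \<kappa>)) (\<lambda>\<tau> _. a \<tau>) h"
  by unfold_locales
     (use B measurable_h p A_pos \<Lambda>_nonneg C(1) T1 a small_map in \<open>auto intro: h_le duhamel_B\<close>)

section \<open>Continuity in time, and existence\<close>

lemma linear_part_continuous:
  assumes v0: "v0 = u0 \<and> v = w \<or> v0 = (\<lambda>y. - u0 y) \<and> v = (\<lambda>y. - w y)"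
  shows "continuous_Lq q T (\<lambda>t x. enn2real (linear_part \<rho> v0 v t x))"
  unfolding linear_part_def
proof (rule duhamel_continuous)
  have v: "v \<in> Lq q" and v0L: "v0 \<in> Lq q" using v0 u0 w by (auto intro: Lq_uminus)
  show "(\<lambda>y. ennreal (v0 y)) \<in> borel_measurable borel" using Lq_measurable[OF v0L] by measurable
  show "case_prod (\<lambda>\<tau> y. ennreal (\<tau> powr \<rho> * v y)) \<in> borel_measurable (borel \<Otimes>\<^sub>M borel)"
    by (rule measurable_powr_times(2)[OF Lq_measurable[OF v]])
  show "(\<integral>\<^sup>+x. epow (nn_heat t (\<lambda>y. ennreal (v0 y)) x + duhamel 0 t (\<lambda>\<tau> y. ennreal (\<tau> powr \<rho> * v y)) x) q \<partial>lborel) < top"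
    if t: "0 \<le> t" "t \<le> T" for t
  proof -
    have "linear_part \<rho> v0 v t x \<le> B t x" for x
      using v0 linear_part_le[of \<rho> u0 w t x] B_linear[of t x] t T(2) by (auto intro: order_trans)
    then have "(\<integral>\<^sup>+x. epow (linear_part \<rho> v0 v t x) q \<partial>lborel) \<le> (\<integral>\<^sup>+x. epow (B t x) q \<partial>lborel)"
      using q by (intro nn_integral_mono epow_mono) auto
    also have "\<dots> < top" using b(2)[of t] by (rule le_less_trans) simp
    finally show ?thesis by (simp add: linear_part_def)
  qed
  fix \<eta> :: real assume \<eta>: "0 < \<eta>"
  \<comment> \<open>Chosen so that \<open>c * Lq_norm q v \<le> \<eta>\<close>, with 1 added in case
    the norm vanishes. Each of the two terms of \<open>nn_integral_powr_le\<close> is then made at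
    most \<open>c / 2\<close>.\<close>
  define c where "c = \<eta> / (Lq_norm q v + 1)"
  have c: "0 < c" using \<eta> by (simp add: c_def add_nonneg_pos)
  obtain d where d: "0 < d" "\<And>r. 0 \<le> r \<Longrightarrow> r \<le> d \<Longrightarrow> 1 / (\<rho> + 1) * r powr (\<rho> + 1) \<le> c / 2"
    using powr_vanishes_at_0[of "\<rho> + 1" "1 / (\<rho> + 1)" "c / 2"] \<rho> c by auto
  have "(\<integral>\<^sup>+x. epow (duhamel a t (\<lambda>\<tau> y. ennreal (\<tau> powr \<rho> * v y)) x) q \<partial>lborel) \<le> ennreal (\<eta> powr q)"
    if t: "0 \<le> a" "a \<le> t" "t \<le> T" "t - a < min d (c / 2)" for a t
  proof -
    have "(\<integral>\<^sup>+\<tau>. indicator {a..t} \<tau> * ennreal (\<tau> powr \<rho>) \<partial>lborel) \<le> ennreal ((t - a) + (t - a) powr (\<rho> + 1) / (\<rho> + 1))"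
      using t T(2) \<rho> by (intro nn_integral_powr_le) auto
    also have "\<dots> \<le> ennreal c"
    proof (rule ennreal_leI)
      have "(t - a) powr (\<rho> + 1) / (\<rho> + 1) \<le> c / 2" using d(2)[of "t - a"] t by simp
      moreover have "t - a \<le> c / 2" using t by simp
      ultimately show "(t - a) + (t - a) powr (\<rho> + 1) / (\<rho> + 1) \<le> c" by linarith
    qed
    finally have "(\<integral>\<^sup>+x. epow (duhamel a t (\<lambda>\<tau> y. ennreal (\<tau> powr \<rho> * v y)) x) q \<partial>lborel) \<le> ennreal ((c * Lq_norm q v) powr q)"
      by (rule duhamel_powr_norm[OF v q c])
    also have "\<dots> \<le> ennreal (\<eta> powr q)"
    proof (intro ennreal_leI powr_mono2)
      have "0 < Lq_norm q v + 1" by (simp add: add_nonneg_pos)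
      then have "c * (Lq_norm q v + 1) = \<eta>" by (simp add: c_def)
      then show "c * Lq_norm q v \<le> \<eta>" using c by (simp add: distrib_left)
    qed (use c q in auto)
    finally show ?thesis .
  qed
  then show "\<exists>d>0. \<forall>a t. 0 \<le> a \<longrightarrow> a \<le> t \<longrightarrow> t \<le> T \<longrightarrow> t - a < d \<longrightarrow>
      (\<integral>\<^sup>+x. epow (duhamel a t (\<lambda>\<tau> y. ennreal (\<tau> powr \<rho> * v y)) x) q \<partial>lborel) \<le> ennreal (\<eta> powr q)"
    using d(1) c by (intro exI[of _ "min d (c / 2)"]) auto
qed (rule q)

text \<open>Restarted at \<open>a\<close>, the Duhamel integral of \<open>B^p\<close> is at most a
  multiple of \<open>(t - a)^(1 - \<kappa>) B t\<close>; hence the remainder required by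
  \<open>duhamel_continuous\<close> is small in \<open>L^q\<close>, uniformly in
  \<open>a\<close>.\<close>

lemma force_continuous:
  assumes F: "case_prod F \<in> borel_measurable (borel \<Otimes>\<^sub>M borel)"
    and F_le: "\<And>\<tau> y. 0 \<le> \<tau> \<Longrightarrow> \<tau> \<le> T \<Longrightarrow> F \<tau> y \<le> ennreal (A * 2 powr p) * epow (B \<tau> y) p"
  shows "continuous_Lq q T (\<lambda>t x. enn2real (duhamel 0 t F x))"
proof -
  define K where "K = A * 2 powr p * C"
  have K: "0 \<le> K" using A_pos C(1) by (simp add: K_def)
  note [measurable (raw)] = measurable_uncurry[OF B]
  have Bp: "case_prod (\<lambda>\<tau> y. epow (B \<tau> y) p) \<in> borel_measurable (borel \<Otimes>\<^sub>M borel)" by measurable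
  have bd: "(\<integral>\<^sup>+x. epow (duhamel a t F x) q \<partial>lborel) \<le> ennreal ((K * (t - a) powr (1 - \<kappa>) * b) powr q)"
    if t: "0 \<le> a" "a \<le> t" "t \<le> T" for a t
  proof -
    have le: "duhamel a t F x \<le> ennreal (K * (t - a) powr (1 - \<kappa>)) * B t x" for x
    proof -
      have "duhamel a t F x \<le> duhamel a t (\<lambda>\<tau> y. ennreal (A * 2 powr p) * epow (B \<tau> y) p) x"
        using t by (intro duhamel_mono F_le) auto
      also have "\<dots> = ennreal (A * 2 powr p) * duhamel a t (\<lambda>\<tau> y. epow (B \<tau> y) p) x"
        by (rule duhamel_cmult[OF Bp])
      also have "\<dots> \<le> ennreal (A * 2 powr p) * (ennreal (C * (t - a) powr (1 - \<kappa>)) * B t x)"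
        using t by (intro mult_left_mono C(2)) auto
      also have "\<dots> = ennreal (K * (t - a) powr (1 - \<kappa>)) * B t x"
        using A_pos C(1) by (simp add: K_def mult.assoc[symmetric] ennreal_mult[symmetric])
      finally show ?thesis .
    qed
    have "(\<integral>\<^sup>+x. epow (duhamel a t F x) q \<partial>lborel) \<le> (\<integral>\<^sup>+x. ennreal ((K * (t - a) powr (1 - \<kappa>)) powr q) * epow (B t x) q \<partial>lborel)"
    proof (intro nn_integral_mono)
      fix x
      have "epow (duhamel a t F x) q \<le> epow (ennreal (K * (t - a) powr (1 - \<kappa>)) * B t x) q"
        using q by (intro epow_mono le) auto
      then show "epow (duhamel a t F x) q \<le> ennreal ((K * (t - a) powr (1 - \<kappa>)) powr q) * epow (B t x) q"
        using K by (simp add: epow_mult)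
    qed
    also have "\<dots> = ennreal ((K * (t - a) powr (1 - \<kappa>)) powr q) * (\<integral>\<^sup>+x. epow (B t x) q \<partial>lborel)"
      by (rule nn_integral_cmult) measurable
    also have "\<dots> \<le> ennreal ((K * (t - a) powr (1 - \<kappa>)) powr q) * ennreal (b powr q)"
      by (intro mult_left_mono b) simp
    also have "\<dots> = ennreal ((K * (t - a) powr (1 - \<kappa>) * b) powr q)"
      using K b(1) by (simp add: ennreal_mult[symmetric] powr_mult)
    finally show ?thesis .
  qed
  have "continuous_Lq q T (\<lambda>t x. enn2real (nn_heat t (\<lambda>_. 0) x + duhamel 0 t F x))"
  proof (rule duhamel_continuous[OF _ F q])
    show "(\<integral>\<^sup>+x. epow (nn_heat t (\<lambda>_. 0) x + duhamel 0 t F x) q \<partial>lborel) < top" if t: "0 \<le> t" "t \<le> T" for t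
      using bd[OF _ t] by (simp add: nn_heat_const) (rule le_less_trans, auto)
    fix \<eta> :: real assume \<eta>: "0 < \<eta>"
    obtain d where d: "0 < d" "\<And>r. 0 \<le> r \<Longrightarrow> r \<le> d \<Longrightarrow> (K * b) * r powr (1 - \<kappa>) \<le> \<eta>"
      using powr_vanishes_at_0[of "1 - \<kappa>" "K * b" \<eta>] \<kappa>(2) K b(1) \<eta> by auto
    have "(\<integral>\<^sup>+x. epow (duhamel a t F x) q \<partial>lborel) \<le> ennreal (\<eta> powr q)"
      if t: "0 \<le> a" "a \<le> t" "t \<le> T" "t - a < d" for a t
    proof (rule order_trans[OF bd[OF t(1-3)]])
      show "ennreal ((K * (t - a) powr (1 - \<kappa>) * b) powr q) \<le> ennreal (\<eta> powr q)"
        using d(2)[of "t - a"] t K b(1) q by (intro ennreal_leI powr_mono2) (auto simp: mult_ac)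
    qed
    with d(1) show "\<exists>d>0. \<forall>a t. 0 \<le> a \<longrightarrow> a \<le> t \<longrightarrow> t \<le> T \<longrightarrow> t - a < d \<longrightarrow>
      (\<integral>\<^sup>+x. epow (duhamel a t F x) q \<partial>lborel) \<le> ennreal (\<eta> powr q)" by blast
  qed simp
  then show ?thesis by (simp add: nn_heat_const)
qed

text \<open>The fixed point of the nonlocal contraction, unfolded. The bound holds at every point
  and the equation wherever \<open>B\<close> is finite, rather than almost everywhere, so that
  \<open>fixed_points_eq\<close> can be applied to it directly.\<close>

definition regular_solution :: "(real \<Rightarrow> real ^ 'n \<Rightarrow> real) \<Rightarrow> bool" where
  "regular_solution U \<longleftrightarrow> case_prod U \<in> borel_measurable (borel \<Otimes>\<^sub>M borel) \<and>
    (\<forall>t x. 0 \<le> t \<longrightarrow> t \<le> T \<longrightarrow> ennreal \<bar>U t x\<bar> \<le> 2 * B t x) \<and>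
    (\<forall>t x. 0 \<le> t \<longrightarrow> t \<le> T \<longrightarrow> B t x < top \<longrightarrow>
      U t x = h t x + enn2real (duhamel 0 t (\<lambda>\<tau> y. ennreal (Lq_norm q (U \<tau>) powr \<alpha> * \<bar>U \<tau> y\<bar> powr p)) x))"

lemma regular_solution_exists: "\<exists>U. regular_solution U"
proof -
  interpret N: duhamel_contraction B p T A \<Lambda> "C * T powr (1 - \<kappa>)" "\<lambda>_ U. Lq_norm q U powr \<alpha>" h
    by (rule nonlocal_contraction) simp
  obtain U where U: "N.admissible U" "\<And>t x. 0 \<le> t \<Longrightarrow> t \<le> T \<Longrightarrow> B t x < top \<Longrightarrow> U t x = N.mild_map U t x"
    using N.fixed_point_exists by blast
  then have "regular_solution U"
    unfolding regular_solution_def N.mild_map_def N.force_def[abs_def] N.admissible_def by blast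
  then show ?thesis by blast
qed

lemma regular_solution_mild:
  assumes U: "regular_solution U"
  shows "continuous_Lq q T U" "mild_solution q \<alpha> p \<rho> w u0 T U"
proof -
  interpret N: duhamel_contraction B p T A \<Lambda> "C * T powr (1 - \<kappa>)" "\<lambda>_ U. Lq_norm q U powr \<alpha>" h
    by (rule nonlocal_contraction) simp
  have adm: "N.admissible U"
    using U by (auto simp: regular_solution_def N.admissible_def)
  have force: "N.force U = (\<lambda>\<tau> y. ennreal (Lq_norm q (U \<tau>) powr \<alpha> * \<bar>U \<tau> y\<bar> powr p))"
    by (simp add: N.force_def fun_eq_iff)
  have fixp: "U t x = h t x + enn2real (duhamel 0 t (N.force U) x)" if "0 \<le> t" "t \<le> T" "B t x < top" for t x
    using U that by (auto simp: regular_solution_def force)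
  have Um: "case_prod U \<in> borel_measurable (borel \<Otimes>\<^sub>M borel)" by (rule N.admissible_measurable[OF adm])
  show "continuous_Lq q T U"
  proof (rule continuous_Lq_cong_AE)
    show "continuous_Lq q T (\<lambda>t x. (enn2real (linear_part \<rho> u0 w t x)
        - enn2real (linear_part \<rho> (\<lambda>y. - u0 y) (\<lambda>y. - w y) t x)) + enn2real (duhamel 0 t (N.force U) x))"
      by (intro continuous_Lq_add continuous_Lq_diff linear_part_continuous force_continuous q
          N.measurable_force Um N.force_le adm) auto
    show "U t \<in> borel_measurable borel" for t by (rule measurable_slice[OF Um])
    show "AE x in lborel. enn2real (linear_part \<rho> u0 w t x)
        - enn2real (linear_part \<rho> (\<lambda>y. - u0 y) (\<lambda>y. - w y) t x) + enn2real (duhamel 0 t (N.force U) x) = U t x"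
      if "t \<in> {0..T}" for t
      using B_finite[of t] by eventually_elim (use that fixp in \<open>auto simp: h_def linear_flow_def\<close>)
  qed
  show "mild_solution q \<alpha> p \<rho> w u0 T U"
    unfolding mild_solution_def
  proof (rule ballI)
    fix t assume "t \<in> {0..T}"
    then have t: "0 \<le> t" "t \<le> T" by auto
    define F where "F \<tau> = nonlinearity q \<alpha> p (U \<tau>)" for \<tau>
    have F_eq: "F \<tau> y = Lq_norm q (U \<tau>) powr \<alpha> * \<bar>U \<tau> y\<bar> powr p" for \<tau> y
      by (simp add: F_def nonlinearity_def)
    have F_nonneg: "0 \<le> F \<tau> y" for \<tau> y by (simp add: F_eq)
    have Fm: "case_prod F \<in> borel_measurable (borel \<Otimes>\<^sub>M borel)"
    proof -
      note [measurable (raw)] = measurable_uncurry[OF Um]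
      note [measurable] = measurable_compose[OF measurable_fst measurable_Lq_norm[OF Um]]
      have "(\<lambda>z. F (fst z) (snd z)) \<in> borel_measurable (borel \<Otimes>\<^sub>M borel)"
        unfolding F_eq by measurable
      then show ?thesis by (simp add: split_beta')
    qed
    have duh: "duhamel 0 t (\<lambda>\<tau> y. ennreal (F \<tau> y)) = duhamel 0 t (N.force U)"
      by (simp add: force F_eq)
    show "AE x in lborel.
        heat_semigroup_defined t u0 x \<and>
        (AE \<tau> in lborel. \<tau> \<in> {0..t} \<longrightarrow>
           heat_semigroup_defined (t - \<tau>) (nonlinearity q \<alpha> p (U \<tau>)) x \<and>
           heat_semigroup_defined (t - \<tau>) w x) \<and>
        set_integrable lborel {0..t}
          (\<lambda>\<tau>. heat_semigroup (t - \<tau>) (nonlinearity q \<alpha> p (U \<tau>)) x) \<and>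
        set_integrable lborel {0..t} (\<lambda>\<tau>. \<tau> powr \<rho> * heat_semigroup (t - \<tau>) w x) \<and>
        U t x = heat_semigroup t u0 x
          + (LINT \<tau>:{0..t}|lborel. heat_semigroup (t - \<tau>) (nonlinearity q \<alpha> p (U \<tau>)) x)
          + (LINT \<tau>:{0..t}|lborel. \<tau> powr \<rho> * heat_semigroup (t - \<tau>) w x)"
      using B_finite[of t]
    proof eventually_elim
      case (elim x)
      have "duhamel 0 t (\<lambda>\<tau> y. ennreal (F \<tau> y)) x < top"
        using N.duhamel_force_le[OF adm t, of x] elim by (simp add: duh) 
      note D = duhamel_set_integral[OF Fm F_nonneg this]
      have "linear_majorant \<rho> u0 w t x < top"
        using B_linear[of t x] t T(2) elim by auto
      note L = linear_flow_eq[OF u0 w q t(1) this]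
      have "AE \<tau> in lborel. \<tau> \<in> {0..t} \<longrightarrow>
           heat_semigroup_defined (t - \<tau>) (F \<tau>) x \<and> heat_semigroup_defined (t - \<tau>) w x"
        using D(1) by eventually_elim (auto intro!: heat_semigroup_defined_Lq[OF w q])
      moreover have "U t x = heat_semigroup t u0 x + (LINT \<tau>:{0..t}|lborel. heat_semigroup (t - \<tau>) (F \<tau>) x)
          + (LINT \<tau>:{0..t}|lborel. \<tau> powr \<rho> * heat_semigroup (t - \<tau>) w x)"
        using fixp[OF t elim] L(2) D(3) by (simp add: h_def duh)
      ultimately show ?case
        using D(2) L(1) heat_semigroup_defined_Lq[OF u0 q t(1)] by (simp add: F_def[symmetric])
    qed
  qed
qed

section \<open>Uniqueness with a frozen coefficient\<close>

text \<open>Three properties of the weight \<open>W\<close> of the linearised equation: it dominates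
  the difference of the forces, its product with the difference of the solutions is controlled by
  the forces themselves, and it is itself at most a multiple of their powers of order
  \<open>\<beta>\<close>. The last rests on \<open>a r^(p - 1) = a^(1/p) (a r^p)^\<beta>\<close>,
  where \<open>a^(1/p)\<close> is bounded through \<open>a \<le> A\<close>.\<close>

lemma power_diff_kato:
  fixes a v u :: real
  assumes a: "0 \<le> a" and v: "0 \<le> v" and u: "0 \<le> u"
  shows "\<bar>a * v powr p - a * u powr p\<bar> \<le> (p * a * (v powr (p - 1) + u powr (p - 1))) * \<bar>v - u\<bar>"
    and "(p * a * (v powr (p - 1) + u powr (p - 1))) * (v + u) \<le> 4 * p * (a * v powr p + a * u powr p)"
    and "a \<le> A \<Longrightarrow> p * a * (v powr (p - 1) + u powr (p - 1))
      \<le> p * A powr (1 / p) * ((a * v powr p) powr \<beta> + (a * u powr p) powr \<beta>)"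
proof -
  have mx: "max v u powr r \<le> v powr r + u powr r" for r by (simp add: max_def)
  have "\<bar>a * v powr p - a * u powr p\<bar> = a * \<bar>v powr p - u powr p\<bar>"
    using a by (simp add: right_diff_distrib[symmetric] abs_mult)
  also have "\<dots> \<le> a * (p * max v u powr (p - 1) * \<bar>v - u\<bar>)"
    using a p v u by (intro mult_left_mono powr_diff_le) auto
  also have "\<dots> \<le> a * (p * (v powr (p - 1) + u powr (p - 1)) * \<bar>v - u\<bar>)"
    using a p mx by (intro mult_left_mono mult_right_mono) auto
  finally show "\<bar>a * v powr p - a * u powr p\<bar> \<le> (p * a * (v powr (p - 1) + u powr (p - 1))) * \<bar>v - u\<bar>"
    by (simp add: mult_ac)
  define m where "m = max v u"
  have m: "0 \<le> m" "v \<le> m" "u \<le> m" using v by (auto simp: m_def)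
  have "(v powr (p - 1) + u powr (p - 1)) * (v + u) \<le> (m powr (p - 1) + m powr (p - 1)) * (m + m)"
    using m v u p by (intro mult_mono add_mono powr_mono2) auto
  also have "\<dots> = 4 * (m powr (p - 1) * m)" by simp
  also have "m powr (p - 1) * m = m powr p" using m(1) by (cases "m = 0") (simp_all add: powr_diff)
  also have "4 * m powr p \<le> 4 * (v powr p + u powr p)" using mx[of p] by (simp add: m_def)
  finally have "p * a * ((v powr (p - 1) + u powr (p - 1)) * (v + u)) \<le> p * a * (4 * (v powr p + u powr p))"
    using p a by (intro mult_left_mono) auto
  then show "(p * a * (v powr (p - 1) + u powr (p - 1))) * (v + u) \<le> 4 * p * (a * v powr p + a * u powr p)"
    by (simp add: algebra_simps)
  assume aA: "a \<le> A"
  have one: "a * r powr (p - 1) \<le> A powr (1 / p) * (a * r powr p) powr \<beta>" if "0 \<le> r" for r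
  proof -
    have "1 / p + \<beta> = 1" "p * \<beta> = p - 1" using p by (simp_all add: \<beta> field_simps)
    then have "a * r powr (p - 1) = a powr (1 / p) * (a * r powr p) powr \<beta>"
      using a that by (simp add: powr_mult powr_powr mult.assoc[symmetric] powr_add[symmetric])
    also have "\<dots> \<le> A powr (1 / p) * (a * r powr p) powr \<beta>"
      using a aA p by (intro mult_right_mono powr_mono2) auto
    finally show ?thesis .
  qed
  have "p * (a * v powr (p - 1) + a * u powr (p - 1))
    \<le> p * (A powr (1 / p) * (a * v powr p) powr \<beta> + A powr (1 / p) * (a * u powr p) powr \<beta>)"
    using p one[OF v] one[OF u] by (intro mult_left_mono add_mono) auto
  then show "p * a * (v powr (p - 1) + u powr (p - 1))
      \<le> p * A powr (1 / p) * ((a * v powr p) powr \<beta> + (a * u powr p) powr \<beta>)"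
    by (simp add: algebra_simps)
qed

text \<open>For a prescribed coefficient the difference of two solutions obeys a linear inequality
  with kernel \<open>W\<close>, to which \<open>duhamel_gronwall_zero\<close> applies. The second
  solution \<open>U\<close> is not assumed but produced by the contraction, so that the equality
  \<open>V = U\<close> transfers the bound \<open>2 B\<close> to \<open>V\<close>.\<close>

lemma frozen_unique:
  fixes V :: "real \<Rightarrow> real ^ 'n \<Rightarrow> real" and a :: "real \<Rightarrow> real"
  defines "f \<equiv> \<lambda>\<tau> y. ennreal (a \<tau> * \<bar>V \<tau> y\<bar> powr p)"
  assumes T1: "0 \<le> T1" "T1 \<le> T"
    and V: "case_prod V \<in> borel_measurable (borel \<Otimes>\<^sub>M borel)"
    and VL: "\<And>t. 0 \<le> t \<Longrightarrow> t \<le> T1 \<Longrightarrow> V t \<in> Lq q" "\<And>t. 0 \<le> t \<Longrightarrow> t \<le> T1 \<Longrightarrow> Lq_norm q (V t) \<le> 2 * b + 1"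
    and a [measurable]: "a \<in> borel_measurable borel" and a0: "\<And>\<tau>. 0 \<le> a \<tau>" and aA: "\<And>\<tau>. 0 \<le> \<tau> \<Longrightarrow> \<tau> \<le> T1 \<Longrightarrow> a \<tau> \<le> A"
    and eq: "\<And>t. 0 \<le> t \<Longrightarrow> t \<le> T1 \<Longrightarrow> AE x in lborel. duhamel 0 t f x < top \<and> V t x = h t x + enn2real (duhamel 0 t f x)"
  obtains U where "case_prod U \<in> borel_measurable (borel \<Otimes>\<^sub>M borel)"
    and "\<And>t x. 0 \<le> t \<Longrightarrow> t \<le> T1 \<Longrightarrow> ennreal \<bar>U t x\<bar> \<le> 2 * B t x"
    and "\<And>t x. 0 \<le> t \<Longrightarrow> t \<le> T1 \<Longrightarrow> B t x < top \<Longrightarrow>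
      U t x = h t x + enn2real (duhamel 0 t (\<lambda>\<tau> y. ennreal (a \<tau> * \<bar>U \<tau> y\<bar> powr p)) x)"
    and "\<And>t. 0 \<le> t \<Longrightarrow> t \<le> T1 \<Longrightarrow> AE x in lborel. V t x = U t x"
proof -
  interpret G: duhamel_contraction B p T1 A \<Lambda> "C * T powr (1 - \<kappa>)" "\<lambda>\<tau> _. a \<tau>" h
    by (rule frozen_contraction[OF T1(2) a a0 aA])
  obtain U where adm: "G.admissible U" and Ufix: "\<And>t x. 0 \<le> t \<Longrightarrow> t \<le> T1 \<Longrightarrow> B t x < top \<Longrightarrow> U t x = G.mild_map U t x"
    using G.fixed_point_exists by blast
  have U: "case_prod U \<in> borel_measurable (borel \<Otimes>\<^sub>M borel)" by (rule G.admissible_measurable[OF adm])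
  define g where "g \<tau> y = ennreal (a \<tau> * \<bar>U \<tau> y\<bar> powr p)" for \<tau> y
  have g_force: "g = G.force U" by (simp add: fun_eq_iff g_def G.force_def)
  note [measurable (raw)] = measurable_uncurry[OF U] measurable_uncurry[OF V]
  note [measurable] = measurable_compose[OF measurable_fst a]
  have f: "case_prod f \<in> borel_measurable (borel \<Otimes>\<^sub>M borel)"
  proof -
    have "(\<lambda>z. f (fst z) (snd z)) \<in> borel_measurable (borel \<Otimes>\<^sub>M borel)" unfolding f_def by measurable
    then show ?thesis by (simp add: split_beta')
  qed
  have g: "case_prod g \<in> borel_measurable (borel \<Otimes>\<^sub>M borel)"
    unfolding g_force by (rule G.measurable_force[OF U])
  define z where "z t x = ennreal \<bar>V t x - U t x\<bar>" for t x
  have z: "case_prod z \<in> borel_measurable (borel \<Otimes>\<^sub>M borel)"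
  proof -
    have "(\<lambda>y. z (fst y) (snd y)) \<in> borel_measurable (borel \<Otimes>\<^sub>M borel)" unfolding z_def by measurable
    then show ?thesis by (simp add: split_beta')
  qed
  define W where "W \<tau> y = ennreal (p * a \<tau> * (\<bar>V \<tau> y\<bar> powr (p - 1) + \<bar>U \<tau> y\<bar> powr (p - 1)))" for \<tau> y
  have W: "case_prod W \<in> borel_measurable (borel \<Otimes>\<^sub>M borel)"
  proof -
    have "(\<lambda>y. W (fst y) (snd y)) \<in> borel_measurable (borel \<Otimes>\<^sub>M borel)" unfolding W_def by measurable
    then show ?thesis by (simp add: split_beta')
  qed
  have W0: "0 \<le> p * a \<tau> * (\<bar>V \<tau> y\<bar> powr (p - 1) + \<bar>U \<tau> y\<bar> powr (p - 1))" for \<tau> y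
    using p a0 by simp
  have fg: "f \<tau> y \<le> g \<tau> y + W \<tau> y * z \<tau> y" "g \<tau> y \<le> f \<tau> y + W \<tau> y * z \<tau> y" for \<tau> y
  proof -
    have "\<bar>a \<tau> * \<bar>V \<tau> y\<bar> powr p - a \<tau> * \<bar>U \<tau> y\<bar> powr p\<bar>
      \<le> (p * a \<tau> * (\<bar>V \<tau> y\<bar> powr (p - 1) + \<bar>U \<tau> y\<bar> powr (p - 1))) * \<bar>\<bar>V \<tau> y\<bar> - \<bar>U \<tau> y\<bar>\<bar>"
      by (rule power_diff_kato(1)[OF a0]) auto
    also have "\<dots> \<le> (p * a \<tau> * (\<bar>V \<tau> y\<bar> powr (p - 1) + \<bar>U \<tau> y\<bar> powr (p - 1))) * \<bar>V \<tau> y - U \<tau> y\<bar>"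
      using W0 by (intro mult_left_mono abs_triangle_ineq3) auto
    finally have le: "ennreal \<bar>a \<tau> * \<bar>V \<tau> y\<bar> powr p - a \<tau> * \<bar>U \<tau> y\<bar> powr p\<bar> \<le> W \<tau> y * z \<tau> y"
      unfolding W_def z_def using W0 by (simp add: ennreal_mult[symmetric] ennreal_leI)
    show "f \<tau> y \<le> g \<tau> y + W \<tau> y * z \<tau> y"
      unfolding f_def g_def using le by (rule ennreal_le_add_of_diff)
    show "g \<tau> y \<le> f \<tau> y + W \<tau> y * z \<tau> y"
      unfolding f_def g_def using le by (intro ennreal_le_add_of_diff) (simp add: abs_minus_commute)
  qed
  have Wz: "case_prod (\<lambda>\<tau> y. W \<tau> y * z \<tau> y) \<in> borel_measurable (borel \<Otimes>\<^sub>M borel)"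
  proof -
    note [measurable (raw)] = measurable_uncurry[OF z] measurable_uncurry[OF W]
    show ?thesis by measurable
  qed
  have AEeq: "AE x in lborel. z t x \<le> duhamel 0 t (\<lambda>\<tau> y. W \<tau> y * z \<tau> y) x" if t: "0 \<le> t" "t \<le> T1" for t
    using eq[OF t] B_finite[of t]
  proof eventually_elim
    case (elim x)
    have gfin: "duhamel 0 t g x < top"
      using G.duhamel_force_le[OF adm t, of x] elim by (auto simp: g_force)
    have Ux: "U t x = h t x + enn2real (duhamel 0 t g x)"
      using Ufix[OF t] elim by (simp add: G.mild_map_def g_force)
    have "ennreal \<bar>enn2real (duhamel 0 t f x) - enn2real (duhamel 0 t g x)\<bar> \<le> duhamel 0 t (\<lambda>\<tau> y. W \<tau> y * z \<tau> y) x"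
    proof (rule ennreal_abs_enn2real_diff_le)
      show "duhamel 0 t f x \<le> duhamel 0 t g x + duhamel 0 t (\<lambda>\<tau> y. W \<tau> y * z \<tau> y) x"
        unfolding duhamel_add[OF g Wz, symmetric] by (intro duhamel_mono fg)
      show "duhamel 0 t g x \<le> duhamel 0 t f x + duhamel 0 t (\<lambda>\<tau> y. W \<tau> y * z \<tau> y) x"
        unfolding duhamel_add[OF f Wz, symmetric] by (intro duhamel_mono fg)
    qed (use elim gfin in auto)
    then show ?case using elim by (simp add: z_def Ux)
  qed
  \<comment> \<open>The Duhamel integral of \<open>f\<close> is \<open>V - h\<close>, of norm at
    most \<open>(2 b + 1) + b\<close>. The same \<open>M\<close> serves for \<open>g\<close>, whose
    Duhamel integral lies below \<open>B\<close>.\<close>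
  define M where "M = 3 * b + 1"
  have M: "0 \<le> M" using b(1) by (simp add: M_def)
  have f_bd: "(\<integral>\<^sup>+x. epow (duhamel 0 t f x) q \<partial>lborel) \<le> ennreal (M powr q)" if t: "0 \<le> t" "t \<le> T1" for t
  proof -
    have hm: "h t \<in> borel_measurable borel" by (rule measurable_slice[OF measurable_h])
    have "AE x in lborel. ennreal \<bar>h t x\<bar> \<le> ennreal 1 * B t x"
      using t T1(2) by (simp add: h_le)
    note hL = Lq_norm_le_majorant[OF hm _ this]
    have "(\<integral>\<^sup>+x. epow (duhamel 0 t f x) q \<partial>lborel) = (\<integral>\<^sup>+x. epow (ennreal \<bar>V t x - h t x\<bar>) q \<partial>lborel)"
    proof (intro nn_integral_cong_AE)
      show "AE x in lborel. epow (duhamel 0 t f x) q = epow (ennreal \<bar>V t x - h t x\<bar>) q"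
        using eq[OF t]
      proof eventually_elim
        case (elim x)
        then have "\<bar>V t x - h t x\<bar> = enn2real (duhamel 0 t f x)" by simp
        with elim show ?case by simp
      qed
    qed
    also have "\<dots> = ennreal (Lq_norm q (\<lambda>x. V t x - h t x) powr q)"
      using q by (intro nn_integral_Lq_norm Lq_diff VL(1)[OF t] hL(1)[OF zero_le_one]) auto
    also have "\<dots> \<le> ennreal (M powr q)"
    proof (intro ennreal_leI powr_mono2)
      have "Lq_norm q (\<lambda>x. V t x - h t x) \<le> Lq_norm q (V t) + Lq_norm q (h t)"
        using Lq_norm_triangle[OF VL(1)[OF t] Lq_uminus[OF hL(1)[OF zero_le_one]] q] by (simp add: Lq_norm_uminus)
      then show "Lq_norm q (\<lambda>x. V t x - h t x) \<le> M"
        using VL(2)[OF t] hL(2)[OF zero_le_one] by (simp add: M_def)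
    qed (use q in auto)
    finally show ?thesis .
  qed
  have g_bd: "(\<integral>\<^sup>+x. epow (duhamel 0 t g x) q \<partial>lborel) \<le> ennreal (M powr q)" if t: "0 \<le> t" "t \<le> T1" for t
  proof -
    have "(\<integral>\<^sup>+x. epow (duhamel 0 t g x) q \<partial>lborel) \<le> (\<integral>\<^sup>+x. epow (B t x) q \<partial>lborel)"
      using q G.duhamel_force_le[OF adm t] by (intro nn_integral_mono epow_mono) (auto simp: g_force)
    also have "\<dots> \<le> ennreal (b powr q)" by (rule b)
    also have "\<dots> \<le> ennreal (M powr q)" using b(1) q by (intro ennreal_leI powr_mono2) (auto simp: M_def)
    finally show ?thesis .
  qed
  define K where "K = 2 powr (real CARD('n) / 2) * exp (2 * real CARD('n)) *
      (3 powr (real CARD('n) / 2 * \<beta>) * M powr \<beta> * (T powr e / (1 - (1 / 2) powr e)))"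
  have half: "(1 / 2 :: real) powr e < 1" using e_pos powr_less_mono2[of e "1 / 2" 1] by simp
  have K0: "0 \<le> K" using half by (simp add: K_def)
  have kato1: "(\<integral>\<^sup>+t. indicator {\<tau>..T1} t * nn_heat (t - \<tau>) (\<lambda>x. ennreal (decay x) * epow (F t x) \<beta>) y \<partial>lborel) \<le> ennreal K * ennreal (decay y)"
    if F: "case_prod F \<in> borel_measurable (borel \<Otimes>\<^sub>M borel)"
      and bd: "\<And>t. 0 \<le> t \<Longrightarrow> t \<le> T1 \<Longrightarrow> (\<integral>\<^sup>+x. epow (duhamel 0 t F x) q \<partial>lborel) \<le> ennreal (M powr q)"
      and \<tau>: "0 \<le> \<tau>" "\<tau> \<le> T1" for F :: "real \<Rightarrow> real ^ 'n \<Rightarrow> ennreal" and \<tau> y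
  proof -
    have T11: "T1 \<le> 1" using T1 T by simp
    have "(\<integral>\<^sup>+t. indicator {\<tau>..T1} t * nn_heat (t - \<tau>) (\<lambda>x. ennreal (decay x) * epow (F t x) \<beta>) y \<partial>lborel)
     \<le> ennreal (2 powr (real CARD('n) / 2) * exp (2 * real CARD('n)) *
      (3 powr (real CARD('n) / 2 * \<beta>) * M powr \<beta> * (T1 powr e / (1 - (1 / 2) powr e)))) * ennreal (decay y)"
      unfolding e by (rule kato_estimate[OF F q M bd \<tau> T11 \<beta>_bounds e_pos[unfolded e]])
    also have "\<dots> \<le> ennreal K * ennreal (decay y)"
      unfolding K_def using T1 e_pos half
      by (intro mult_right_mono mult_left_mono ennreal_leI divide_right_mono powr_mono2) auto
    finally show ?thesis .
  qed
  have kato: "(\<integral>\<^sup>+t. indicator {\<tau>..T1} t * nn_heat (t - \<tau>) (\<lambda>x. ennreal (decay x) * W t x) y \<partial>lborel) \<le> ennreal (1 / 2) * ennreal (decay y)"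
    if \<tau>: "0 \<le> \<tau>" "\<tau> \<le> T1" for \<tau> y
  proof -
    define c where "c = p * A powr (1 / p)"
    have c: "0 \<le> c" using p by (simp add: c_def)
    define H where "H F t x = ennreal (decay x) * epow (F t x) \<beta>" for F :: "real \<Rightarrow> real ^ 'n \<Rightarrow> ennreal" and t x
    have Hm: "case_prod (H F) \<in> borel_measurable (borel \<Otimes>\<^sub>M borel)" if "case_prod F \<in> borel_measurable (borel \<Otimes>\<^sub>M borel)" for F
    proof -
      note [measurable (raw)] = measurable_uncurry[OF that]
      have "(\<lambda>z. H F (fst z) (snd z)) \<in> borel_measurable (borel \<Otimes>\<^sub>M borel)" unfolding H_def by measurable
      then show ?thesis by (simp add: split_beta')
    qed
    note [measurable (raw)] = measurable_nn_heat_uncurry[OF Hm[OF f]] measurable_nn_heat_uncurry[OF Hm[OF g]]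
    have Wle: "ennreal (decay x) * W t x \<le> ennreal c * (H f t x + H g t x)" if "0 \<le> t" "t \<le> T1" for t x
    proof -
      have "W t x \<le> ennreal (c * ((a t * \<bar>V t x\<bar> powr p) powr \<beta> + (a t * \<bar>U t x\<bar> powr p) powr \<beta>))"
        unfolding W_def c_def by (intro ennreal_leI power_diff_kato(3) a0 aA that) auto
      also have "\<dots> = ennreal c * (epow (f t x) \<beta> + epow (g t x) \<beta>)"
      proof -
        have "epow (f t x) \<beta> = ennreal ((a t * \<bar>V t x\<bar> powr p) powr \<beta>)"
          "epow (g t x) \<beta> = ennreal ((a t * \<bar>U t x\<bar> powr p) powr \<beta>)"
          unfolding f_def g_def using a0 by (auto intro!: epow_ennreal)
        then show ?thesis using c by (simp add: ennreal_mult)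
      qed
      finally have "ennreal (decay x) * W t x \<le> ennreal (decay x) * (ennreal c * (epow (f t x) \<beta> + epow (g t x) \<beta>))"
        by (rule mult_left_mono) simp
      then show ?thesis by (simp add: H_def algebra_simps)
    qed
    have "(\<integral>\<^sup>+t. indicator {\<tau>..T1} t * nn_heat (t - \<tau>) (\<lambda>x. ennreal (decay x) * W t x) y \<partial>lborel)
      \<le> (\<integral>\<^sup>+t. ennreal c * (indicator {\<tau>..T1} t * nn_heat (t - \<tau>) (H f t) y + indicator {\<tau>..T1} t * nn_heat (t - \<tau>) (H g t) y) \<partial>lborel)"
    proof (intro nn_integral_mono)
      fix t
      show "indicator {\<tau>..T1} t * nn_heat (t - \<tau>) (\<lambda>x. ennreal (decay x) * W t x) y
        \<le> ennreal c * (indicator {\<tau>..T1} t * nn_heat (t - \<tau>) (H f t) y + indicator {\<tau>..T1} t * nn_heat (t - \<tau>) (H g t) y)"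
      proof (cases "t \<in> {\<tau>..T1}")
        case True
        then have "nn_heat (t - \<tau>) (\<lambda>x. ennreal (decay x) * W t x) y \<le> nn_heat (t - \<tau>) (\<lambda>x. ennreal c * (H f t x + H g t x)) y"
          using \<tau> by (intro nn_heat_mono Wle) auto
        also have "\<dots> = ennreal c * (nn_heat (t - \<tau>) (H f t) y + nn_heat (t - \<tau>) (H g t) y)"
          using measurable_slice[OF Hm[OF f], of t] measurable_slice[OF Hm[OF g], of t]
          by (subst nn_heat_cmult) (auto simp: nn_heat_add)
        finally show ?thesis using True by simp
      qed simp
    qed
    also have "\<dots> = ennreal c * ((\<integral>\<^sup>+t. indicator {\<tau>..T1} t * nn_heat (t - \<tau>) (H f t) y \<partial>lborel) + (\<integral>\<^sup>+t. indicator {\<tau>..T1} t * nn_heat (t - \<tau>) (H g t) y \<partial>lborel))"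
      by (subst nn_integral_cmult) (auto simp: nn_integral_add)
    also have "\<dots> \<le> ennreal c * (ennreal K * ennreal (decay y) + ennreal K * ennreal (decay y))"
      unfolding H_def[abs_def] by (intro mult_left_mono add_mono kato1 f g f_bd g_bd \<tau>) auto
    also have "\<dots> = ennreal (2 * c * K) * ennreal (decay y)"
      using c K0 by (simp add: ennreal_mult[symmetric] ennreal_plus[symmetric] del: ennreal_plus)
    also have "\<dots> \<le> ennreal (1 / 2) * ennreal (decay y)"
      using small_kato by (intro mult_right_mono ennreal_leI) (auto simp: c_def K_def M_def)
    finally show ?thesis .
  qed
  \<comment> \<open>Since \<open>W z\<close> is at most \<open>4 p (f + g)\<close>, the test
    integral is finite as soon as those of both forces are, which follows from the
    \<open>L^q\<close> bounds at the final time \<open>T1\<close>.\<close>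
  have fin: "(\<integral>\<^sup>+t. indicator {0..T1} t * (\<integral>\<^sup>+x. ennreal (decay x) * (W t x * z t x) \<partial>lborel) \<partial>lborel) < top"
  proof -
    have T11: "T1 \<le> 1" using T1 T by simp
    have fin1: "(\<integral>\<^sup>+t. indicator {0..T1} t * (\<integral>\<^sup>+x. ennreal (decay x) * f t x \<partial>lborel) \<partial>lborel) < top"
      by (rule duhamel_decay_finite[OF f q T11 _ f_bd[OF T1(1) order_refl]]) simp
    have fin2: "(\<integral>\<^sup>+t. indicator {0..T1} t * (\<integral>\<^sup>+x. ennreal (decay x) * g t x \<partial>lborel) \<partial>lborel) < top"
      by (rule duhamel_decay_finite[OF g q T11 _ g_bd[OF T1(1) order_refl]]) simp
    define If Ig where "If t = (\<integral>\<^sup>+x. ennreal (decay x) * f t x \<partial>lborel)"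
      and "Ig t = (\<integral>\<^sup>+x. ennreal (decay x) * g t x \<partial>lborel)" for t
    note [measurable (raw)] = measurable_uncurry[OF f] measurable_uncurry[OF g]
    have [measurable]: "If \<in> borel_measurable borel" "Ig \<in> borel_measurable borel"
      unfolding If_def Ig_def by measurable
    have inner: "(\<integral>\<^sup>+x. ennreal (decay x) * (W t x * z t x) \<partial>lborel) \<le> ennreal (4 * p) * (If t + Ig t)" for t
    proof -
      have "(\<integral>\<^sup>+x. ennreal (decay x) * (W t x * z t x) \<partial>lborel)
        \<le> (\<integral>\<^sup>+x. ennreal (4 * p) * (ennreal (decay x) * f t x + ennreal (decay x) * g t x) \<partial>lborel)"
      proof (intro nn_integral_mono)
        fix x
        have "W t x * z t x \<le> ennreal ((p * a t * (\<bar>V t x\<bar> powr (p - 1) + \<bar>U t x\<bar> powr (p - 1))) * (\<bar>V t x\<bar> + \<bar>U t x\<bar>))"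
          unfolding W_def z_def using W0[of t x]
          by (simp only: ennreal_mult[symmetric] abs_ge_zero) (intro ennreal_leI mult_left_mono abs_triangle_ineq4)
        also have "\<dots> \<le> ennreal (4 * p * (a t * \<bar>V t x\<bar> powr p + a t * \<bar>U t x\<bar> powr p))"
          by (intro ennreal_leI power_diff_kato(2) a0) auto
        also have "\<dots> = ennreal (4 * p) * (f t x + g t x)"
          using p a0[of t] by (simp add: f_def g_def ennreal_mult)
        finally have "ennreal (decay x) * (W t x * z t x) \<le> ennreal (decay x) * (ennreal (4 * p) * (f t x + g t x))"
          by (rule mult_left_mono) simp
        then show "ennreal (decay x) * (W t x * z t x) \<le> ennreal (4 * p) * (ennreal (decay x) * f t x + ennreal (decay x) * g t x)"
          by (simp add: algebra_simps)
      qed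
      also have "\<dots> = ennreal (4 * p) * (If t + Ig t)"
        using measurable_slice[OF f, of t] measurable_slice[OF g, of t]
        unfolding If_def Ig_def by (subst nn_integral_cmult) (auto simp: nn_integral_add)
      finally show ?thesis .
    qed
    have "(\<integral>\<^sup>+t. indicator {0..T1} t * (\<integral>\<^sup>+x. ennreal (decay x) * (W t x * z t x) \<partial>lborel) \<partial>lborel)
      \<le> (\<integral>\<^sup>+t. ennreal (4 * p) * (indicator {0..T1} t * If t + indicator {0..T1} t * Ig t) \<partial>lborel)"
    proof (intro nn_integral_mono)
      fix t
      have "indicator {0..T1} t * (\<integral>\<^sup>+x. ennreal (decay x) * (W t x * z t x) \<partial>lborel)
          \<le> indicator {0..T1} t * (ennreal (4 * p) * (If t + Ig t))"
        by (intro mult_left_mono inner) simp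
      then show "indicator {0..T1} t * (\<integral>\<^sup>+x. ennreal (decay x) * (W t x * z t x) \<partial>lborel)
          \<le> ennreal (4 * p) * (indicator {0..T1} t * If t + indicator {0..T1} t * Ig t)"
        by (simp add: algebra_simps)
    qed
    also have "\<dots> = ennreal (4 * p) * ((\<integral>\<^sup>+t. indicator {0..T1} t * If t \<partial>lborel) + (\<integral>\<^sup>+t. indicator {0..T1} t * Ig t \<partial>lborel))"
      by (subst nn_integral_cmult) (auto simp: nn_integral_add)
    also have "\<dots> < top"
      using fin1 fin2 by (simp add: If_def Ig_def ennreal_mult_less_top)
    finally show ?thesis .
  qed
  show thesis
  proof (rule that[OF U])
    show "ennreal \<bar>U t x\<bar> \<le> 2 * B t x" if "0 \<le> t" "t \<le> T1" for t x
      by (rule G.admissible_le[OF adm that])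
    show "U t x = h t x + enn2real (duhamel 0 t (\<lambda>\<tau> y. ennreal (a \<tau> * \<bar>U \<tau> y\<bar> powr p)) x)"
      if "0 \<le> t" "t \<le> T1" "B t x < top" for t x
      using Ufix[OF that] by (simp add: G.mild_map_def G.force_def[abs_def])
    show "AE x in lborel. V t x = U t x" if t: "0 \<le> t" "t \<le> T1" for t
    proof -
      have "AE x in lborel. z t x = 0"
        by (rule duhamel_gronwall_zero[OF z W kato AEeq fin t])
      then show ?thesis by eventually_elim (simp add: z_def)
    qed
  qed
qed

lemma mild_solution_eq_regular:
  assumes u: "regular_solution u"
    and v: "continuous_Lq q T v" "mild_solution q \<alpha> p \<rho> w u0 T v"
    and T1: "0 \<le> T1" "T1 \<le> T" and bound: "\<And>t. 0 \<le> t \<Longrightarrow> t \<le> T1 \<Longrightarrow> Lq_norm q (v t) \<le> 2 * b + 1"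
    and t: "0 \<le> t" "t \<le> T1"
  shows "AE x in lborel. v t x = u t x"
proof -
  have vL: "v t \<in> Lq q" if "0 \<le> t" "t \<le> T" for t
    using v(1) that by (auto simp: continuous_Lq_def)
  obtain V where V: "case_prod V \<in> borel_measurable (borel \<Otimes>\<^sub>M borel)"
    and Vv: "\<And>t. t \<in> {0..T} \<Longrightarrow> AE x in lborel. V t x = v t x"
    using continuous_Lq_measurable_version[OF v(1) q] by blast
  have Vm: "V t \<in> borel_measurable borel" for t by (rule measurable_slice[OF V])
  have norm_eq: "Lq_norm q (V t) = Lq_norm q (v t)" if "0 \<le> t" "t \<le> T" for t
    by (rule Lq_norm_cong_AE[OF Vv Vm Lq_measurable[OF vL[OF that]]]) (use that in simp)
  have VL: "V t \<in> Lq q" if "0 \<le> t" "t \<le> T" for t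
    by (rule Lq_cong_AE[OF _ vL[OF that] Vm]) (use Vv[of t] that in auto)
  define a where "a \<tau> = Lq_norm q (V \<tau>) powr \<alpha>" for \<tau>
  have a: "a \<in> borel_measurable borel"
    unfolding a_def using measurable_Lq_norm[OF V] by measurable
  have aA: "a \<tau> \<le> A" if "0 \<le> \<tau>" "\<tau> \<le> T1" for \<tau>
    unfolding a_def A using bound[OF that] norm_eq[of \<tau>] that T1(2) \<alpha> by (intro powr_mono2) auto
  define F' where "F' \<tau> y = a \<tau> * \<bar>V \<tau> y\<bar> powr p" for \<tau> y
  have F': "case_prod F' \<in> borel_measurable (borel \<Otimes>\<^sub>M borel)"
  proof -
    note [measurable (raw)] = measurable_uncurry[OF V]
    note [measurable] = measurable_compose[OF measurable_fst a]
    have "(\<lambda>z. F' (fst z) (snd z)) \<in> borel_measurable (borel \<Otimes>\<^sub>M borel)"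
      unfolding F'_def by measurable
    then show ?thesis by (simp add: split_beta')
  qed
  define F where "F \<tau> = nonlinearity q \<alpha> p (v \<tau>)" for \<tau>
  have F_eq: "F \<tau> y = Lq_norm q (v \<tau>) powr \<alpha> * \<bar>v \<tau> y\<bar> powr p" for \<tau> y
    by (simp add: F_def nonlinearity_def)
  have F_nonneg: "0 \<le> F \<tau> y" for \<tau> y by (simp add: F_eq)
  have eq: "AE x in lborel. duhamel 0 t (\<lambda>\<tau> y. ennreal (a \<tau> * \<bar>V \<tau> y\<bar> powr p)) x < top \<and>
      V t x = h t x + enn2real (duhamel 0 t (\<lambda>\<tau> y. ennreal (a \<tau> * \<bar>V \<tau> y\<bar> powr p)) x)"
    if t: "0 \<le> t" "t \<le> T1" for t
  proof -
    have tT: "t \<in> {0..T}" using t T1 by auto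
    have Fm: "F \<tau> \<in> borel_measurable borel" if "\<tau> \<in> {0..t}" for \<tau>
    proof -
      have [measurable]: "v \<tau> \<in> borel_measurable borel"
        using that tT by (intro Lq_measurable[OF vL]) auto
      show ?thesis unfolding F_def nonlinearity_def by measurable
    qed
    have FF': "AE y in lborel. F' \<tau> y = F \<tau> y" if "\<tau> \<in> {0..t}" for \<tau>
    proof -
      have "\<tau> \<in> {0..T}" using that tT by auto
      from Vv[OF this] show ?thesis
        by eventually_elim (use norm_eq[of \<tau>] \<open>\<tau> \<in> {0..T}\<close> in \<open>simp add: F'_def F_eq a_def\<close>)
    qed
    show ?thesis
      using v(2)[unfolded mild_solution_def, rule_format, OF tT] B_finite[of t] Vv[OF tT]
    proof eventually_elim
      case (elim x)
      have def: "AE \<tau> in lborel. \<tau> \<in> {0..t} \<longrightarrow> heat_semigroup_defined (t - \<tau>) (F \<tau>) x"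
        using elim(1) unfolding F_def by (auto elim!: eventually_mono)
      have int: "set_integrable lborel {0..t} (\<lambda>\<tau>. heat_semigroup (t - \<tau>) (F \<tau>) x)"
        using elim(1) unfolding F_def by blast
      note S = set_integral_eq_duhamel[OF F' Fm F_nonneg FF' def int]
      have "linear_majorant \<rho> u0 w t x < top"
        using B_linear[of t x] tT T(2) elim by auto
      note L = linear_flow_eq(2)[OF u0 w q t(1) this]
      show ?case
        using elim S L by (simp add: h_def F_def[symmetric] F'_def)
    qed
  qed
  obtain U where U: "case_prod U \<in> borel_measurable (borel \<Otimes>\<^sub>M borel)"
    and U_le: "\<And>t x. 0 \<le> t \<Longrightarrow> t \<le> T1 \<Longrightarrow> ennreal \<bar>U t x\<bar> \<le> 2 * B t x"
    and U_fix: "\<And>t x. 0 \<le> t \<Longrightarrow> t \<le> T1 \<Longrightarrow> B t x < top \<Longrightarrow>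
      U t x = h t x + enn2real (duhamel 0 t (\<lambda>\<tau> y. ennreal (a \<tau> * \<bar>U \<tau> y\<bar> powr p)) x)"
    and VU: "\<And>t. 0 \<le> t \<Longrightarrow> t \<le> T1 \<Longrightarrow> AE x in lborel. V t x = U t x"
    using frozen_unique[OF T1 V _ _ a _ aA eq] VL norm_eq bound T1(2) by (auto simp: a_def)
  have aU: "a \<tau> = Lq_norm q (U \<tau>) powr \<alpha>" if "0 \<le> \<tau>" "\<tau> \<le> T1" for \<tau>
    unfolding a_def using Lq_norm_cong_AE[OF VU[OF that] Vm measurable_slice[OF U]] by simp
  interpret N: duhamel_contraction B p T1 A \<Lambda> "C * T powr (1 - \<kappa>)" "\<lambda>_ U. Lq_norm q U powr \<alpha>" h
    by (rule nonlocal_contraction[OF T1(2)])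
  have admU: "N.admissible U" using U U_le by (simp add: N.admissible_def)
  have admu: "N.admissible u" using u T1(2) by (auto simp: N.admissible_def regular_solution_def)
  have main: "U t x = u t x" if "B t x < top" for x
  proof (rule N.fixed_points_eq[OF admU admu _ _ t that])
    fix s y assume s: "0 \<le> s" "s \<le> T1" and fin: "B s y < top"
    \<comment> \<open>\<open>a\<close> is the coefficient of \<open>U\<close> only on [0, T1], which
      is all that the integral up to \<open>s\<close> sees.\<close>
    have "duhamel 0 s (\<lambda>\<tau> y. ennreal (a \<tau> * \<bar>U \<tau> y\<bar> powr p)) y = duhamel 0 s (N.force U) y"
      using s by (intro duhamel_cong_AE) (auto simp: aU N.force_def)
    then show "U s y = N.mild_map U s y"
      using U_fix[OF s fin] by (simp add: N.mild_map_def)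
    show "u s y = N.mild_map u s y"
      using u s T1(2) fin by (simp add: regular_solution_def N.mild_map_def N.force_def[abs_def])
  qed
  have "t \<in> {0..T}" using t T1(2) by simp
  from Vv[OF this] VU[OF t] B_finite[of t] show ?thesis
    by eventually_elim (use main in auto)
qed

section \<open>Continuation: a bound for arbitrary solutions\<close>

lemma mild_solution_at_0:
  assumes v: "continuous_Lq q T v" "mild_solution q \<alpha> p \<rho> w u0 T v"
  shows "Lq_norm q (v 0) \<le> b"
proof -
  have 0: "0 \<in> {0..T}" using T(1) by simp
  have vL: "v 0 \<in> Lq q" using v(1) 0 by (simp add: continuous_Lq_def)
  have null: "(LINT \<tau>:{0..0}|lborel. g \<tau>) = 0" for g :: "real \<Rightarrow> real"
  proof -
    have "AE \<tau> in lborel. \<tau> \<noteq> (0 :: real)" by (rule AE_lborel_singleton)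
    then show ?thesis
      unfolding set_lebesgue_integral_def by (intro integral_eq_zero_AE) (auto elim!: eventually_mono)
  qed
  have "AE x in lborel. v 0 x = u0 x"
    using v(2)[unfolded mild_solution_def, rule_format, OF 0]
    by eventually_elim (simp add: null del: atLeastAtMost_singleton)
  then have "Lq_norm q (v 0) = Lq_norm q u0"
    by (rule Lq_norm_cong_AE[OF _ Lq_measurable[OF vL] Lq_measurable[OF u0]])
  also have "\<dots> \<le> 1 * b"
  proof (rule Lq_norm_le_majorant(2)[OF Lq_measurable[OF u0]])
    have "ennreal \<bar>u0 x\<bar> \<le> B 0 x" for x
    proof -
      have "ennreal \<bar>u0 x\<bar> \<le> linear_majorant \<rho> u0 w 0 x" by (simp add: linear_majorant_def)
      also have "\<dots> \<le> B 0 x" by (rule B_linear) simp_all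
      finally show ?thesis .
    qed
    then show "AE x in lborel. ennreal \<bar>u0 x\<bar> \<le> ennreal 1 * B 0 x" by simp
  qed simp
  finally show ?thesis by simp
qed

text \<open>Let \<open>s\<close> be the infimum of the times at which the bound fails. It holds on
  \<open>[0, s]\<close>, at \<open>s\<close> itself by continuity from the left or, if
  \<open>s = 0\<close>, by the initial condition. There \<open>v\<close> equals \<open>u\<close>, so
  its norm is at most \<open>2 b\<close>, and continuity keeps it below \<open>2 b + 1\<close>
  shortly after \<open>s\<close>, a contradiction.\<close>

lemma mild_solution_bound:
  assumes u: "regular_solution u"
    and v: "continuous_Lq q T v" "mild_solution q \<alpha> p \<rho> w u0 T v"
    and t: "0 \<le> t" "t \<le> T"
  shows "Lq_norm q (v t) \<le> 2 * b + 1"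
proof (rule ccontr)
  assume not: "\<not> ?thesis"
  have vL: "v t \<in> Lq q" if "0 \<le> t" "t \<le> T" for t
    using v(1) that by (auto simp: continuous_Lq_def)
  define S where "S = {t \<in> {0..T}. 2 * b + 1 < Lq_norm q (v t)}"
  define s where "s = Inf S"
  have tS: "t \<in> S" using not t by (simp add: S_def)
  have bdd: "bdd_below S" by (intro bdd_belowI[of _ 0]) (auto simp: S_def)
  have s: "0 \<le> s" "s \<le> T"
    using cInf_lower[OF tS bdd] t tS unfolding s_def by (auto intro!: cInf_greatest simp: S_def)
  have below: "Lq_norm q (v r) \<le> 2 * b + 1" if "0 \<le> r" "r < s" for r
  proof (rule ccontr)
    assume "\<not> ?thesis"
    then have "r \<in> S" using that s by (simp add: S_def)
    then have "s \<le> r" unfolding s_def by (rule cInf_lower[OF _ bdd])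
    with that show False by simp
  qed
  have near: "\<exists>d>0. \<forall>r. 0 \<le> r \<longrightarrow> r \<le> T \<longrightarrow> \<bar>r - s\<bar> < d \<longrightarrow> \<bar>Lq_norm q (v r) - Lq_norm q (v s)\<bar> < \<eta>" if \<eta>: "0 < \<eta>" for \<eta>
  proof -
    obtain d where d: "0 < d" "\<And>r. r \<in> {0..T} \<Longrightarrow> \<bar>r - s\<bar> < d \<Longrightarrow> Lq_norm q (\<lambda>x. v r x - v s x) < \<eta>"
      using v(1) s \<eta> unfolding continuous_Lq_iff by (meson atLeastAtMost_iff)
    have "\<bar>Lq_norm q (v r) - Lq_norm q (v s)\<bar> < \<eta>" if "0 \<le> r" "r \<le> T" "\<bar>r - s\<bar> < d" for r
      using Lq_norm_diff_le[OF vL[OF that(1,2)] vL[OF s] q] d(2)[of r] that by simp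
    with d(1) show ?thesis by blast
  qed
  have at_s: "Lq_norm q (v s) \<le> 2 * b + 1"
  proof (cases "s = 0")
    case True
    then show ?thesis using mild_solution_at_0[OF v] b(1) by simp
  next
    case False
    show ?thesis
    proof (rule field_le_epsilon)
      fix \<eta> :: real assume "0 < \<eta>"
      from near[OF this] obtain d where d: "0 < d"
        "\<And>r. 0 \<le> r \<Longrightarrow> r \<le> T \<Longrightarrow> \<bar>r - s\<bar> < d \<Longrightarrow> \<bar>Lq_norm q (v r) - Lq_norm q (v s)\<bar> < \<eta>" by blast
      define r where "r = max 0 (s - d / 2)"
      have r: "0 \<le> r" "r < s" "r \<le> T" "\<bar>r - s\<bar> < d" using False s d(1) by (auto simp: r_def)
      show "Lq_norm q (v s) \<le> 2 * b + 1 + \<eta>"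
        using d(2)[OF r(1,3,4)] below[OF r(1,2)] by linarith
    qed
  qed
  \<comment> \<open>The bound on the closed interval is exactly the hypothesis needed here; the
    equality then improves \<open>2 b + 1\<close> to \<open>2 b\<close> at time
    \<open>s\<close>.\<close>
  have "AE x in lborel. v s x = u s x"
    using below at_s s by (intro mild_solution_eq_regular[OF u v s _ s(1) order_refl]) (auto simp: le_less)
  then have "Lq_norm q (v s) = Lq_norm q (u s)"
    using u by (intro Lq_norm_cong_AE Lq_measurable[OF vL[OF s]] measurable_slice) (auto simp: regular_solution_def)
  also have "\<dots> \<le> 2 * b"
    using u s by (intro Lq_norm_le_2b(2)[of _ s] measurable_slice) (auto simp: regular_solution_def)
  finally have vs: "Lq_norm q (v s) \<le> 2 * b" .
  from near[of 1] obtain d where d: "0 < d"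
    "\<And>r. 0 \<le> r \<Longrightarrow> r \<le> T \<Longrightarrow> \<bar>r - s\<bar> < d \<Longrightarrow> \<bar>Lq_norm q (v r) - Lq_norm q (v s)\<bar> < 1" by auto
  \<comment> \<open>There are bad times in \<open>[s, s + d)\<close>; at such a time the norm
    exceeds \<open>2 b + 1\<close> although it differs by less than 1 from a value at most
    \<open>2 b\<close>.\<close>
  have "Inf S < s + d" using d(1) by (simp add: s_def)
  then obtain r where r: "r \<in> S" "r < s + d"
    using cInf_less_iff[of S "s + d"] tS bdd by blast
  have "s \<le> r" unfolding s_def by (rule cInf_lower[OF r(1) bdd])
  then show False
    using d(2)[of r] r vs by (auto simp: S_def)
qed

lemma mild_solution_unique:
  assumes u: "regular_solution u"
    and v: "continuous_Lq q T v" "mild_solution q \<alpha> p \<rho> w u0 T v"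
    and t: "t \<in> {0..T}"
  shows "AE x in lborel. v t x = u t x"
  using t T(1) by (intro mild_solution_eq_regular[OF u v, of T] mild_solution_bound[OF u v]) auto

end

section \<open>Choice of the constants and of the existence time\<close>

theorem theorem1p1:
  fixes p q \<alpha> \<rho> :: real
    and u0 w :: "real ^ 'n \<Rightarrow> real"
  assumes "p > 1" and "q \<ge> 1" and "\<alpha> \<ge> 1" and "\<rho> > -1"
    and "q > real CARD('n) * (p - 1) / 2"
    and "u0 \<in> Lq q" and "w \<in> Lq q"
  shows "\<exists>T>0. \<exists>u. continuous_Lq q T u \<and> mild_solution q \<alpha> p \<rho> w u0 T u \<and>
           (\<forall>v. continuous_Lq q T v \<and> mild_solution q \<alpha> p \<rho> w u0 T v \<longrightarrow>
              (\<forall>t\<in>{0..T}. AE x in lborel. v t x = u t x))"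
proof -
  define \<kappa> where "\<kappa> = real CARD('n) * (p - 1) / (2 * q)"
  have \<kappa>: "\<kappa> < 1" using assms(2,5) by (simp add: \<kappa>_def field_simps)
  obtain B :: "real \<Rightarrow> real ^ 'n \<Rightarrow> ennreal" and b' C :: real
    where B: "case_prod B \<in> borel_measurable (borel \<Otimes>\<^sub>M borel)"
      "\<And>t x. 0 \<le> t \<Longrightarrow> t \<le> 1 \<Longrightarrow> linear_majorant \<rho> u0 w t x \<le> B t x"
      and b': "0 \<le> b'" "\<And>t. (\<integral>\<^sup>+x. epow (B t x) q \<partial>lborel) \<le> ennreal b'"
      and C: "0 \<le> C" "\<And>a t x. a \<le> t \<Longrightarrow> duhamel a t (\<lambda>\<tau> y. epow (B \<tau> y) p) x
        \<le> ennreal (C * (t - a) powr (1 - \<kappa>)) * B t x"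
    using majorant_exists[OF assms(1,2,4) _ assms(6,7)] \<kappa> unfolding \<kappa>_def by metis
  define b where "b = b' powr (1 / q)"
  have b: "0 \<le> b" "b powr q = b'" using b'(1) assms(2) by (auto simp: b_def powr_powr)
  have B_norm: "(\<integral>\<^sup>+x. epow (B t x) q \<partial>lborel) \<le> ennreal (b powr q)" for t
    unfolding b(2) by (rule b')
  define \<beta> e A \<Lambda> where "\<beta> = (p - 1) / p" and "e = 1 - \<beta> - real CARD('n) * \<beta> / (2 * q)"
    and "A = (2 * b + 1) powr \<alpha>" and "\<Lambda> = \<alpha> * (2 * b + 1) powr (\<alpha> - 1) * b"
  have "e = (1 - \<kappa>) / p"
    unfolding e_def \<kappa>_def \<beta>_def using assms(1,2) by (simp add: divide_simps)
  then have e: "0 < e" using \<kappa> assms(1) by simp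
  have half: "(1 / 2 :: real) powr e < 1" using e powr_less_mono2[of e "1 / 2" 1] by simp
  have A: "0 < A" and \<Lambda>: "0 \<le> \<Lambda>" using b(1) assms(3) by (auto simp: A_def \<Lambda>_def)
  \<comment> \<open>The left sides of the three smallness conditions without their power of
    \<open>T\<close>. They do not depend on \<open>T\<close>, since \<open>B\<close>,
    \<open>b\<close> and \<open>C\<close> were fixed before it.\<close>
  define c1 c2 c3 where "c1 = C * (A * 2 powr p)" and "c2 = C * (\<Lambda> * 2 powr p + A * p * 2 powr p)"
    and "c3 = 2 * (p * A powr (1 / p)) * (2 powr (real CARD('n) / 2) * exp (2 * real CARD('n)) *
      (3 powr (real CARD('n) / 2 * \<beta>) * (3 * b + 1) powr \<beta> * (1 / (1 - (1 / 2) powr e))))"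
  have c: "0 \<le> c1" "0 \<le> c2" "0 \<le> c3"
    using C(1) A \<Lambda> assms(1) half by (simp_all add: c1_def c2_def c3_def)
  obtain T1 where T1: "0 < T1" "\<And>T. 0 \<le> T \<Longrightarrow> T \<le> T1 \<Longrightarrow> c1 * T powr (1 - \<kappa>) \<le> 1"
    using powr_vanishes_at_0[of "1 - \<kappa>" c1 1] \<kappa> c by auto
  obtain T2 where T2: "0 < T2" "\<And>T. 0 \<le> T \<Longrightarrow> T \<le> T2 \<Longrightarrow> c2 * T powr (1 - \<kappa>) \<le> 1 / 2"
    using powr_vanishes_at_0[of "1 - \<kappa>" c2 "1 / 2"] \<kappa> c by auto
  obtain T3 where T3: "0 < T3" "\<And>T. 0 \<le> T \<Longrightarrow> T \<le> T3 \<Longrightarrow> c3 * T powr e \<le> 1 / 2"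
    using powr_vanishes_at_0[of e c3 "1 / 2"] e c by auto
  \<comment> \<open>At most 1, because the majorant dominates the linear evolution only on [0, 1]
    and the weighted kernel estimates are stated for times up to 1.\<close>
  define T where "T = min 1 (min T1 (min T2 T3))"
  have T: "0 < T" "T \<le> 1" "T \<le> T1" "T \<le> T2" "T \<le> T3" using T1(1) T2(1) T3(1) by (auto simp: T_def)
  interpret heat_problem p q \<alpha> \<rho> \<kappa> \<beta> e A \<Lambda> b C T u0 w B
  proof
    show "C * T powr (1 - \<kappa>) * (A * 2 powr p) \<le> 1"
      using T1(2)[of T] T by (simp add: c1_def mult_ac)
    have "c2 * T powr (1 - \<kappa>) \<le> 1 / 2" using T2(2)[of T] T by simp
    moreover have "C * T powr (1 - \<kappa>) * (\<Lambda> * 2 powr p + A * p * 2 powr p) = c2 * T powr (1 - \<kappa>)"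
      by (simp only: c2_def mult_ac)
    ultimately show "C * T powr (1 - \<kappa>) * (\<Lambda> * 2 powr p + A * p * 2 powr p) \<le> 1 / 2" by (simp only:)
    have "c3 * T powr e \<le> 1 / 2" using T3(2)[of T] T by simp
    moreover have "2 * (p * A powr (1 / p)) * (2 powr (real CARD('n) / 2) * exp (2 * real CARD('n)) *
      (3 powr (real CARD('n) / 2 * \<beta>) * (3 * b + 1) powr \<beta> * (T powr e / (1 - (1 / 2) powr e)))) = c3 * T powr e"
      by (simp add: c3_def)
    ultimately show "2 * (p * A powr (1 / p)) * (2 powr (real CARD('n) / 2) * exp (2 * real CARD('n)) *
      (3 powr (real CARD('n) / 2 * \<beta>) * (3 * b + 1) powr \<beta> * (T powr e / (1 - (1 / 2) powr e)))) \<le> 1 / 2" by simp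
  qed (fact assms \<kappa> \<kappa>_def \<beta>_def e_def A_def \<Lambda>_def B b(1) B_norm C T)+
  obtain u where "regular_solution u" using regular_solution_exists by blast
  then show ?thesis
    using T(1) regular_solution_mild mild_solution_unique by blast
qed

end
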